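(* Let $\alpha_2,\vartheta\in\mathbb{R}\setminus\{0\}$. (1) (Steep domain wall transitions.) Let $\chi$ be a domain wall function and, for $\varepsilon>0$, define $$\mathfrak{S}^\varepsilon(0)=-\alpha_2P_X^2\sigma_2+\vartheta\chi_\varepsilon(X)\sigma_3,\qquad\chi_\varepsilon(X)=\chi(X/\varepsilon),$$ acting in $L^2(\mathbb{R};\mathbb{C}^2)$. Then, for $\varepsilon>0$ sufficiently small, $\mathfrak{S}^\varepsilon(0)$ has at least two nonzero eigenvalues $\Omega^\varepsilon_{+1}>0$ and $\Omega^\varepsilon_{-1}=-\Omega^\varepsilon_{+1}$ within its spectral gap $(-|\vartheta|,|\vartheta|)$. (2) (Explicitly solvable model.) Let $\mathfrak{S}(0)=-\alpha_2P_X^2\sigma_2+\vartheta\,\mathrm{sgn}(X)\sigma_3$ acting in $L^2(\mathbb{R};\mathbb{C}^2)$. Then $\mathfrak{S}(0)$ has two explicit bound state eigenpairs in its spectral gap, obtained by solving the constant-coefficient equations for $X>0$ and $X<0$ and imposing matching conditions (continuity of the eigenfunction and its first derivative) across $X=0$.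
   Context: $P_X=-i\partial_X$, $\sigma_2=\begin{bmatrix}0&-i\\i&0\end{bmatrix}$, $\sigma_3=\begin{bmatrix}1&0\\0&-1\end{bmatrix}$. A domain wall function is a smooth real-valued function $\chi$ on $\mathbb{R}$ with $\chi(X)\to\pm1$ as $X\to\pm\infty$. The operators are self-adjoint with domain $H^2(\mathbb{R};\mathbb{C}^2)$; the gap in their essential spectra is $(-|\vartheta|,|\vartheta|)$. No assumption is made on the sign of $\int_{\mathbb{R}}(\chi^2-1)\,dX$. A bound state is an $L^2(\mathbb{R};\mathbb{C}^2)$ eigenfunction. *)

theory Defs
  imports "HOL-Analysis.Analysis"
begin

definition sigma2 :: "complex^2^2" where
  "sigma2 = vector [vector [0, - \<i>], vector [\<i>, 0]]"

definition sigma3 :: "complex^2^2" where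
  "sigma3 = vector [vector [1, 0], vector [0, - 1]]"

definition smooth :: "(real \<Rightarrow> real) \<Rightarrow> bool" where
  "smooth f \<longleftrightarrow> (\<forall>n. (deriv ^^ n) f differentiable_on UNIV)"

definition domain_wall :: "(real \<Rightarrow> real) \<Rightarrow> bool" where
  "domain_wall w \<longleftrightarrow>
     smooth w \<and> (w \<longlongrightarrow> 1) at_top \<and> (w \<longlongrightarrow> - 1) at_bot"

(* Elements of L^2(R; C^2) are represented by Borel functions; functions that agree
   almost everywhere represent the same element. *)
definition L2 :: "(real \<Rightarrow> complex^2) set" where
  "L2 = {\<psi>. \<psi> \<in> borel_measurable lborel \<and> integrable lborel (\<lambda>X. (norm (\<psi> X))\<^sup>2)}"

definition test_function :: "(real \<Rightarrow> real) \<Rightarrow> bool" where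
  "test_function \<phi> \<longleftrightarrow> smooth \<phi> \<and> compact (closure {X. \<phi> X \<noteq> 0})"

definition weak_derivative :: "(real \<Rightarrow> complex^2) \<Rightarrow> (real \<Rightarrow> complex^2) \<Rightarrow> bool" where
  "weak_derivative \<psi> g \<longleftrightarrow>
     (\<forall>\<phi>. test_function \<phi> \<longrightarrow>
        (LINT X|lborel. deriv \<phi> X *\<^sub>R \<psi> X) = - (LINT X|lborel. \<phi> X *\<^sub>R g X))"

(* Unbounded operators on L^2 are given by their graphs: T \<psi> f means that \<psi> lies in the
   domain of T and T \<psi> = f in L^2. *)
type_synonym operator_graph = "(real \<Rightarrow> complex^2) \<Rightarrow> (real \<Rightarrow> complex^2) \<Rightarrow> bool"

(* P = -i d/dX, with domain H^1. *)
definition momentum :: operator_graph where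
  "momentum \<psi> f \<longleftrightarrow> \<psi> \<in> L2 \<and> f \<in> L2 \<and>
     (\<exists>g. weak_derivative \<psi> g \<and> (AE X in lborel. f X = (- \<i>) *s g X))"

(* The variable w stands for the domain wall function chi (a binder in HOL-Analysis).
   S = - \<alpha>2 P^2 sigma2 + \<theta> w(X) sigma3. Requiring P \<psi> and P (P \<psi>) to exist in L^2 makes the
   domain H^2(R; C^2) whenever w is bounded and measurable. *)
definition S_op :: "real \<Rightarrow> real \<Rightarrow> (real \<Rightarrow> real) \<Rightarrow> operator_graph" where
  "S_op \<alpha>2 \<theta> w \<psi> f \<longleftrightarrow> f \<in> L2 \<and>
     (\<exists>\<psi>1 \<psi>2. momentum \<psi> \<psi>1 \<and> momentum \<psi>1 \<psi>2 \<and>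
        (AE X in lborel. f X = (- \<alpha>2) *\<^sub>R (sigma2 *v \<psi>2 X) + (\<theta> * w X) *\<^sub>R (sigma3 *v \<psi> X)))"

definition eigenpair :: "operator_graph \<Rightarrow> real \<Rightarrow> (real \<Rightarrow> complex^2) \<Rightarrow> bool" where
  "eigenpair T \<Omega> \<psi> \<longleftrightarrow>
     \<not> (AE X in lborel. \<psi> X = 0) \<and> T \<psi> (\<lambda>X. \<Omega> *\<^sub>R \<psi> X)"

definition eigenvalue :: "operator_graph \<Rightarrow> real \<Rightarrow> bool" where
  "eigenvalue T \<Omega> \<longleftrightarrow> (\<exists>\<psi>. eigenpair T \<Omega> \<psi>)"

definition spectral_gap :: "real \<Rightarrow> real set" where
  "spectral_gap \<theta> = {- \<bar>\<theta>\<bar> <..< \<bar>\<theta>\<bar>}"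

(* The constant-coefficient equations on the half-lines X > 0 and X < 0, in the classical
   sense, with \<psi> and its first derivative continuous across X = 0; P^2 \<psi> = - \<psi>''. *)
definition matched_solution :: "real \<Rightarrow> real \<Rightarrow> real \<Rightarrow> (real \<Rightarrow> complex^2) \<Rightarrow> bool" where
  "matched_solution \<alpha>2 \<theta> \<Omega> \<psi> \<longleftrightarrow> (\<exists>d\<psi> dd\<psi>.
     (\<forall>X. X \<noteq> 0 \<longrightarrow> (\<psi> has_vector_derivative d\<psi> X) (at X) \<and>
                    (d\<psi> has_vector_derivative dd\<psi> X) (at X)) \<and>
     (\<forall>X>0. (- \<alpha>2) *\<^sub>R (sigma2 *v (- dd\<psi> X)) + \<theta> *\<^sub>R (sigma3 *v \<psi> X) = \<Omega> *\<^sub>R \<psi> X) \<and>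
     (\<forall>X<0. (- \<alpha>2) *\<^sub>R (sigma2 *v (- dd\<psi> X)) - \<theta> *\<^sub>R (sigma3 *v \<psi> X) = \<Omega> *\<^sub>R \<psi> X) \<and>
     isCont \<psi> 0 \<and> isCont d\<psi> 0)"

(* The exponents of the solutions on the half-lines satisfy
   \<lambda>^4 = - (\<theta>^2 - \<Omega>^2) / \<alpha>2^2; they are (\<plusminus>1 \<plusminus> i) times this rate when \<Omega>^2 = \<theta>^2 / 2. *)
definition decay_rate :: "real \<Rightarrow> real \<Rightarrow> real" where
  "decay_rate \<alpha>2 \<theta> = sqrt (\<bar>\<theta>\<bar> / (2 * sqrt 2 * \<bar>\<alpha>2\<bar>))"

definition bound_profile :: "real \<Rightarrow> real \<Rightarrow> real" where
  "bound_profile k X =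
     (let \<delta> = sqrt 2 - 1 in
      if X \<ge> 0 then exp (- k * X) * (\<delta> * cos (k * X) + sin (k * X))
      else \<delta> * exp (k * X) * (cos (k * X) + \<delta> * sin (k * X)))"

(* Eigenpairs of the sgn model: eigenvalue \<theta> / sqrt 2 for the first eigenfunction and
   - \<theta> / sqrt 2 for the second, which is the first one with its components exchanged. *)
definition bound_state_1 :: "real \<Rightarrow> real \<Rightarrow> real \<Rightarrow> complex^2" where
  "bound_state_1 \<alpha>2 \<theta> X =
     (let u = bound_profile (decay_rate \<alpha>2 \<theta>) in
      vector [complex_of_real (u X), - \<i> * complex_of_real (sgn (\<alpha>2 * \<theta>) * u (- X))])"

definition bound_state_2 :: "real \<Rightarrow> real \<Rightarrow> real \<Rightarrow> complex^2" where
  "bound_state_2 \<alpha>2 \<theta> X =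
     (let u = bound_profile (decay_rate \<alpha>2 \<theta>) in
      vector [- \<i> * complex_of_real (sgn (\<alpha>2 * \<theta>) * u (- X)), complex_of_real (u X)])"

end

theory Submission
  imports Defs
begin

text \<open>
  Write \<open>\<psi> = u e1 + v e2\<close> with \<open>e2\<close> carrying the factor \<open>- i sgn (\<alpha>2 \<theta>)\<close>, and \<open>\<Omega> = \<theta> \<rho>\<close>.
  The eigenvalue equation becomes the real system \<open>u'' = - l (w + \<rho>) v\<close>, \<open>v'' = l (w - \<rho>) u\<close>
  with \<open>l = |\<theta>| / |\<alpha>2|\<close>; exchanging the components of \<open>\<psi>\<close> turns \<open>\<Omega>\<close> into \<open>- \<Omega>\<close>, so one
  positive eigenvalue suffices.

  For the sign function the system has constant coefficients on each half-line. A square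
  integrable solution keeps only the decaying exponentials, and matching at \<open>0\<close> leaves a
  linear system in \<open>(u 0, v 0)\<close> that is singular only for \<open>\<rho> = \<plusminus>1 / sqrt 2\<close>.

  A steep wall is treated as a perturbation of the sign function by a Lyapunov-Schmidt argument.
  The difference \<open>w (x / \<epsilon>) - sgn x\<close> is bounded on \<open>|x| \<le> R \<epsilon>\<close> and uniformly small outside, which
  makes it a small perturbation of the Green operator on exponentially weighted bounded
  continuous functions, without any rate of convergence of \<open>w\<close>. For every \<open>\<rho> = 1 / sqrt 2 + \<mu>\<close>
  with small \<open>\<mu>\<close> a contraction yields a decaying solution satisfying all matching conditions but
  one; the remaining defect is \<open>\<mu>\<close> times a quantity bounded away from \<open>0\<close> plus a small error, so
  it vanishes for some \<open>\<mu>\<close> by the intermediate value theorem.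
\<close>

section \<open>A perturbed fixed point with a scalar side condition\<close>

text \<open>The eigenvalues sit in a gap of an operator that is unbounded above and below, so no
  quadratic form is minimized; the solvable sign wall is the centre of a perturbation instead. Its
  number \<open>1 / sqrt 2\<close> arises as follows. Put
  \<open>c\<^sup>2 = (1 - \<rho>) / (1 + \<rho>)\<close>. For wall value 1 the combination
  \<open>u + i v / c\<close> satisfies a scalar equation \<open>z'' = 2 i r\<^sup>2 z\<close> with
  \<open>2 r\<^sup>2 = l (1 - \<rho>) / c\<close>. For wall value -1 the two coefficients change
  places, and \<open>c v + i u\<close> satisfies the same equation. Decay ties the slopes at 0 to
  the values there, and equating slopes from both sides gives \<open>2 u 0 = (1 / c - c) v 0\<close>
  and \<open>2 v 0 = (1 / c - c) u 0\<close>. Hence \<open>(1 / c - c)\<^sup>2 = 4\<close>, that is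
  \<open>c = sqrt 2 - 1\<close> or \<open>c = sqrt 2 + 1\<close>. As this system is singular exactly
  at the eigenvalue, a forcing is admissible only under a scalar condition, and the freedom in
  \<open>\<rho>\<close> has to pay for it. The coupling \<open>l\<close> is no obstacle: a dilation
  by \<open>k\<close> multiplies it by \<open>k\<^sup>2\<close> and otherwise changes only the width
  of the wall.\<close>

lemma scalar_balance_perturbation:
  fixes A :: "'a::{real_normed_vector, complete_space} \<Rightarrow> 'a" and a :: "'a \<Rightarrow> real" and y0 :: 'a
  assumes A: "linear A" and a: "linear a" and K0: "K > 0"
    and bA: "\<And>y. norm (A y) \<le> K * norm y" and ba: "\<And>y. \<bar>a y\<bar> \<le> K * norm y"
    and N: "a y0 > 0" and \<eta>: "\<eta> > 0"
  obtains d where "d > 0"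
    and "\<And>B b. linear B \<Longrightarrow> linear b \<Longrightarrow> (\<And>y. norm (B y) \<le> d * norm y) \<Longrightarrow>
          (\<And>y. \<bar>b y\<bar> \<le> d * norm y) \<Longrightarrow>
          \<exists>y \<mu>. \<bar>\<mu>\<bar> \<le> \<eta> \<and> y = y0 + \<mu> *\<^sub>R A y + B y \<and> \<mu> * a y + b y = 0"
proof -
  define Y where "Y = norm y0"
  have Y0: "Y > 0"
  proof -
    have "y0 \<noteq> 0" using N a linear_0 by fastforce
    thus ?thesis by (simp add: Y_def)
  qed
  \<comment> \<open>The three bounds keep \<open>\<mu>\<close> within \<open>\<eta>\<close>, make
    the map a contraction with constant 1/2 (together with \<open>d \<le> h * K\<close>), and keep
    \<open>a\<close> above half of \<open>a y0\<close> on the fixed points.\<close>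
  define h where "h = min \<eta> (min (1 / (4*K)) (a y0 / (8*K*K*Y)))"
  have h0: "h > 0" using \<eta> K0 N Y0 by (simp add: h_def)
  have hK: "h * K \<le> 1/4"
  proof -
    have "h \<le> 1/(4*K)" by (simp add: h_def)
    thus ?thesis using K0 by (simp add: field_simps)
  qed
  have hN: "h * K * K * Y * 4 \<le> a y0 / 2"
  proof -
    have "h \<le> a y0 / (8*K*K*Y)" by (simp add: h_def)
    hence "h * (8*K*K*Y) \<le> a y0" using K0 Y0 by (simp add: field_simps)
    thus ?thesis by (simp add: algebra_simps)
  qed
  \<comment> \<open>The first bound lets \<open>B\<close> share the contraction constant; the second
    keeps \<open>b\<close> at a fixed point, whose norm is at most \<open>2 * Y\<close>, within a
    quarter of \<open>h * a y0\<close>. Neither involves \<open>B\<close> or \<open>b\<close>, so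
    one \<open>d\<close> serves every perturbation.\<close>
  define d where "d = min (h*K) (h * a y0 / (8*Y))"
  have d0: "d > 0" using h0 K0 N Y0 by (simp add: d_def)
  show ?thesis
  proof (rule that[OF d0])
    fix B :: "'a \<Rightarrow> 'a" and b :: "'a \<Rightarrow> real"
    assume B: "linear B" and b: "linear b"
      and bB: "\<And>y. norm (B y) \<le> d * norm y" and bb: "\<And>y. \<bar>b y\<bar> \<le> d * norm y"
    have contr: "norm (\<mu> *\<^sub>R A y + B y) \<le> (\<bar>\<mu>\<bar> * K + d) * norm y" for \<mu> y
    proof -
      have "norm (\<mu> *\<^sub>R A y + B y) \<le> \<bar>\<mu>\<bar> * norm (A y) + norm (B y)"
        by (metis norm_scaleR norm_triangle_ineq)
      also have "\<dots> \<le> \<bar>\<mu>\<bar> * (K * norm y) + d * norm y"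
        using bA bB by (intro add_mono mult_left_mono) auto
      finally show ?thesis by (simp add: algebra_simps)
    qed
    have q: "\<bar>\<mu>\<bar> * K + d \<le> 2*(h*K)" if "\<bar>\<mu>\<bar> \<le> h" for \<mu>
    proof -
      have "\<bar>\<mu>\<bar> * K \<le> h * K" using that K0 by (simp add: mult_right_mono)
      moreover have "d \<le> h*K" by (simp add: d_def)
      ultimately show ?thesis by simp
    qed
    have half: "norm (\<mu> *\<^sub>R A y + B y) \<le> 1/2 * norm y" if "\<bar>\<mu>\<bar> \<le> h" for \<mu> y
    proof -
      have "(\<bar>\<mu>\<bar> * K + d) * norm y \<le> 1/2 * norm y"
        using q[OF that] hK by (intro mult_right_mono) auto
      thus ?thesis using contr[of \<mu> y] by linarith
    qed
    have lin: "linear (\<lambda>y. \<mu> *\<^sub>R A y + B y)" for \<mu>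
      using A B by (simp add: linear_compose_add linear_compose_scale_right)
    have "\<exists>y. y = y0 + (\<mu> *\<^sub>R A y + B y)" if \<mu>: "\<bar>\<mu>\<bar> \<le> h" for \<mu>
    proof -
      have "dist (y0 + (\<mu> *\<^sub>R A x + B x)) (y0 + (\<mu> *\<^sub>R A y + B y)) \<le> 1/2 * dist x y" for x y
      proof -
        have "dist (y0 + (\<mu> *\<^sub>R A x + B x)) (y0 + (\<mu> *\<^sub>R A y + B y))
            = norm (\<mu> *\<^sub>R A (x - y) + B (x - y))"
          using linear_diff[OF lin[of \<mu>], of x y] by (simp add: dist_norm)
        thus ?thesis using half[OF \<mu>, of "x - y"] by (simp add: dist_norm)
      qed
      hence "\<exists>!y. y0 + (\<mu> *\<^sub>R A y + B y) = y"
        by (intro banach_fix_type[where c = "1/2"]) auto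
      thus ?thesis by metis
    qed
    then obtain Z where Z: "\<And>\<mu>. \<bar>\<mu>\<bar> \<le> h \<Longrightarrow> Z \<mu> = y0 + (\<mu> *\<^sub>R A (Z \<mu>) + B (Z \<mu>))" by metis
    have Zb: "norm (Z \<mu>) \<le> 2 * Y" if \<mu>: "\<bar>\<mu>\<bar> \<le> h" for \<mu>
    proof -
      have "norm (Z \<mu>) \<le> norm y0 + norm (\<mu> *\<^sub>R A (Z \<mu>) + B (Z \<mu>))"
        by (metis Z[OF \<mu>] norm_triangle_ineq)
      thus ?thesis using half[OF \<mu>, of "Z \<mu>"] by (simp add: Y_def)
    qed
    have Zd: "norm (Z \<mu> - y0) \<le> 4*(h*K)*Y" if \<mu>: "\<bar>\<mu>\<bar> \<le> h" for \<mu>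
    proof -
      have "norm (Z \<mu> - y0) = norm (\<mu> *\<^sub>R A (Z \<mu>) + B (Z \<mu>))"
        by (metis Z[OF \<mu>] add_diff_cancel_left')
      also have "\<dots> \<le> (\<bar>\<mu>\<bar> * K + d) * norm (Z \<mu>)" by (rule contr)
      also have "\<dots> \<le> (2*(h*K)) * (2*Y)"
        using q[OF \<mu>] Zb[OF \<mu>] h0 K0 by (intro mult_mono) auto
      finally show ?thesis by simp
    qed
    have Zlip: "norm (Z \<mu> - Z \<nu>) \<le> (4*K*Y) * \<bar>\<mu> - \<nu>\<bar>" if \<mu>: "\<bar>\<mu>\<bar> \<le> h" and \<nu>: "\<bar>\<nu>\<bar> \<le> h" for \<mu> \<nu>
    proof -
      \<comment> \<open>The difference of two fixed points solves the same contractive equation with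
        source \<open>(\<mu> - \<nu>) *\<^sub>R A (Z \<nu>)\<close>. The resulting Lipschitz bound
        is the continuity that the intermediate value theorem asks for.\<close>
      have "Z \<mu> - Z \<nu> = (\<mu> *\<^sub>R A (Z \<mu> - Z \<nu>) + B (Z \<mu> - Z \<nu>)) + (\<mu> - \<nu>) *\<^sub>R A (Z \<nu>)"
      proof -
        have "Z \<mu> - Z \<nu> = (y0 + (\<mu> *\<^sub>R A (Z \<mu>) + B (Z \<mu>))) - (y0 + (\<nu> *\<^sub>R A (Z \<nu>) + B (Z \<nu>)))"
          using Z[OF \<mu>] Z[OF \<nu>] by simp
        thus ?thesis by (simp add: linear_diff[OF A] linear_diff[OF B] algebra_simps)
      qed
      hence "norm (Z \<mu> - Z \<nu>) \<le> 1/2 * norm (Z \<mu> - Z \<nu>) + \<bar>\<mu> - \<nu>\<bar> * norm (A (Z \<nu>))"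
        using norm_triangle_ineq[of "\<mu> *\<^sub>R A (Z \<mu> - Z \<nu>) + B (Z \<mu> - Z \<nu>)" "(\<mu> - \<nu>) *\<^sub>R A (Z \<nu>)"]
          half[OF \<mu>, of "Z \<mu> - Z \<nu>"] by simp
      moreover have "\<bar>\<mu> - \<nu>\<bar> * norm (A (Z \<nu>)) \<le> \<bar>\<mu> - \<nu>\<bar> * (K * (2*Y))"
        using bA[of "Z \<nu>"] Zb[OF \<nu>] K0
        by (intro mult_left_mono) (auto intro: order_trans mult_left_mono)
      ultimately show ?thesis by (simp add: algebra_simps)
    qed
    define F where "F \<mu> = \<mu> * a (Z \<mu>) + b (Z \<mu>)" for \<mu>
    have lip_cont: "continuous_on {-h..h} (\<lambda>\<mu>. f (Z \<mu>))"
      if f: "linear f" and bf: "\<And>y. \<bar>f y\<bar> \<le> C * norm y" and C: "C \<ge> 0" for f :: "'a \<Rightarrow> real" and C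
    proof (rule lipschitz_on_continuous_on)
      show "(C * (4*K*Y))-lipschitz_on {-h..h} (\<lambda>\<mu>. f (Z \<mu>))"
      proof (rule lipschitz_onI)
        fix x y assume "x \<in> {-h..h}" "y \<in> {-h..h}"
        hence xy: "\<bar>x\<bar> \<le> h" "\<bar>y\<bar> \<le> h" by auto
        have "dist (f (Z x)) (f (Z y)) = \<bar>f (Z x - Z y)\<bar>"
          by (simp add: linear_diff[OF f] dist_real_def)
        also have "\<dots> \<le> C * norm (Z x - Z y)" by (rule bf)
        also have "\<dots> \<le> C * ((4*K*Y) * \<bar>x - y\<bar>)"
          using Zlip[OF xy] C by (rule mult_left_mono)
        finally show "dist (f (Z x)) (f (Z y)) \<le> C * (4*K*Y) * dist x y"
          by (simp add: dist_real_def algebra_simps)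
      qed (use C K0 Y0 in auto)
    qed
    have Fc: "continuous_on {-h..h} F"
      unfolding F_def using lip_cont[OF a ba] lip_cont[OF b bb] K0 d0
      by (intro continuous_intros) auto
    have near: "a (Z \<mu>) \<ge> a y0 / 2" if \<mu>: "\<bar>\<mu>\<bar> \<le> h" for \<mu>
    proof -
      have "\<bar>a (Z \<mu> - y0)\<bar> \<le> K * (4*(h*K)*Y)"
        using ba[of "Z \<mu> - y0"] Zd[OF \<mu>] K0 by (meson less_imp_le mult_left_mono order_trans)
      hence "\<bar>a (Z \<mu>) - a y0\<bar> \<le> h * K * K * Y * 4"
        by (simp add: linear_diff[OF a] algebra_simps)
      thus ?thesis using hN by linarith
    qed
    have small: "\<bar>b (Z \<mu>)\<bar> \<le> h * a y0 / 4" if \<mu>: "\<bar>\<mu>\<bar> \<le> h" for \<mu>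
    proof -
      have "\<bar>b (Z \<mu>)\<bar> \<le> d * (2*Y)"
        using bb[of "Z \<mu>"] Zb[OF \<mu>] d0 by (meson less_imp_le mult_left_mono order_trans)
      also have "\<dots> \<le> (h * a y0 / (8*Y)) * (2*Y)"
        using Y0 by (intro mult_right_mono) (auto simp: d_def)
      also have "\<dots> = h * a y0 / 4" using Y0 by simp
      finally show ?thesis .
    qed
    have hh: "h * a (Z \<mu>) \<ge> h * a y0 / 2" if "\<bar>\<mu>\<bar> \<le> h" for \<mu>
      using mult_left_mono[OF near[OF that], of h] h0 by simp
    have pos: "h * a y0 > 0" using h0 N by simp
    \<comment> \<open>At \<open>\<mu> = h\<close> and \<open>\<mu> = - h\<close> the term
      \<open>\<mu> * a (Z \<mu>)\<close> has modulus at least \<open>h * a y0 / 2\<close>, twice the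
      largest value allowed for \<open>b\<close>, so its sign decides.\<close>
    have "F h \<ge> 0"
    proof -
      have "\<bar>b (Z h)\<bar> \<le> h * a y0 / 4" "h * a y0 / 2 \<le> h * a (Z h)"
        using hh[of h] small[of h] h0 by auto
      thus ?thesis using pos unfolding F_def by linarith
    qed
    moreover have "F (-h) \<le> 0"
    proof -
      have "\<bar>b (Z (-h))\<bar> \<le> h * a y0 / 4" "h * a y0 / 2 \<le> h * a (Z (-h))"
        using hh[of "-h"] small[of "-h"] h0 by auto
      thus ?thesis using pos unfolding F_def by linarith
    qed
    ultimately obtain \<mu> where \<mu>: "-h \<le> \<mu>" "\<mu> \<le> h" "F \<mu> = 0"
      using IVT'[of F "-h" 0 h] Fc h0 by auto
    have "\<bar>\<mu>\<bar> \<le> h" using \<mu> by auto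
    moreover have "h \<le> \<eta>" by (simp add: h_def)
    ultimately show "\<exists>y \<mu>. \<bar>\<mu>\<bar> \<le> \<eta> \<and> y = y0 + \<mu> *\<^sub>R A y + B y \<and> \<mu> * a y + b y = 0"
      using Z[of \<mu>] \<mu>(3) by (intro exI[of _ "Z \<mu>"] exI[of _ \<mu>]) (auto simp: F_def algebra_simps)
  qed
qed

section \<open>Green operators on the half-line\<close>

text \<open>
  With \<open>\<omega> = 1 + i\<close>, the integral of \<open>exp (x / 2) exp (- \<omega> |x - t|) exp (- t / 2) h t\<close> over \<open>t \<ge> 0\<close> is
  split at \<open>t = x\<close> into a forward and a backward part, with exponents \<open>\<omega> \<mp> 1 / 2\<close>. The weight
  \<open>exp (x / 2)\<close> turns boundedness into exponential decay.
\<close>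

abbreviation exp_lo :: complex where "exp_lo \<equiv> Complex (1/2) 1"
abbreviation exp_hi :: complex where "exp_hi \<equiv> Complex (3/2) 1"

definition fwd_int :: "(real \<Rightarrow> complex) \<Rightarrow> real \<Rightarrow> complex" where
  "fwd_int h x = exp (- (exp_lo * of_real x)) * integral {0..x} (\<lambda>t. exp (exp_lo * of_real t) * h t)"

definition bwd_int :: "(real \<Rightarrow> complex) \<Rightarrow> real \<Rightarrow> complex" where
  "bwd_int h x = exp (exp_hi * of_real x) * integral {x..} (\<lambda>t. exp (- (exp_hi * of_real t)) * h t)"

section \<open>Bounds for the Green integrals\<close>

lemma integral_indicator_atLeastAtMost_le:
  fixes R :: real
  assumes R: "R \<ge> 0" and S: "S \<in> sets lebesgue"
  shows "(indicator {0..R} :: real \<Rightarrow> real) integrable_on S"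
    and "integral S (indicator {0..R}) \<le> R"
proof -
  have m: "{0..R} \<inter> S \<in> lmeasurable"
    using S by (metis fmeasurable_Int_fmeasurable lmeasurable_cbox interval_cbox)
  thus "(indicator {0..R} :: real \<Rightarrow> real) integrable_on S"
    by (simp add: integrable_on_indicator)
  have "integral S (indicator {0..R}) = measure lebesgue ({0..R} \<inter> S)"
    using m by (simp add: integral_indicator)
  also have "\<dots> \<le> measure lebesgue {0..R}"
    using S by (intro measure_mono_fmeasurable) auto
  finally show "integral S (indicator {0..R}) \<le> R" using R by simp
qed

text \<open>A forcing of size \<open>M\<close> on a core of length \<open>R\<close> enters only
  through the product \<open>M * R\<close>: this is why an error of order one near a steep wall is
  harmless. The tail \<open>d\<close> is multiplied by the integral of the kernel, at most
  \<open>1 / (1/2)\<close>.\<close>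

lemma norm_fwd_int_le:
  assumes h: "continuous_on UNIV h" and x: "x \<ge> 0" and R: "R \<ge> 0" and M: "M \<ge> 0" and d: "d \<ge> 0"
    and b: "\<And>t. t \<ge> 0 \<Longrightarrow> norm (h t) \<le> M * indicator {0..R} t + d"
  shows "norm (fwd_int h x) \<le> M * R + 2 * d"
proof -
  \<comment> \<open>The exponential is replaced by its maximum on the core only; doing the same with
    the constant \<open>d\<close> would leave a factor growing with \<open>x\<close>.\<close>
  let ?g = "\<lambda>t. exp (x/2) * M * indicator {0..R} t + d * exp (t/2)"
  have e: "((\<lambda>t. exp (t/2)) has_integral (2 * exp (x/2) - 2 * exp (0/2))) {0..x}"
    using x by (intro fundamental_theorem_of_calculus)
      (auto intro!: derivative_eq_intros simp: has_real_derivative_iff_has_vector_derivative[symmetric])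
  note ind = integral_indicator_atLeastAtMost_le[OF R, of "{0..x}"]
  have gi: "?g integrable_on {0..x}"
    using ind(1) e by (intro integrable_add integrable_on_mult_right) auto
  have "norm (integral {0..x} (\<lambda>t. exp (exp_lo * of_real t) * h t)) \<le> integral {0..x} ?g"
  proof (rule integral_norm_bound_integral[OF _ gi])
    show "(\<lambda>t. exp (exp_lo * complex_of_real t) * h t) integrable_on {0..x}"
      by (intro integrable_continuous_real continuous_intros continuous_on_subset[OF h]) auto
    fix t assume t: "t \<in> {0..x}"
    have "norm (exp (exp_lo * complex_of_real t) * h t) = exp (t/2) * norm (h t)"
      by (simp add: norm_mult)
    also have "\<dots> \<le> exp (t/2) * (M * indicator {0..R} t + d)"
      using b[of t] t by (intro mult_left_mono) auto
    also have "\<dots> \<le> ?g t"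
      using t M by (auto simp: algebra_simps indicator_def intro!: mult_left_mono)
    finally show "norm (exp (exp_lo * complex_of_real t) * h t) \<le> ?g t" .
  qed
  also have "integral {0..x} ?g = exp (x/2) * M * integral {0..x} (indicator {0..R}) + d * (2 * exp (x/2) - 2)"
    using ind(1) e
    by (subst integral_add) (auto simp: integral_unique intro!: integrable_on_mult_right)
  also have "\<dots> \<le> exp (x/2) * M * R + d * (2 * exp (x/2))"
    using ind(2) M d by (intro add_mono mult_left_mono) auto
  also have "\<dots> = exp (x/2) * (M * R + 2 * d)" by (simp add: algebra_simps)
  finally have "norm (integral {0..x} (\<lambda>t. exp (exp_lo * of_real t) * h t)) \<le> exp (x/2) * (M * R + 2 * d)" .
  hence "exp (-(x/2)) * norm (integral {0..x} (\<lambda>t. exp (exp_lo * of_real t) * h t))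
      \<le> exp (-(x/2)) * (exp (x/2) * (M * R + 2 * d))" by (intro mult_left_mono) auto
  also have "\<dots> = M * R + 2 * d" by (simp add: exp_minus)
  finally show ?thesis by (simp add: fwd_int_def norm_mult)
qed

lemma bwd_int_integrable:
  assumes h: "continuous_on UNIV h" and b: "\<And>t. t \<ge> x \<Longrightarrow> norm (h t) \<le> B"
  shows "(\<lambda>t. exp (- (exp_hi * of_real t)) * h t) integrable_on {x..}"
proof (rule measurable_bounded_by_integrable_imp_integrable)
  show "(\<lambda>t. exp (- (exp_hi * complex_of_real t)) * h t) \<in> borel_measurable (lebesgue_on {x..})"
    by (intro continuous_imp_measurable_on_sets_lebesgue continuous_intros continuous_on_subset[OF h]) auto
  show "(\<lambda>t. exp (- (3/2) * t) * B) integrable_on {x..}"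
    by (intro integrable_on_mult_left integrable_on_exp_minus_to_infinity) auto
  fix t assume "t \<in> {x..}"
  thus "norm (exp (- (exp_hi * complex_of_real t)) * h t) \<le> exp (- (3/2) * t) * B"
    using b by (auto simp: norm_mult intro!: mult_left_mono)
qed auto

text \<open>Here the kernel is largest at the starting point \<open>x\<close>, so the core again
  costs \<open>M * R\<close>, and the tail costs \<open>d / (3/2)\<close>, rounded up to
  \<open>d\<close>.\<close>

lemma norm_bwd_int_le:
  assumes h: "continuous_on UNIV h" and x: "x \<ge> 0" and R: "R \<ge> 0" and M: "M \<ge> 0" and d: "d \<ge> 0"
    and b: "\<And>t. t \<ge> 0 \<Longrightarrow> norm (h t) \<le> M * indicator {0..R} t + d"
  shows "norm (bwd_int h x) \<le> M * R + d"
proof -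
  let ?g = "\<lambda>t. exp (-(3/2) * x) * M * indicator {0..R} t + d * exp (-(3/2) * t)"
  have e: "((\<lambda>t. exp (-(3/2) * t)) has_integral exp (-(3/2)*x) / (3/2)) {x..}"
    by (rule has_integral_exp_minus_to_infinity) auto
  note ind = integral_indicator_atLeastAtMost_le[OF R, of "{x..}"]
  have gi: "?g integrable_on {x..}"
    using ind(1) e by (intro integrable_add integrable_on_mult_right) auto
  have b': "norm (h t) \<le> M + d" if "t \<ge> x" for t
  proof -
    have "M * indicator {0..R} t \<le> M" using M by (auto simp: indicator_def)
    thus ?thesis using b[of t] that x by simp
  qed
  have "norm (integral {x..} (\<lambda>t. exp (-(exp_hi * of_real t)) * h t)) \<le> integral {x..} ?g"
  proof (rule integral_norm_bound_integral[OF _ gi])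
    show "(\<lambda>t. exp (- (exp_hi * complex_of_real t)) * h t) integrable_on {x..}"
      by (rule bwd_int_integrable[OF h b'])
    fix t assume t: "t \<in> {x..}"
    have "norm (exp (-(exp_hi * complex_of_real t)) * h t) = exp (-(3/2) * t) * norm (h t)"
      by (simp add: norm_mult)
    also have "\<dots> \<le> exp (-(3/2)*t) * (M * indicator {0..R} t + d)"
      using b[of t] t x by (intro mult_left_mono) auto
    also have "\<dots> \<le> ?g t"
      using t M by (auto simp: algebra_simps indicator_def intro!: mult_left_mono)
    finally show "norm (exp (-(exp_hi * complex_of_real t)) * h t) \<le> ?g t" .
  qed
  also have "integral {x..} ?g = exp (-(3/2)*x) * M * integral {x..} (indicator {0..R}) + d * (exp (-(3/2)*x) / (3/2))"
    using ind(1) e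
    by (subst integral_add) (auto simp: integral_unique intro!: integrable_on_mult_right)
  also have "\<dots> \<le> exp (-(3/2)*x) * M * R + d * exp (-(3/2)*x)"
    using ind(2) M d by (intro add_mono mult_left_mono) auto
  also have "\<dots> = exp (-(3/2)*x) * (M * R + d)" by (simp add: algebra_simps)
  finally have "norm (integral {x..} (\<lambda>t. exp (-(exp_hi * of_real t)) * h t)) \<le> exp (-(3/2)*x) * (M * R + d)" .
  hence "exp ((3/2)*x) * norm (integral {x..} (\<lambda>t. exp (-(exp_hi * of_real t)) * h t))
      \<le> exp ((3/2)*x) * (exp (-(3/2)*x) * (M * R + d))" by (intro mult_left_mono) auto
  also have "\<dots> = M * R + d" by (simp add: exp_minus)
  finally show ?thesis by (simp add: bwd_int_def norm_mult)
qed

section \<open>Differential equations, linearity and uniqueness for the Green integrals\<close>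

lemma fwd_int_zero: "fwd_int h 0 = 0" by (simp add: fwd_int_def)

lemma has_vector_derivative_exp_mult:
  "((\<lambda>u. exp (a * of_real u)) has_vector_derivative a * exp (a * of_real x)) (at x within S)" for a :: complex
  by (rule has_vector_derivative_real_field) (auto intro!: derivative_eq_intros)

lemma has_vector_derivative_integral_atLeast:
  fixes f :: "real \<Rightarrow> complex"
  assumes f: "continuous_on UNIV f" and x: "x \<ge> 0"
  shows "((\<lambda>u. integral {0..u} f) has_vector_derivative f x) (at x within {0..})"
proof -
  have "at x within {0..x+1} = at x within {0..}"
    by (rule at_within_nhd[of _ "{x - 1<..<x+1}"]) auto
  thus ?thesis
    using integral_has_vector_derivative[OF continuous_on_subset[OF f], of 0 "x + 1" x] x by simp
qed

lemma fwd_int_has_vector_derivative: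
  assumes h: "continuous_on UNIV h" and x: "x \<ge> 0"
  shows "(fwd_int h has_vector_derivative (h x - exp_lo * fwd_int h x)) (at x within {0..})"
proof -
  have "continuous_on UNIV (\<lambda>t. exp (exp_lo * complex_of_real t) * h t)" by (intro continuous_intros h)
  note 1 = has_vector_derivative_integral_atLeast[OF this x]
  note 2 = has_vector_derivative_exp_mult[of "- exp_lo" x "{0..}", unfolded mult_minus_left]
  have "((\<lambda>u. exp (-(exp_lo * of_real u)) * integral {0..u} (\<lambda>t. exp (exp_lo * complex_of_real t) * h t)) has_vector_derivative
     exp (-(exp_lo * of_real x)) * (exp (exp_lo * of_real x) * h x) + - (exp_lo * exp (-(exp_lo * of_real x))) * integral {0..x} (\<lambda>t. exp (exp_lo * complex_of_real t) * h t)) (at x within {0..})"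
    by (rule has_vector_derivative_mult[OF 2 1])
  moreover have "exp (-(exp_lo * of_real x)) * (exp (exp_lo * of_real x) * h x) = h x"
    by (simp add: exp_minus)
  ultimately show ?thesis by (simp add: fwd_int_def[abs_def] mult.assoc)
qed

lemma bwd_int_has_vector_derivative:
  assumes h: "continuous_on UNIV h" and b: "\<And>t. t \<ge> 0 \<Longrightarrow> norm (h t) \<le> B" and x: "x \<ge> 0"
  shows "(bwd_int h has_vector_derivative (exp_hi * bwd_int h x - h x)) (at x within {0..})"
proof -
  let ?f = "\<lambda>t. exp (-(exp_hi * complex_of_real t)) * h t"
  let ?F = "\<lambda>u. exp (exp_hi * of_real u) * (integral {0..} ?f - integral {0..u} ?f)"
  \<comment> \<open>The tail integral is traded for a constant minus an integral from 0, to which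
    the fundamental theorem applies.\<close>
  have split: "bwd_int h u = ?F u" if u: "u \<ge> 0" for u
  proof -
    have "integral {0..u} ?f + integral {u..} ?f = integral ({0..u} \<union> {u..}) ?f"
    proof (rule integral_Un[symmetric])
      show "?f integrable_on {0..u}"
        by (intro integrable_continuous_real continuous_intros continuous_on_subset[OF h]) auto
      show "?f integrable_on {u..}" using u b by (intro bwd_int_integrable[OF h, of _ B]) auto
      have "{0..u} \<inter> {u..} = {u}" using u by auto
      thus "negligible ({0..u} \<inter> {u..})" by simp
    qed
    moreover have "{0..u} \<union> {u..} = {0..}" using u by auto
    ultimately have "integral {0..u} ?f + integral {u..} ?f = integral {0..} ?f" by simp
    hence "integral {u..} ?f = integral {0..} ?f - integral {0..u} ?f"
      unfolding eq_diff_eq by (subst add.commute)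
    thus ?thesis by (simp add: bwd_int_def)
  qed
  have "continuous_on UNIV ?f" by (intro continuous_intros h)
  note has_vector_derivative_integral_atLeast[OF this x]
  hence 1: "((\<lambda>u. integral {0..} ?f - integral {0..u} ?f) has_vector_derivative (0 - ?f x)) (at x within {0..})"
    by (intro derivative_intros)
  note 2 = has_vector_derivative_exp_mult[of exp_hi x "{0..}"]
  have "(?F has_vector_derivative exp (exp_hi * of_real x) * (0 - ?f x) +
     exp_hi * exp (exp_hi * of_real x) * (integral {0..} ?f - integral {0..x} ?f)) (at x within {0..})"
    by (rule has_vector_derivative_mult[OF 2 1])
  moreover have "exp (exp_hi * of_real x) * (0 - ?f x) = - h x"
    by (simp add: exp_minus)
  ultimately have "(?F has_vector_derivative (- h x + exp_hi * ?F x)) (at x within {0..})"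
    by (simp only: mult.assoc)
  hence "(?F has_vector_derivative (exp_hi * ?F x - h x)) (at x within {0..})"
    by (simp only: add.commute[of "- h x"] diff_conv_add_uminus)
  moreover have "?F x = bwd_int h x" using split[OF x] by simp
  ultimately have "(?F has_vector_derivative (exp_hi * bwd_int h x - h x)) (at x within {0..})" by simp
  thus ?thesis
    by (rule has_vector_derivative_transform[rotated 2]) (use x split in auto)
qed

abbreviation \<omega> :: complex where "\<omega> \<equiv> Complex 1 1"

lemma fwd_int_add:
  assumes "continuous_on UNIV f" "continuous_on UNIV g"
  shows "fwd_int (\<lambda>t. f t + g t) x = fwd_int f x + fwd_int g x"
proof -
  have "integral {0..x} (\<lambda>t. exp (exp_lo * of_real t) * f t + exp (exp_lo * of_real t) * g t) =
    integral {0..x} (\<lambda>t. exp (exp_lo * of_real t) * f t) + integral {0..x} (\<lambda>t. exp (exp_lo * of_real t) * g t)"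
    by (intro integral_add integrable_continuous_real continuous_intros continuous_on_subset[OF assms(1)]
        continuous_on_subset[OF assms(2)]) auto
  thus ?thesis by (simp add: fwd_int_def distrib_left)
qed

lemma fwd_int_scaleR: "fwd_int (\<lambda>t. r *\<^sub>R f t) x = r *\<^sub>R fwd_int f x"
  by (simp add: fwd_int_def)

lemma bwd_int_add:
  assumes "continuous_on UNIV f" "continuous_on UNIV g"
    and "\<And>t. norm (f t) \<le> Bf" "\<And>t. norm (g t) \<le> Bg"
  shows "bwd_int (\<lambda>t. f t + g t) x = bwd_int f x + bwd_int g x"
proof -
  have "integral {x..} (\<lambda>t. exp (-(exp_hi * of_real t)) * f t + exp (-(exp_hi * of_real t)) * g t) =
    integral {x..} (\<lambda>t. exp (-(exp_hi * of_real t)) * f t) + integral {x..} (\<lambda>t. exp (-(exp_hi * of_real t)) * g t)"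
    using bwd_int_integrable[of f x Bf] bwd_int_integrable[of g x Bg] assms by (intro integral_add) auto
  thus ?thesis by (simp add: bwd_int_def distrib_left)
qed

lemma bwd_int_scaleR: "bwd_int (\<lambda>t. r *\<^sub>R f t) x = r *\<^sub>R bwd_int f x"
  by (simp add: bwd_int_def)

text \<open>The homogeneous solutions are multiples of \<open>exp (exp_hi * x)\<close> and grow, so
  a bounded solution of the first-order equation is unique. An improper integral can thus be
  evaluated by guessing a bounded solution, as is done for the ground state.\<close>

lemma bwd_int_unique:
  assumes h: "continuous_on UNIV h" and b: "\<And>t. t \<ge> 0 \<Longrightarrow> norm (h t) \<le> B"
    and F: "\<And>x. x \<ge> 0 \<Longrightarrow> (F has_vector_derivative (exp_hi * F x - h x)) (at x within {0..})"
    and bF: "\<And>x. x \<ge> 0 \<Longrightarrow> norm (F x) \<le> C"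
  shows "bwd_int h 0 = F 0"
proof -
  \<comment> \<open>With the integrating factor the difference of the two solutions becomes
    constant; since both are bounded it also tends to 0.\<close>
  let ?D = "\<lambda>x. exp (- (exp_hi * of_real x)) * (bwd_int h x - F x)"
  have B0: "B \<ge> 0" using b[of 0] norm_ge_zero[of "h 0"] by linarith
  have d: "(?D has_vector_derivative 0) (at x within {0..})" if x: "x \<ge> 0" for x
  proof -
    note 1 = has_vector_derivative_exp_mult[of "- exp_hi" x "{0..}", unfolded mult_minus_left]
    have 2: "((\<lambda>x. bwd_int h x - F x) has_vector_derivative (exp_hi * bwd_int h x - h x) - (exp_hi * F x - h x)) (at x within {0..})"
      by (intro derivative_intros bwd_int_has_vector_derivative[OF h b x] F[OF x])
    show ?thesis
      using has_vector_derivative_mult[OF 1 2] by (simp add: algebra_simps)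
  qed
  have const: "?D x = ?D 0" if "x \<ge> 0" for x
  proof -
    obtain k where "\<And>x. x \<in> {0..} \<Longrightarrow> ?D x = k"
      using has_vector_derivative_zero_constant[of "{0..}" ?D] d by auto
    from this[of x] this[of 0] that show ?thesis by simp
  qed
  have lim: "(?D \<longlongrightarrow> 0) at_top"
  proof (rule Lim_null_comparison)
    have "norm (?D x) \<le> exp (- x) * (B + C)" if x: "x \<ge> 0" for x
    proof -
      \<comment> \<open>Only boundedness matters here: the core is empty of weight
        (\<open>R = M = 0\<close>) and the whole bound \<open>B\<close> is taken as tail.\<close>
      have "norm (bwd_int h x - F x) \<le> B + C"
        using norm_bwd_int_le[OF h x, of 0 0 B] b bF[OF x] B0 norm_triangle_ineq4[of "bwd_int h x" "F x"] by auto
      moreover have "norm (exp (- (exp_hi * complex_of_real x))) \<le> exp (-x)" using x by simp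
      ultimately show ?thesis unfolding norm_mult by (intro mult_mono) auto
    qed
    thus "eventually (\<lambda>x. norm (?D x) \<le> exp (- x) * (B + C)) at_top"
      using eventually_ge_at_top[of 0] by (rule eventually_mono[rotated])
    show "((\<lambda>x. exp (- x) * (B + C)) \<longlongrightarrow> 0) at_top"
      by (intro tendsto_mult_left_zero filterlim_compose[OF exp_at_bot] filterlim_uminus_at_bot_at_top)
  qed
  have "((\<lambda>x::real. ?D 0) \<longlongrightarrow> 0) at_top"
  proof -
    have "eventually (\<lambda>x. ?D x = ?D 0) at_top"
      using eventually_ge_at_top[of 0] by (rule eventually_mono) (rule const)
    from tendsto_cong[OF this] lim show ?thesis by blast
  qed
  thus ?thesis by (simp add: tendsto_const_iff trivial_limit_at_top_linorder)
qed

text \<open>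
  \<open>z x = exp (- x / 2) ray_sol a h x\<close> solves \<open>z'' = 2 i z + exp (- x / 2) h\<close> with \<open>z 0 = a\<close> (note
  \<open>\<omega>\<^sup>2 = 2 i\<close>), and \<open>exp (- x / 2) ray_slope a h x\<close> is its derivative.
\<close>

definition ray_sol :: "complex \<Rightarrow> (real \<Rightarrow> complex) \<Rightarrow> real \<Rightarrow> complex" where
  "ray_sol a h x = (a + bwd_int h 0 / (2 * \<omega>)) * exp (- (exp_lo * of_real x)) - (fwd_int h x + bwd_int h x) / (2 * \<omega>)"

definition ray_slope :: "complex \<Rightarrow> (real \<Rightarrow> complex) \<Rightarrow> real \<Rightarrow> complex" where
  "ray_slope a h x = - \<omega> * (a + bwd_int h 0 / (2 * \<omega>)) * exp (- (exp_lo * of_real x)) + (fwd_int h x - bwd_int h x) / 2"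

lemma ray_sol_zero: "ray_sol a h 0 = a" by (simp add: ray_sol_def fwd_int_zero)
lemma ray_slope_zero: "ray_slope a h 0 = - \<omega> * a - bwd_int h 0"
proof -
  have "\<omega> \<noteq> 0" by (simp add: complex_eq_iff)
  thus ?thesis by (simp add: ray_slope_def fwd_int_zero field_simps)
qed

lemma norm_two_omega: "norm (2 * \<omega>) \<ge> 2"
proof -
  have "\<bar>Re (2 * \<omega>)\<bar> \<le> norm (2*\<omega>)" by (rule abs_Re_le_cmod)
  thus ?thesis by simp
qed

lemma norm_ray_sol_le:
  assumes h: "continuous_on UNIV h" and x: "x \<ge> 0" and R: "R \<ge> 0" and M: "M \<ge> 0" and d: "d \<ge> 0"
    and b: "\<And>t. t \<ge> 0 \<Longrightarrow> norm (h t) \<le> M * indicator {0..R} t + d"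
  shows "norm (ray_sol a h x) \<le> norm a + 3 * (M * R + d)" and "norm (ray_slope a h x) \<le> 2 * norm a + 4 * (M * R + d)"
proof -
  have k: "norm (fwd_int h x) \<le> M*R + 2*d" "norm (bwd_int h x) \<le> M*R+d" "norm (bwd_int h 0) \<le> M*R+d"
    using norm_fwd_int_le[OF h x R M d b] norm_bwd_int_le[OF h x R M d b] norm_bwd_int_le[OF h _ R M d b, of 0] by auto
  have MR: "M*R \<ge> 0" using M R by simp
  have e: "norm (exp (- (exp_lo * complex_of_real x))) \<le> 1" using x by simp
  have half: "norm (z / (2*\<omega>)) \<le> norm z / 2" for z
    unfolding norm_divide using norm_two_omega by (intro divide_left_mono) auto
  have A: "norm (a + bwd_int h 0 / (2 * \<omega>)) \<le> norm a + (M*R+d)/2"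
    using norm_triangle_ineq[of a "bwd_int h 0 / (2*\<omega>)"] half[of "bwd_int h 0"] k(3) by argo
  have A': "norm ((a + bwd_int h 0 / (2 * \<omega>)) * exp (- (exp_lo * of_real x))) \<le> norm a + (M*R+d)/2"
    using mult_mono[OF A e] M R d by (simp add: norm_mult)
  have B: "norm ((fwd_int h x + bwd_int h x) / (2*\<omega>)) \<le> (2*M*R+3*d)/2"
    using half[of "fwd_int h x + bwd_int h x"] norm_triangle_ineq[of "fwd_int h x" "bwd_int h x"] k by argo
  show "norm (ray_sol a h x) \<le> norm a + 3 * (M * R + d)"
    using norm_triangle_ineq4[of "(a + bwd_int h 0 / (2 * \<omega>)) * exp (- (exp_lo * of_real x))" "(fwd_int h x + bwd_int h x) / (2*\<omega>)"]
      A' B MR d unfolding ray_sol_def by argo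
  have o: "norm \<omega> \<le> 2" using cmod_le[of \<omega>] by simp
  have C: "norm (- \<omega> * ((a + bwd_int h 0 / (2 * \<omega>)) * exp (- (exp_lo * of_real x)))) \<le> 2 * (norm a + (M*R+d)/2)"
    unfolding norm_mult[of "-\<omega>"] using A' o by (intro mult_mono) auto
  have "norm ((fwd_int h x - bwd_int h x) / 2) \<le> (2*M*R+3*d)/2"
    using norm_triangle_ineq4[of "fwd_int h x" "bwd_int h x"] k by (simp add: norm_divide)
  thus "norm (ray_slope a h x) \<le> 2 * norm a + 4 * (M * R + d)"
    using norm_triangle_ineq[of "- \<omega> * ((a + bwd_int h 0 / (2 * \<omega>)) * exp (- (exp_lo * of_real x)))" "(fwd_int h x - bwd_int h x) / 2"]
      C MR d unfolding ray_slope_def mult.assoc by argo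
qed

lemma ray_sol_ode:
  assumes h: "continuous_on UNIV h" and b: "\<And>t. t \<ge> 0 \<Longrightarrow> norm (h t) \<le> B" and x: "x \<ge> 0"
  shows "((\<lambda>x. exp (-x/2) *\<^sub>R ray_sol a h x) has_vector_derivative exp (-x/2) *\<^sub>R ray_slope a h x) (at x within {0..})"
    and "((\<lambda>x. exp (-x/2) *\<^sub>R ray_slope a h x) has_vector_derivative exp (-x/2) *\<^sub>R (2 * \<i> * ray_sol a h x + h x)) (at x within {0..})"
proof -
  have e: "((\<lambda>x. exp (-x/2)) has_real_derivative - exp (-x/2) / 2) (at x within {0..})"
    by (auto intro!: derivative_eq_intros)
  have E: "((\<lambda>u. exp (-(exp_lo * of_real u))) has_vector_derivative - exp_lo * exp (-(exp_lo * of_real x))) (at x within {0..})"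
    by (rule has_vector_derivative_real_field) (auto intro!: derivative_eq_intros)
  note k1 = fwd_int_has_vector_derivative[OF h x] and k2 = bwd_int_has_vector_derivative[OF h b x]
  have o0: "\<omega> \<noteq> 0" by (simp add: complex_eq_iff)
  have pe: "exp_lo = \<omega> - 1/2" "exp_hi = \<omega> + 1/2" by (simp_all add: complex_eq_iff)
  have oo: "\<omega> * \<omega> = 2 * \<i>" by (simp add: complex_eq_iff)
  have G': "(ray_sol a h has_vector_derivative (a + bwd_int h 0 / (2 * \<omega>)) * (- exp_lo * exp (-(exp_lo * of_real x))) -
      ((h x - exp_lo * fwd_int h x) + (exp_hi * bwd_int h x - h x)) / (2*\<omega>)) (at x within {0..})"
    unfolding ray_sol_def[abs_def]
    by (intro has_vector_derivative_diff has_vector_derivative_mult_right has_vector_derivative_divide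
        has_vector_derivative_add E k1 k2)
  have D': "(ray_slope a h has_vector_derivative (- \<omega> * (a + bwd_int h 0 / (2 * \<omega>))) * (- exp_lo * exp (-(exp_lo * of_real x))) +
      ((h x - exp_lo * fwd_int h x) - (exp_hi * bwd_int h x - h x)) / 2) (at x within {0..})"
    unfolding ray_slope_def[abs_def]
    by (intro has_vector_derivative_diff has_vector_derivative_mult_right has_vector_derivative_divide
        has_vector_derivative_add E k1 k2)
  have 1: "((\<lambda>x. exp (-x/2) *\<^sub>R ray_sol a h x) has_vector_derivative
     exp (-x/2) *\<^sub>R ((a + bwd_int h 0 / (2 * \<omega>)) * (- exp_lo * exp (-(exp_lo * of_real x))) -
      ((h x - exp_lo * fwd_int h x) + (exp_hi * bwd_int h x - h x)) / (2*\<omega>)) + (- exp (-x/2) / 2) *\<^sub>R ray_sol a h x) (at x within {0..})"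
    by (rule has_vector_derivative_scaleR[OF e G'])
  have 2: "((\<lambda>x. exp (-x/2) *\<^sub>R ray_slope a h x) has_vector_derivative
     exp (-x/2) *\<^sub>R ((- \<omega> * (a + bwd_int h 0 / (2 * \<omega>))) * (- exp_lo * exp (-(exp_lo * of_real x))) +
      ((h x - exp_lo * fwd_int h x) - (exp_hi * bwd_int h x - h x)) / 2) + (- exp (-x/2) / 2) *\<^sub>R ray_slope a h x) (at x within {0..})"
    by (rule has_vector_derivative_scaleR[OF e D'])
  \<comment> \<open>The forcing enters the derivatives of the two integrals with opposite signs. It
    cancels in their sum, so \<open>ray_slope\<close> does not contain it pointwise, and in half
    their difference it reappears with coefficient 1. The atoms keep the exponentials out of the
    field arithmetic.\<close>
  have r1: "e * (A * (- (w - 1/2) * E) - ((H - (w - 1/2) * K) + ((w + 1/2) * L - H)) / (2*w)) + (- e / 2) * (A * E - (K + L) / (2*w))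
     = e * (- w * A * E + (K - L) / 2)" if "w \<noteq> 0" for e A E H K L w :: complex
    using that by (simp add: field_simps)
  have r2: "e * ((- w * A) * (- (w - 1/2) * E) + ((H - (w - 1/2) * K) - ((w + 1/2) * L - H)) / 2) + (- e / 2) * (- w * A * E + (K - L) / 2)
     = e * ((w * w) * (A * E - (K + L) / (2*w)) + H)" if "w \<noteq> 0" for e A E H K L w :: complex
    using that by (simp add: field_simps)
  show "((\<lambda>x. exp (-x/2) *\<^sub>R ray_sol a h x) has_vector_derivative exp (-x/2) *\<^sub>R ray_slope a h x) (at x within {0..})"
    using 1 r1[OF o0, of "of_real (exp (-x/2))" "a + bwd_int h 0 / (2 * \<omega>)" "exp (- (exp_lo * of_real x))" "h x" "fwd_int h x" "bwd_int h x"]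
    by (simp add: scaleR_conv_of_real ray_sol_def ray_slope_def flip: pe)
  show "((\<lambda>x. exp (-x/2) *\<^sub>R ray_slope a h x) has_vector_derivative exp (-x/2) *\<^sub>R (2 * \<i> * ray_sol a h x + h x)) (at x within {0..})"
    using 2 r2[OF o0, of "of_real (exp (-x/2))" "a + bwd_int h 0 / (2 * \<omega>)" "exp (- (exp_lo * of_real x))" "h x" "fwd_int h x" "bwd_int h x"]
    by (simp add: scaleR_conv_of_real ray_sol_def ray_slope_def oo flip: pe)
qed

lemma ray_sol_add:
  assumes "continuous_on UNIV f" "continuous_on UNIV g"
    and "\<And>t. norm (f t) \<le> Bf" "\<And>t. norm (g t) \<le> Bg"
  shows "ray_sol (a + b) (\<lambda>t. f t + g t) x = ray_sol a f x + ray_sol b g x"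
  by (simp add: ray_sol_def fwd_int_add[OF assms(1,2)] bwd_int_add[OF assms] add_divide_distrib algebra_simps)

lemma ray_sol_scaleR: "ray_sol (r *\<^sub>R a) (\<lambda>t. r *\<^sub>R f t) x = r *\<^sub>R ray_sol a f x"
  unfolding ray_sol_def fwd_int_scaleR bwd_int_scaleR by (simp add: scaleR_conv_of_real algebra_simps add_divide_distrib)

lemma continuous_ray_sol:
  assumes h: "continuous_on UNIV h" and b: "\<And>t. t \<ge> 0 \<Longrightarrow> norm (h t) \<le> B"
  shows "continuous_on UNIV (\<lambda>x. ray_sol a h (max 0 x))"
proof (rule continuous_on_compose2[of "{0..}" "ray_sol a h" _ "max 0"])
  have "continuous_on {0..} (fwd_int h)"
    by (rule continuous_on_vector_derivative) (use fwd_int_has_vector_derivative[OF h] in auto)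
  moreover have "continuous_on {0..} (bwd_int h)"
    by (rule continuous_on_vector_derivative) (use bwd_int_has_vector_derivative[OF h b] in auto)
  moreover have "\<omega> \<noteq> 0" by (simp add: complex_eq_iff)
  ultimately show "continuous_on {0..} (ray_sol a h)"
    unfolding ray_sol_def[abs_def] by (intro continuous_intros) auto
qed (auto intro!: continuous_intros)

section \<open>Folding the line at the wall\<close>

text \<open>
  After rescaling to \<open>l = 2 sqrt 2\<close>, put \<open>c = sqrt 2 - 1\<close> (so \<open>1 / c = sqrt 2 + 1\<close>) and fold:
  \<open>z1 x = u x + i v x / c\<close> and \<open>z2 x = c v (- x) + i u (- x)\<close> for \<open>x \<ge> 0\<close>. At \<open>\<rho> = 1 / sqrt 2\<close> and for the
  sign wall both satisfy \<open>z'' = 2 i z\<close>. With \<open>v 0\<close> fixed, continuity of \<open>u'\<close> and \<open>v'\<close> at \<open>0\<close>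
  determines the change \<open>boundary_value h\<close> of \<open>u 0\<close> caused by the forcing \<open>h\<close> and requires \<open>solvability h = 0\<close>.
\<close>

type_synonym pairfun = "real \<Rightarrow>\<^sub>C (complex \<times> complex)"

definition boundary_value :: "(real \<Rightarrow> complex \<times> complex) \<Rightarrow> real" where
  "boundary_value h = - (Re (bwd_int (\<lambda>t. fst (h t)) 0) + Im (bwd_int (\<lambda>t. snd (h t)) 0)) / 2"

definition solvability :: "(real \<Rightarrow> complex \<times> complex) \<Rightarrow> real" where
  "solvability h = Re (bwd_int (\<lambda>t. fst (h t)) 0) + (sqrt 2 - 1) * Im (bwd_int (\<lambda>t. fst (h t)) 0)
      + Im (bwd_int (\<lambda>t. snd (h t)) 0) + (sqrt 2 + 1) * Re (bwd_int (\<lambda>t. snd (h t)) 0)"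

text \<open>Bounded continuous functions live on the whole real type; \<open>max 0\<close> extends
  the half-line solution by its value at 0, so all information lies in
  \<open>x \<ge> 0\<close>.\<close>

definition pair_solution :: "(real \<Rightarrow> complex \<times> complex) \<Rightarrow> real \<Rightarrow> complex \<times> complex" where
  "pair_solution h x = (ray_sol (of_real (boundary_value h)) (\<lambda>t. fst (h t)) (max 0 x), ray_sol (\<i> * of_real (boundary_value h)) (\<lambda>t. snd (h t)) (max 0 x))"

text \<open>One estimate covers both perturbations: the shift of \<open>\<rho>\<close> has
  \<open>R = M = 0\<close> and \<open>d = 1\<close>, while the wall error makes
  \<open>M * R + d\<close> small. The sign in \<open>e\<close> makes the value at the ground state
  positive later on. The constant 80 is a common roundup of \<open>8 * 8\<close> for the solution
  (two components, each at most \<open>4 * N y\<close>) and \<open>6 * 8\<close> for the solvability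
  functional.\<close>

lemma multiplier_operator:
  fixes m :: "real \<Rightarrow> complex \<times> complex \<Rightarrow> complex \<times> complex"
  defines "Y \<equiv> \<lambda>y :: pairfun. Bcontfun (pair_solution (\<lambda>t. m t (apply_bcontfun y t)))"
    and "e \<equiv> \<lambda>y :: pairfun. - solvability (\<lambda>t. m t (apply_bcontfun y t))"
  assumes lin: "\<And>t. linear (m t)"
    and cont: "\<And>y :: pairfun. continuous_on UNIV (\<lambda>t. m t (apply_bcontfun y t))"
    and B: "\<And>t z. norm (m t z) \<le> B * norm z"
    and RMd: "R \<ge> 0" "M \<ge> 0" "d \<ge> 0"
    and b1: "\<And>t z. t \<ge> 0 \<Longrightarrow> norm (fst (m t z)) \<le> 8 * (M * indicator {0..R} t + d) * norm z"
    and b2: "\<And>t z. t \<ge> 0 \<Longrightarrow> norm (snd (m t z)) \<le> 8 * (M * indicator {0..R} t + d) * norm z"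
  shows "\<And>y x. apply_bcontfun (Y y) x = pair_solution (\<lambda>t. m t (apply_bcontfun y t)) x"
    and "linear Y" and "linear e"
    and "\<And>y. norm (Y y) \<le> 80 * (M * R + d) * norm y" and "\<And>y. \<bar>e y\<bar> \<le> 80 * (M * R + d) * norm y"
proof -
  define h where "h y t = m t (apply_bcontfun y t)" for y :: pairfun and t
  have c1: "continuous_on UNIV (\<lambda>t. fst (h y t))" and c2: "continuous_on UNIV (\<lambda>t. snd (h y t))" for y
    unfolding h_def by (intro continuous_intros cont)+
  have B0: "B \<ge> 0"
  proof -
    have "0 \<le> B * norm ((1, 0) :: complex \<times> complex)" using B[of 0 "(1,0)"] norm_ge_zero order_trans by blast
    thus ?thesis by simp
  qed
  have hB: "norm (h y t) \<le> B * norm y" for y t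
    unfolding h_def using B[of t "apply_bcontfun y t"] norm_bounded[of y t] B0
    by (meson mult_left_mono order_trans)
  have B1: "norm (fst (h y t)) \<le> B * norm y" and B2: "norm (snd (h y t)) \<le> B * norm y" for y t
    using hB[of y t] norm_fst_le[of "fst (h y t)" "snd (h y t)"] norm_snd_le[of "snd (h y t)" "fst (h y t)"] by auto
  have w: "8 * (M * indicator {0..R} t + d) * norm (apply_bcontfun y t) \<le> (8 * M * norm y) * indicator {0..R} t + 8 * d * norm y"
    for y :: pairfun and t
  proof -
    have "8 * (M * indicator {0..R} t + d) * norm (apply_bcontfun y t) \<le> 8 * (M * indicator {0..R} t + d) * norm y"
      using RMd norm_bounded[of y t] by (intro mult_left_mono) auto
    thus ?thesis by (simp add: algebra_simps)
  qed
  have f1: "norm (fst (h y t)) \<le> (8 * M * norm y) * indicator {0..R} t + 8 * d * norm y"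
    and f2: "norm (snd (h y t)) \<le> (8 * M * norm y) * indicator {0..R} t + 8 * d * norm y" if "t \<ge> 0" for y t
    using b1[OF that, of "apply_bcontfun y t"] b2[OF that, of "apply_bcontfun y t"] w[of t y] unfolding h_def by linarith+
  define N where "N y = 8 * (M * R + d) * norm y" for y :: pairfun
  have N0: "N y \<ge> 0" for y unfolding N_def using RMd by simp
  have Neq: "8 * M * norm y * R + 8 * d * norm y = N y" for y by (simp add: N_def algebra_simps)
  have nn: "8 * M * norm y \<ge> 0" "8 * d * norm y \<ge> 0" for y :: pairfun using RMd by auto
  have I1: "norm (bwd_int (\<lambda>t. fst (h y t)) 0) \<le> N y" and I2: "norm (bwd_int (\<lambda>t. snd (h y t)) 0) \<le> N y" for y
    using norm_bwd_int_le[OF c1 _ RMd(1) nn f1, of 0 y] norm_bwd_int_le[OF c2 _ RMd(1) nn f2, of 0 y] by (simp_all add: Neq)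
  have boundary_value: "\<bar>boundary_value (h y)\<bar> \<le> N y" for y
    using I1[of y] I2[of y] abs_Re_le_cmod[of "bwd_int (\<lambda>t. fst (h y t)) 0"] abs_Im_le_cmod[of "bwd_int (\<lambda>t. snd (h y t)) 0"]
    unfolding boundary_value_def by (simp add: abs_le_iff field_simps)
  have g1: "norm (ray_sol (of_real (boundary_value (h y))) (\<lambda>t. fst (h y t)) (max 0 x)) \<le> 4 * N y"
    and g2: "norm (ray_sol (\<i> * of_real (boundary_value (h y))) (\<lambda>t. snd (h y t)) (max 0 x)) \<le> 4 * N y" for x y
    using norm_ray_sol_le(1)[OF c1 _ RMd(1) nn f1, of "max 0 x" "of_real (boundary_value (h y))" y]
      norm_ray_sol_le(1)[OF c2 _ RMd(1) nn f2, of "max 0 x" "\<i> * of_real (boundary_value (h y))" y] boundary_value[of y]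
    by (simp_all add: Neq norm_mult)
  have T: "norm (pair_solution (h y) x) \<le> 8 * N y" for x y
    unfolding pair_solution_def using norm_Pair_le[of "ray_sol (of_real (boundary_value (h y))) (\<lambda>t. fst (h y t)) (max 0 x)" "ray_sol (\<i> * of_real (boundary_value (h y))) (\<lambda>t. snd (h y t)) (max 0 x)"]
      g1[of y x] g2[of y x] by linarith
  have Tc: "continuous_on UNIV (pair_solution (h y))" for y
    unfolding pair_solution_def[abs_def] by (intro continuous_on_Pair continuous_ray_sol[OF c1 B1] continuous_ray_sol[OF c2 B2])
  have "pair_solution (h y) \<in> bcontfun" for y by (rule bcontfun_normI[OF Tc T])
  hence ap: "apply_bcontfun (Y y) = pair_solution (h y)" for y
    unfolding Y_def h_def by (simp add: Bcontfun_inverse)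
  thus "\<And>y x. apply_bcontfun (Y y) x = pair_solution (\<lambda>t. m t (apply_bcontfun y t)) x"
    by (simp add: h_def[abs_def])
  have ha: "fst (h (y + z) t) = fst (h y t) + fst (h z t)" "snd (h (y + z) t) = snd (h y t) + snd (h z t)" for y z t
    unfolding h_def by (simp_all add: linear_add[OF lin] plus_bcontfun.rep_eq)
  have hs: "fst (h (r *\<^sub>R y) t) = r *\<^sub>R fst (h y t)" "snd (h (r *\<^sub>R y) t) = r *\<^sub>R snd (h y t)" for y r t
    unfolding h_def by (simp_all add: linear_scale[OF lin] scaleR_bcontfun.rep_eq)
  note K2a = bwd_int_add[OF c1 c1 B1 B1] bwd_int_add[OF c2 c2 B2 B2]
  have bala: "boundary_value (h (y + z)) = boundary_value (h y) + boundary_value (h z)" for y z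
    unfolding boundary_value_def ha K2a by (simp add: field_simps)
  have bals: "boundary_value (h (r *\<^sub>R y)) = r * boundary_value (h y)" for y r
    unfolding boundary_value_def hs bwd_int_scaleR by (simp add: field_simps)
  have Ga: "pair_solution (h (y + z)) x = pair_solution (h y) x + pair_solution (h z) x" for y z x
    unfolding pair_solution_def ha bala of_real_add distrib_left ray_sol_add[OF c1 c1 B1 B1] ray_sol_add[OF c2 c2 B2 B2] by simp
  have Gs: "pair_solution (h (r *\<^sub>R y)) x = r *\<^sub>R pair_solution (h y) x" for y r x
  proof -
    have "of_real (r * boundary_value (h y)) = r *\<^sub>R (of_real (boundary_value (h y)) :: complex)"
      "\<i> * of_real (r * boundary_value (h y)) = r *\<^sub>R (\<i> * of_real (boundary_value (h y)) :: complex)"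
      by (simp_all add: scaleR_conv_of_real)
    thus ?thesis unfolding pair_solution_def hs bals by (simp only: ray_sol_scaleR scaleR_Pair)
  qed
  show "linear Y"
    by (rule linearI) (auto intro!: bcontfun_eqI simp: ap Ga Gs plus_bcontfun.rep_eq scaleR_bcontfun.rep_eq)
  have e: "e y = - solvability (h y)" for y by (simp add: e_def h_def[abs_def])
  show "linear e"
  proof (rule linearI)
    show "e (y + z) = e y + e z" for y z
      unfolding e solvability_def ha K2a by (simp add: algebra_simps)
    show "e (r *\<^sub>R y) = r *\<^sub>R e y" for r y
      unfolding e solvability_def hs bwd_int_scaleR by (simp add: algebra_simps)
  qed
  show "norm (Y y) \<le> 80 * (M * R + d) * norm y" for y
  proof (rule norm_bound)
    show "norm (apply_bcontfun (Y y) x) \<le> 80 * (M * R + d) * norm y" for x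
      using T[of y x] N0[of y] unfolding ap N_def by linarith
  qed
  show "\<bar>e y\<bar> \<le> 80 * (M * R + d) * norm y" for y
  proof -
    have s: "0 \<le> sqrt 2 - 1" "sqrt 2 - 1 \<le> (1::real)" "sqrt 2 + 1 \<le> (3::real)"
      using real_sqrt_le_mono[of 2 4] by auto
    define P Q where "P = bwd_int (\<lambda>t. fst (h y t)) 0" and "Q = bwd_int (\<lambda>t. snd (h y t)) 0"
    have "\<bar>Re P\<bar> \<le> N y" "\<bar>Im P\<bar> \<le> N y" "\<bar>Re Q\<bar> \<le> N y" "\<bar>Im Q\<bar> \<le> N y"
      using I1[of y] I2[of y] abs_Re_le_cmod[of P] abs_Im_le_cmod[of P] abs_Re_le_cmod[of Q] abs_Im_le_cmod[of Q]
      unfolding P_def Q_def by linarith+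
    moreover from this have "\<bar>(sqrt 2 - 1) * Im P\<bar> \<le> 1 * N y" "\<bar>(sqrt 2 + 1) * Re Q\<bar> \<le> 3 * N y"
      unfolding abs_mult using s N0[of y] by (intro mult_mono; simp)+
    ultimately have "\<bar>e y\<bar> \<le> 6 * N y" unfolding e solvability_def P_def[symmetric] Q_def[symmetric] by linarith
    thus ?thesis using N0[of y] unfolding N_def by linarith
  qed
qed

text \<open>
  The forcing produced by a change of \<open>\<rho>\<close> and by a change of the wall in the folded
  coordinates; \<open>4 \<mp> 2 sqrt 2 = 2 sqrt 2 (sqrt 2 \<mp> 1)\<close>.
\<close>

definition energy_shift :: "complex \<Rightarrow> complex" where
  "energy_shift z = Complex (- (4 - 2 * sqrt 2) * Im z) (- (4 + 2 * sqrt 2) * Re z)"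

definition wall_shift :: "complex \<Rightarrow> complex" where
  "wall_shift z = Complex (- (4 - 2 * sqrt 2) * Im z) ((4 + 2 * sqrt 2) * Re z)"

lemma bounded_linear_energy_shift: "bounded_linear energy_shift" and bounded_linear_wall_shift: "bounded_linear wall_shift"
  unfolding energy_shift_def wall_shift_def
  by (auto simp: linear_conv_bounded_linear[symmetric] complex_eq_iff algebra_simps intro!: linearI)

lemma sqrt2_mult: "sqrt 2 * (sqrt 2 * r) = 2 * r" "sqrt 2 * sqrt 2 = (2::real)" for r :: real
  by (simp_all flip: mult.assoc)

lemma sqrt2_bounds: "1 < sqrt (2::real)" "sqrt (2::real) < 2"
  using real_sqrt_less_mono[of 1 2] real_sqrt_less_mono[of 2 4] by auto

lemma norm_energy_shift_le: "norm (energy_shift z) \<le> 8 * norm z" and norm_wall_shift_le: "norm (wall_shift z) \<le> 8 * norm z"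
proof -
  have "\<bar>(4 - 2 * sqrt 2) * Im z\<bar> \<le> (4 - 2 * sqrt 2) * norm z"
    unfolding abs_mult using sqrt2_bounds abs_Im_le_cmod[of z] by (intro mult_mono) auto
  moreover have "\<bar>(4 + 2 * sqrt 2) * Re z\<bar> \<le> (4 + 2 * sqrt 2) * norm z"
    unfolding abs_mult using sqrt2_bounds abs_Re_le_cmod[of z] by (intro mult_mono) auto
  moreover have "(4 - 2 * sqrt 2) * norm z + (4 + 2 * sqrt 2) * norm z = 8 * norm z"
    by (simp add: algebra_simps)
  ultimately show "norm (energy_shift z) \<le> 8 * norm z" "norm (wall_shift z) \<le> 8 * norm z"
    using cmod_le[of "energy_shift z"] cmod_le[of "wall_shift z"] unfolding energy_shift_def wall_shift_def complex.sel
    by (simp_all only: mult_minus_left abs_minus_cancel)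
qed

text \<open>The sign wall bound state in folded form, normalized by \<open>u 0 = v 0 = 1\<close> and
  freed from the weight \<open>exp (- x / 2)\<close>; its second component is
  \<open>sqrt 2 - 1\<close> times the first.\<close>

definition ground_state :: "real \<Rightarrow> complex" where
  "ground_state x = Complex 1 (sqrt 2 + 1) * exp (- (exp_lo * of_real (max 0 x)))"

lemma continuous_ground_state: "continuous_on UNIV ground_state"
  unfolding ground_state_def[abs_def] by (intro continuous_intros)

lemma norm_ground_state_le: "norm (ground_state x) \<le> norm (Complex 1 (sqrt 2 + 1))"
  unfolding ground_state_def norm_mult by (rule mult_left_le) auto

text \<open>\<open>energy_shift\<close> is only real-linear:
  \<open>energy_shift z = - 2 sqrt 2 i z - 4 i cnj z\<close>. The forcing is therefore a combination
  of \<open>exp (- exp_lo x)\<close> and its conjugate, and so is the bounded solution of the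
  first-order equation.\<close>

lemma bwd_int_ground_state: "bwd_int (\<lambda>t. energy_shift (ground_state t)) 0 = Complex (- (2 * sqrt 2 + 1)) (- (sqrt 2 + 3))"
proof -
  \<comment> \<open>Comparison of coefficients: \<open>?A\<close> is the coefficient of
    \<open>exp (- exp_lo x)\<close> in the forcing divided by
    \<open>exp_lo + exp_hi = 2 \<omega>\<close>, and \<open>?B\<close> that of the conjugate divided
    by \<open>cnj exp_lo + exp_hi = 2\<close>.\<close>
  let ?A = "Complex 1 (- (sqrt 2 + 1))" and ?B = "Complex (- 2 * (sqrt 2 + 1)) (- 2)"
  let ?F = "\<lambda>x. ?A * exp (- (exp_lo * of_real x)) + ?B * exp (- (cnj exp_lo * of_real x))"
  have "bwd_int (\<lambda>t. energy_shift (ground_state t)) 0 = ?F 0"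
  proof (rule bwd_int_unique)
    show "continuous_on UNIV (\<lambda>t. energy_shift (ground_state t))"
      by (intro bounded_linear.continuous_on[OF bounded_linear_energy_shift] continuous_ground_state)
    show "norm (energy_shift (ground_state t)) \<le> 8 * norm (Complex 1 (sqrt 2 + 1))" for t
      using norm_energy_shift_le[of "ground_state t"] norm_ground_state_le[of t] by linarith
    show "norm (?F x) \<le> norm ?A + norm ?B" if "x \<ge> 0" for x
    proof -
      have "norm (?A * exp (- (exp_lo * of_real x))) \<le> norm ?A" "norm (?B * exp (- (cnj exp_lo * of_real x))) \<le> norm ?B"
        unfolding norm_mult using that by (auto intro!: mult_left_le)
      thus ?thesis using norm_triangle_ineq[of "?A * exp (- (exp_lo * of_real x))" "?B * exp (- (cnj exp_lo * of_real x))"]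
        by linarith
    qed
    fix x :: real assume x: "x \<ge> 0"
    define E where "E = exp (- (exp_lo * complex_of_real x))"
    have E': "exp (- (cnj exp_lo * of_real x)) = cnj E"
      unfolding E_def by (simp add: exp_cnj)
    have "(?F has_vector_derivative ?A * (- exp_lo * exp (- (exp_lo * of_real x))) + ?B * (- cnj exp_lo * exp (- (cnj exp_lo * of_real x)))) (at x within {0..})"
      by (intro has_vector_derivative_add has_vector_derivative_mult_right)
        (rule has_vector_derivative_real_field; auto intro!: derivative_eq_intros)+
    moreover have "?A * (- exp_lo * exp (- (exp_lo * of_real x))) + ?B * (- cnj exp_lo * exp (- (cnj exp_lo * of_real x)))
       = exp_hi * ?F x - energy_shift (ground_state x)"
    proof -
      note s = sqrt2_mult
      have g: "ground_state x = Complex 1 (sqrt 2 + 1) * E" using x by (simp add: ground_state_def E_def)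
      show ?thesis unfolding g E' E_def[symmetric]
        by (simp add: complex_eq_iff energy_shift_def algebra_simps s add_divide_distrib diff_divide_distrib)
    qed
    ultimately show "(?F has_vector_derivative exp_hi * ?F x - energy_shift (ground_state x)) (at x within {0..})" by simp
  qed
  thus ?thesis by (simp add: complex_eq_iff)
qed

text \<open>Smallness is measured by \<open>M * R + d'\<close>, the quantity that survives the Green
  integrals; the supremum \<open>B\<close> is merely finite. \<open>V1\<close> and \<open>V2\<close>
  stand for the deviation of the wall from 1 on the right and from -1 on the left.\<close>

definition small_potentials :: "real \<Rightarrow> (real \<Rightarrow> real) \<Rightarrow> (real \<Rightarrow> real) \<Rightarrow> bool" where
  "small_potentials d V1 V2 \<longleftrightarrow> continuous_on UNIV V1 \<and> continuous_on UNIV V2 \<and>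
     (\<exists>B. \<forall>t. \<bar>V1 t\<bar> \<le> B \<and> \<bar>V2 t\<bar> \<le> B) \<and>
     (\<exists>R\<ge>0. \<exists>M\<ge>0. \<exists>d'\<ge>0. M * R + d' \<le> d \<and>
        (\<forall>t\<ge>0. \<bar>V1 t\<bar> \<le> M * indicator {0..R} t + d' \<and> \<bar>V2 t\<bar> \<le> M * indicator {0..R} t + d'))"

text \<open>The last line expresses that \<open>u'\<close> and \<open>v'\<close> are continuous at \<open>0\<close>; \<open>v0\<close> is \<open>v 0\<close>.\<close>

definition half_line_pair where
  "half_line_pair \<mu> V1 V2 z1 z1' z2 z2' \<longleftrightarrow> (\<exists>u0 v0 C. v0 \<noteq> 0 \<and>
     (\<forall>x\<ge>0. (z1 has_vector_derivative z1' x) (at x within {0..}) \<and>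
       (z1' has_vector_derivative 2 * \<i> * z1 x + \<mu> *\<^sub>R energy_shift (z1 x) + V1 x *\<^sub>R wall_shift (z1 x)) (at x within {0..}) \<and>
       (z2 has_vector_derivative z2' x) (at x within {0..}) \<and>
       (z2' has_vector_derivative 2 * \<i> * z2 x + \<mu> *\<^sub>R energy_shift (z2 x) - V2 x *\<^sub>R wall_shift (z2 x)) (at x within {0..}) \<and>
       norm (z1 x) \<le> C * exp (-x/2) \<and> norm (z1' x) \<le> C * exp (-x/2) \<and>
       norm (z2 x) \<le> C * exp (-x/2) \<and> norm (z2' x) \<le> C * exp (-x/2)) \<and>
     z1 0 = Complex u0 ((sqrt 2 + 1) * v0) \<and> z2 0 = Complex ((sqrt 2 - 1) * v0) u0 \<and>
     Re (z1' 0) = - Im (z2' 0) \<and> (sqrt 2 - 1) * Im (z1' 0) = - (sqrt 2 + 1) * Re (z2' 0))"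

text \<open>The unknown of the fixed point is the folded pair multiplied by
  \<open>exp (x / 2)\<close>. The shift \<open>\<mu>\<close> of \<open>\<rho>\<close> supplies the
  operator \<open>A\<close> and the functional \<open>a\<close>, the wall error supplies
  \<open>B\<close> and \<open>b\<close>, and the scalar balance is the matching condition that the
  choice of \<open>u 0\<close> leaves open.\<close>

lemma half_line_solutions:
  assumes \<eta>: "\<eta> > 0"
  obtains d where "d > 0"
    and "\<And>V1 V2. small_potentials d V1 V2 \<Longrightarrow>
       \<exists>\<mu> z1 z1' z2 z2'. \<bar>\<mu>\<bar> \<le> \<eta> \<and> half_line_pair \<mu> V1 V2 z1 z1' z2 z2'"
proof -
  let ?m = "\<lambda>(t::real) z. (energy_shift (fst z), energy_shift (snd z))"
  let ?A = "\<lambda>y :: pairfun. Bcontfun (pair_solution (\<lambda>t. ?m t (apply_bcontfun y t)))"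
  let ?a = "\<lambda>y :: pairfun. - solvability (\<lambda>t. ?m t (apply_bcontfun y t))"
  note lt = bounded_linear.linear[OF bounded_linear_energy_shift] and lv = bounded_linear.linear[OF bounded_linear_wall_shift]
  have fs: "norm (fst z) \<le> norm z" "norm (snd z) \<le> norm z" for z :: "complex \<times> complex"
    using norm_fst_le[of "fst z" "snd z"] norm_snd_le[of "snd z" "fst z"] by auto
  have mlin: "linear (?m t)" for t
    by (rule linearI) (auto simp: linear_add[OF lt] linear_scale[OF lt])
  have mcont: "continuous_on UNIV (\<lambda>t. ?m t (apply_bcontfun y t))" for y :: pairfun
    by (intro continuous_on_Pair bounded_linear.continuous_on[OF bounded_linear_energy_shift] continuous_intros) auto
  have t1: "norm (energy_shift (fst z)) \<le> 8 * norm z" "norm (energy_shift (snd z)) \<le> 8 * norm z" for z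
    using norm_energy_shift_le[of "fst z"] norm_energy_shift_le[of "snd z"] fs[of z] by linarith+
  have mB: "norm (?m t z) \<le> 16 * norm z" for t z
    using norm_Pair_le[of "energy_shift (fst z)" "energy_shift (snd z)"] t1[of z] by simp
  have A: "linear ?A" "linear ?a" "\<And>y. norm (?A y) \<le> 80 * norm y" "\<And>y. \<bar>?a y\<bar> \<le> 80 * norm y"
    and Aap: "\<And>y x. apply_bcontfun (?A y) x = pair_solution (\<lambda>t. ?m t (apply_bcontfun y t)) x"
    using multiplier_operator[of ?m 16 0 0 1, OF mlin mcont mB] t1 by (simp_all del: minus_apply)
  define y0 where "y0 = Bcontfun (\<lambda>x. (ground_state x, (sqrt 2 - 1) *\<^sub>R ground_state x))"
  have y0ap: "apply_bcontfun y0 x = (ground_state x, (sqrt 2 - 1) *\<^sub>R ground_state x)" for x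
  proof -
    have "(\<lambda>x. (ground_state x, (sqrt 2 - 1) *\<^sub>R ground_state x)) \<in> bcontfun"
    proof (rule bcontfun_normI)
      show "continuous_on UNIV (\<lambda>x. (ground_state x, (sqrt 2 - 1) *\<^sub>R ground_state x))"
        by (intro continuous_intros continuous_ground_state)
      show "norm (ground_state x, (sqrt 2 - 1) *\<^sub>R ground_state x) \<le> norm (Complex 1 (sqrt 2 + 1)) + (sqrt 2 - 1) * norm (Complex 1 (sqrt 2 + 1))" for x
        using norm_Pair_le[of "ground_state x" "(sqrt 2 - 1) *\<^sub>R ground_state x"] norm_ground_state_le[of x] sqrt2_bounds
          mult_left_mono[OF norm_ground_state_le[of x], of "sqrt 2 - 1"]
        by (smt (verit) norm_scaleR)
    qed
    thus ?thesis by (simp add: y0_def Bcontfun_inverse)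
  qed
  note s2 = sqrt2_mult
  \<comment> \<open>Transversality: the matching defect moves with nonzero speed in
    \<open>\<rho>\<close>, so a small wall error can be compensated by a small
    \<open>\<mu>\<close>.\<close>
  have "?a y0 = 8 * sqrt 2"
    unfolding solvability_def y0ap fst_conv snd_conv linear_scale[OF lt] bwd_int_scaleR bwd_int_ground_state
    by (simp add: algebra_simps s2)
  hence a0: "?a y0 > 0" by simp
  obtain d where d: "d > 0" and key: "\<And>B b. linear B \<Longrightarrow> linear b \<Longrightarrow> (\<And>y. norm (B y) \<le> d * norm y) \<Longrightarrow>
          (\<And>y. \<bar>b y\<bar> \<le> d * norm y) \<Longrightarrow>
          \<exists>y \<mu>. \<bar>\<mu>\<bar> \<le> \<eta> \<and> y = y0 + \<mu> *\<^sub>R ?A y + B y \<and> \<mu> * ?a y + b y = 0"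
  proof (rule scalar_balance_perturbation[where A = ?A and a = ?a and K = 80 and ?y0.0 = y0 and \<eta> = \<eta>])
  qed (use A a0 \<eta> in auto)
  show ?thesis
  proof (rule that[of "d / 80"])
    show "d / 80 > 0" using d by simp
    fix V1 V2 assume "small_potentials (d / 80) V1 V2"
    then obtain R M d' B where cV: "continuous_on UNIV V1" "continuous_on UNIV V2"
      and BV: "\<And>t. \<bar>V1 t\<bar> \<le> B" "\<And>t. \<bar>V2 t\<bar> \<le> B"
      and RMd: "R \<ge> 0" "M \<ge> 0" "d' \<ge> 0"
      and V: "\<And>t. t \<ge> 0 \<Longrightarrow> \<bar>V1 t\<bar> \<le> M * indicator {0..R} t + d'"
         "\<And>t. t \<ge> 0 \<Longrightarrow> \<bar>V2 t\<bar> \<le> M * indicator {0..R} t + d'"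
      and small: "M * R + d' \<le> d / 80"
      unfolding small_potentials_def by blast
    \<comment> \<open>On the left half-line \<open>u\<close> and \<open>v\<close> change places in
      the folded variable, which reverses the sign of the wall error.\<close>
    let ?n = "\<lambda>t z. (V1 t *\<^sub>R wall_shift (fst z), - (V2 t *\<^sub>R wall_shift (snd z)))"
    let ?B = "\<lambda>y :: pairfun. Bcontfun (pair_solution (\<lambda>t. ?n t (apply_bcontfun y t)))"
    let ?b = "\<lambda>y :: pairfun. - solvability (\<lambda>t. ?n t (apply_bcontfun y t))"
    have nlin: "linear (?n t)" for t
      by (rule linearI) (auto simp: linear_add[OF lv] linear_scale[OF lv] algebra_simps)
    have ncont: "continuous_on UNIV (\<lambda>t. ?n t (apply_bcontfun y t))" for y :: pairfun
      by (intro continuous_on_Pair bounded_linear.continuous_on[OF bounded_linear_wall_shift] continuous_intros cV) auto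
    have nb: "norm (r *\<^sub>R wall_shift (fst z)) \<le> 8 * c * norm z" "norm (r *\<^sub>R wall_shift (snd z)) \<le> 8 * c * norm z"
      if "\<bar>r\<bar> \<le> c" for r c z
    proof -
      have "norm (wall_shift (fst z)) \<le> 8 * norm z" "norm (wall_shift (snd z)) \<le> 8 * norm z"
        using norm_wall_shift_le[of "fst z"] norm_wall_shift_le[of "snd z"] fs[of z] by linarith+
      hence "\<bar>r\<bar> * norm (wall_shift (fst z)) \<le> c * (8 * norm z)" "\<bar>r\<bar> * norm (wall_shift (snd z)) \<le> c * (8 * norm z)"
        using that by (auto intro!: mult_mono)
      thus "norm (r *\<^sub>R wall_shift (fst z)) \<le> 8 * c * norm z" "norm (r *\<^sub>R wall_shift (snd z)) \<le> 8 * c * norm z"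
        by simp_all
    qed
    have nB: "norm (?n t z) \<le> 16 * B * norm z" for t z
      using norm_Pair_le[of "V1 t *\<^sub>R wall_shift (fst z)" "- (V2 t *\<^sub>R wall_shift (snd z))"] nb(1)[OF BV(1)[of t], of z] nb(2)[OF BV(2)[of t], of z]
      by simp
    have nb1: "norm (fst (?n t z)) \<le> 8 * (M * indicator {0..R} t + d') * norm z"
      and nb2: "norm (snd (?n t z)) \<le> 8 * (M * indicator {0..R} t + d') * norm z" if "t \<ge> 0" for t z
      using nb(1)[OF V(1)[OF that], of z] nb(2)[OF V(2)[OF that], of z] by simp_all
    note mo = multiplier_operator[of ?n, OF nlin ncont nB RMd nb1 nb2]
    have le: "80 * (M * R + d') * norm y \<le> d * norm y" for y :: pairfun
      using small by (intro mult_right_mono) auto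
    obtain y \<mu> where \<mu>: "\<bar>\<mu>\<bar> \<le> \<eta>" and y: "y = y0 + \<mu> *\<^sub>R ?A y + ?B y" and sol: "\<mu> * ?a y + ?b y = 0"
      using key[OF mo(2,3) order_trans[OF mo(4) le] order_trans[OF mo(5) le]] by auto
    define y1 y2 where "y1 t = fst (apply_bcontfun y t)" and "y2 t = snd (apply_bcontfun y t)" for t
    have cy: "continuous_on UNIV y1" "continuous_on UNIV y2"
      unfolding y1_def[abs_def] y2_def[abs_def] by (intro continuous_intros; simp)+
    have yb: "norm (y1 t) \<le> norm y" "norm (y2 t) \<le> norm y" for t
      unfolding y1_def y2_def using fs[of "apply_bcontfun y t"] norm_bounded[of y t] by linarith+
    define h1 h2 where "h1 t = \<mu> *\<^sub>R energy_shift (y1 t) + V1 t *\<^sub>R wall_shift (y1 t)"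
      and "h2 t = \<mu> *\<^sub>R energy_shift (y2 t) + - (V2 t *\<^sub>R wall_shift (y2 t))" for t
    have ct: "continuous_on UNIV (\<lambda>t. energy_shift (y1 t))" "continuous_on UNIV (\<lambda>t. energy_shift (y2 t))"
      by (intro bounded_linear.continuous_on[OF bounded_linear_energy_shift] cy)+
    have cv: "continuous_on UNIV (\<lambda>t. V1 t *\<^sub>R wall_shift (y1 t))" "continuous_on UNIV (\<lambda>t. - (V2 t *\<^sub>R wall_shift (y2 t)))"
      by (intro continuous_intros cV bounded_linear.continuous_on[OF bounded_linear_wall_shift] cy)+
    have ct': "continuous_on UNIV (\<lambda>t. \<mu> *\<^sub>R energy_shift (y1 t))" "continuous_on UNIV (\<lambda>t. \<mu> *\<^sub>R energy_shift (y2 t))"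
      by (intro continuous_intros ct)+
    have ch: "continuous_on UNIV h1" "continuous_on UNIV h2"
      unfolding h1_def[abs_def] h2_def[abs_def] by (intro continuous_intros ct cv)+
    let ?N = "8 * norm y"
    have bt: "norm (energy_shift (y1 t)) \<le> ?N" "norm (energy_shift (y2 t)) \<le> ?N" for t
      using norm_energy_shift_le[of "y1 t"] norm_energy_shift_le[of "y2 t"] yb[of t] by linarith+
    have bt': "norm (\<mu> *\<^sub>R energy_shift (y1 t)) \<le> \<bar>\<mu>\<bar> * ?N" "norm (\<mu> *\<^sub>R energy_shift (y2 t)) \<le> \<bar>\<mu>\<bar> * ?N" for t
      unfolding norm_scaleR using bt[of t] by (intro mult_left_mono; simp)+
    have bv: "norm (V1 t *\<^sub>R wall_shift (y1 t)) \<le> 8 * B * norm y" "norm (- (V2 t *\<^sub>R wall_shift (y2 t))) \<le> 8 * B * norm y" for t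
    proof -
      have B0: "B \<ge> 0" using BV(1)[of 0] by linarith
      have "8 * B * norm (apply_bcontfun y t) \<le> 8 * B * norm y"
        using norm_bounded[of y t] B0 by (intro mult_left_mono) auto
      thus "norm (V1 t *\<^sub>R wall_shift (y1 t)) \<le> 8 * B * norm y" "norm (- (V2 t *\<^sub>R wall_shift (y2 t))) \<le> 8 * B * norm y"
        using nb(1)[OF BV(1)[of t], of "apply_bcontfun y t"] nb(2)[OF BV(2)[of t], of "apply_bcontfun y t"]
        unfolding y1_def y2_def norm_minus_cancel by linarith+
    qed
    let ?H = "\<bar>\<mu>\<bar> * ?N + 8 * B * norm y"
    have bh: "norm (h1 t) \<le> ?H" "norm (h2 t) \<le> ?H" for t
      unfolding h1_def h2_def using bt'[of t] bv[of t] by (intro norm_triangle_le; linarith)+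
    have H0: "?H \<ge> 0" using bh(1)[of 0] norm_ge_zero order_trans by blast
    have K2h: "bwd_int h1 x = \<mu> *\<^sub>R bwd_int (\<lambda>t. energy_shift (y1 t)) x + bwd_int (\<lambda>t. V1 t *\<^sub>R wall_shift (y1 t)) x"
      "bwd_int h2 x = \<mu> *\<^sub>R bwd_int (\<lambda>t. energy_shift (y2 t)) x + bwd_int (\<lambda>t. - (V2 t *\<^sub>R wall_shift (y2 t))) x" for x
      unfolding h1_def[abs_def] h2_def[abs_def]
      by (simp_all only: bwd_int_add[OF ct'(1) cv(1) bt'(1) bv(1)] bwd_int_add[OF ct'(2) cv(2) bt'(2) bv(2)] bwd_int_scaleR)
    let ?My = "\<lambda>t. ?m t (apply_bcontfun y t)" and ?Ny = "\<lambda>t. ?n t (apply_bcontfun y t)"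
    \<comment> \<open>\<open>bb\<close> is the total change of \<open>u 0\<close>; with
      \<open>v 0 = 1\<close> the corrected boundary data are \<open>?w1\<close> and
      \<open>?w2\<close>.\<close>
    define bb where "bb = - (Re (bwd_int h1 0) + Im (bwd_int h2 0)) / 2"
    let ?w1 = "Complex (1 + bb) (sqrt 2 + 1)" and ?w2 = "Complex (sqrt 2 - 1) (1 + bb)"
    have bb: "bb = \<mu> * boundary_value ?My + boundary_value ?Ny"
      unfolding bb_def K2h boundary_value_def fst_conv snd_conv y1_def[symmetric] y2_def[symmetric] by (simp add: field_simps)
    have yx: "apply_bcontfun y x = apply_bcontfun y0 x + \<mu> *\<^sub>R pair_solution ?My x
        + pair_solution ?Ny x" for x
    proof -
      have "apply_bcontfun y x = apply_bcontfun (y0 + \<mu> *\<^sub>R ?A y + ?B y) x" using y by simp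
      thus ?thesis by (simp only: plus_bcontfun.rep_eq scaleR_bcontfun.rep_eq Aap mo(1))
    qed
    have g0: "ground_state x = ray_sol (Complex 1 (sqrt 2 + 1)) (\<lambda>t. 0) x" if "x \<ge> 0" for x
      using that by (simp add: ground_state_def ray_sol_def fwd_int_def bwd_int_def)
    have Geq: "ray_sol (a + r *\<^sub>R b + c) (\<lambda>t. r *\<^sub>R f t + g t) x = ray_sol a (\<lambda>t. 0) x + r *\<^sub>R ray_sol b f x + ray_sol c g x"
      if "continuous_on UNIV f" "continuous_on UNIV g" "\<And>t. norm (r *\<^sub>R f t) \<le> Bf" "\<And>t. norm (g t) \<le> Bg"
      for a b c r f g x Bf Bg
    proof -
      have cf: "continuous_on UNIV (\<lambda>t. r *\<^sub>R f t)" by (intro continuous_intros that)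
      have "ray_sol (a + r *\<^sub>R b + c) (\<lambda>t. (0 + r *\<^sub>R f t) + g t) x = ray_sol (a + r *\<^sub>R b) (\<lambda>t. 0 + r *\<^sub>R f t) x + ray_sol c g x"
        using that(3) by (intro ray_sol_add[of _ _ Bf Bg] that continuous_intros) simp
      also have "ray_sol (a + r *\<^sub>R b) (\<lambda>t. 0 + r *\<^sub>R f t) x = ray_sol a (\<lambda>t. 0) x + ray_sol (r *\<^sub>R b) (\<lambda>t. r *\<^sub>R f t) x"
        by (intro ray_sol_add[of _ _ 0 Bf] that cf continuous_intros) simp
      finally show ?thesis by (simp add: ray_sol_scaleR)
    qed
    \<comment> \<open>\<open>ray_sol\<close> is jointly linear in boundary value and forcing, so the
      ground state and both corrections merge into one solution with forcing \<open>h1\<close>.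
      Since \<open>h1\<close> is built from \<open>y1\<close> itself, the Green formula then turns
      into the differential equation.\<close>
    have y1G: "y1 x = ray_sol ?w1 h1 x" if x: "x \<ge> 0" for x
    proof -
      have "?w1 = Complex 1 (sqrt 2 + 1) + \<mu> *\<^sub>R of_real (boundary_value ?My)
          + of_real (boundary_value ?Ny)"
        by (simp add: complex_eq_iff bb)
      hence "ray_sol ?w1 h1 x = ray_sol (Complex 1 (sqrt 2 + 1)) (\<lambda>t. 0) x
          + \<mu> *\<^sub>R ray_sol (of_real (boundary_value ?My)) (\<lambda>t. energy_shift (y1 t)) x
          + ray_sol (of_real (boundary_value ?Ny)) (\<lambda>t. V1 t *\<^sub>R wall_shift (y1 t)) x"
        unfolding h1_def[abs_def] by (simp only: Geq[OF ct(1) cv(1) bt'(1) bv(1)])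
      also have "\<dots> = y1 x"
        unfolding y1_def yx[of x] y0ap using x by (simp add: pair_solution_def g0 max_def)
      finally show ?thesis ..
    qed
    have y2G: "y2 x = ray_sol ?w2 h2 x" if x: "x \<ge> 0" for x
    proof -
      have "?w2 = (sqrt 2 - 1) *\<^sub>R Complex 1 (sqrt 2 + 1) + \<mu> *\<^sub>R (\<i> * of_real (boundary_value ?My))
          + \<i> * of_real (boundary_value ?Ny)"
        by (simp add: complex_eq_iff bb algebra_simps)
      hence "ray_sol ?w2 h2 x = ray_sol ((sqrt 2 - 1) *\<^sub>R Complex 1 (sqrt 2 + 1)) (\<lambda>t. 0) x
          + \<mu> *\<^sub>R ray_sol (\<i> * of_real (boundary_value ?My)) (\<lambda>t. energy_shift (y2 t)) x
          + ray_sol (\<i> * of_real (boundary_value ?Ny)) (\<lambda>t. - (V2 t *\<^sub>R wall_shift (y2 t))) x"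
        unfolding h2_def[abs_def] by (simp only: Geq[OF ct(2) cv(2) bt'(2) bv(2)])
      also have "ray_sol ((sqrt 2 - 1) *\<^sub>R Complex 1 (sqrt 2 + 1)) (\<lambda>t. 0) x = (sqrt 2 - 1) *\<^sub>R ground_state x"
        using ray_sol_scaleR[of "sqrt 2 - 1" "Complex 1 (sqrt 2 + 1)" "\<lambda>t. 0" x] g0[OF x] by simp
      also have "(sqrt 2 - 1) *\<^sub>R ground_state x
          + \<mu> *\<^sub>R ray_sol (\<i> * of_real (boundary_value ?My)) (\<lambda>t. energy_shift (y2 t)) x
          + ray_sol (\<i> * of_real (boundary_value ?Ny)) (\<lambda>t. - (V2 t *\<^sub>R wall_shift (y2 t))) x = y2 x"
        unfolding y2_def yx[of x] y0ap using x by (simp add: pair_solution_def max_def)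
      finally show ?thesis ..
    qed
    let ?z1 = "\<lambda>x. exp (-x/2) *\<^sub>R ray_sol ?w1 h1 x"
    let ?z1' = "\<lambda>x. exp (-x/2) *\<^sub>R ray_slope ?w1 h1 x"
    let ?z2 = "\<lambda>x. exp (-x/2) *\<^sub>R ray_sol ?w2 h2 x"
    let ?z2' = "\<lambda>x. exp (-x/2) *\<^sub>R ray_slope ?w2 h2 x"
    have p1: "exp (-x/2) *\<^sub>R (2 * \<i> * ray_sol ?w1 h1 x + h1 x)
        = 2 * \<i> * ?z1 x + \<mu> *\<^sub>R energy_shift (?z1 x) + V1 x *\<^sub>R wall_shift (?z1 x)" if "x \<ge> 0" for x
      unfolding y1G[OF that, symmetric] h1_def linear_scale[OF lt] linear_scale[OF lv]
      by (simp add: algebra_simps)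
    have p2: "exp (-x/2) *\<^sub>R (2 * \<i> * ray_sol ?w2 h2 x + h2 x)
        = 2 * \<i> * ?z2 x + \<mu> *\<^sub>R energy_shift (?z2 x) - V2 x *\<^sub>R wall_shift (?z2 x)" if "x \<ge> 0" for x
      unfolding y2G[OF that, symmetric] h2_def linear_scale[OF lt] linear_scale[OF lv]
      by (simp add: algebra_simps)
    obtain C where C: "\<And>x. x \<ge> 0 \<Longrightarrow> norm (ray_sol ?w1 h1 x) \<le> C"
      "\<And>x. x \<ge> 0 \<Longrightarrow> norm (ray_slope ?w1 h1 x) \<le> C"
      "\<And>x. x \<ge> 0 \<Longrightarrow> norm (ray_sol ?w2 h2 x) \<le> C"
      "\<And>x. x \<ge> 0 \<Longrightarrow> norm (ray_slope ?w2 h2 x) \<le> C"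
    proof
      define H a1 a2 where "H = ?H" and "a1 = norm ?w1" and "a2 = norm ?w2"
      have n0: "H \<ge> 0" "a1 \<ge> 0" "a2 \<ge> 0" using H0 by (simp_all add: H_def a1_def a2_def)
      have bh': "norm (h1 t) \<le> 0 * indicator {0..0} t + H" "norm (h2 t) \<le> 0 * indicator {0..0} t + H" for t
        using bh[of t] by (simp_all add: H_def)
      fix x :: real assume x: "x \<ge> 0"
      show "norm (ray_sol ?w1 h1 x) \<le> 2 * a1 + 2 * a2 + 4 * H"
        "norm (ray_slope ?w1 h1 x) \<le> 2 * a1 + 2 * a2 + 4 * H"
        using norm_ray_sol_le[OF ch(1) x order_refl order_refl n0(1) bh'(1), of ?w1, folded a1_def] n0
        by simp_all
      show "norm (ray_sol ?w2 h2 x) \<le> 2 * a1 + 2 * a2 + 4 * H"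
        "norm (ray_slope ?w2 h2 x) \<le> 2 * a1 + 2 * a2 + 4 * H"
        using norm_ray_sol_le[OF ch(2) x order_refl order_refl n0(1) bh'(2), of ?w2, folded a2_def] n0
        by simp_all
    qed
    have ell0: "Re (bwd_int h1 0) + (sqrt 2 - 1) * Im (bwd_int h1 0) + Im (bwd_int h2 0) + (sqrt 2 + 1) * Re (bwd_int h2 0) = 0"
      (is "?L = 0")
    proof -
      have "?L = - (\<mu> * ?a y + ?b y)"
        unfolding K2h solvability_def fst_conv snd_conv y1_def[symmetric] y2_def[symmetric]
        by (simp add: algebra_simps)
      thus ?thesis using sol by simp
    qed
    \<comment> \<open>By \<open>ray_slope_zero\<close> the two slope conditions prescribe
      \<open>2 * bb\<close>. Their homogeneous parts agree because \<open>1 / c - c = 2\<close> for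
      \<open>c = sqrt 2 - 1\<close>. The first condition holds by the choice of \<open>bb\<close>;
      the second then is equivalent to the vanishing of the solvability functional.\<close>
    have bdry1: "Re (?z1' 0) = - Im (?z2' 0)"
      unfolding ray_slope_zero bb_def by (simp add: field_simps)
    have bdry2: "(sqrt 2 - 1) * Im (?z1' 0) = - (sqrt 2 + 1) * Re (?z2' 0)"
    proof -
      have "2 * bb = (sqrt 2 - 1) * Im (bwd_int h1 0) + (sqrt 2 + 1) * Re (bwd_int h2 0)"
        using ell0 unfolding bb_def by simp
      thus ?thesis unfolding ray_slope_zero by (simp add: algebra_simps)
    qed
    have "half_line_pair \<mu> V1 V2 ?z1 ?z1' ?z2 ?z2'"
      unfolding half_line_pair_def
    proof (rule exI[of _ "1 + bb"], rule exI[of _ 1], rule exI[of _ C], intro conjI allI impI)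
      show "(1::real) \<noteq> 0" by simp
      show "?z1 0 = Complex (1 + bb) ((sqrt 2 + 1) * 1)" "?z2 0 = Complex ((sqrt 2 - 1) * 1) (1 + bb)" by (simp_all add: ray_sol_zero)
      show "Re (?z1' 0) = - Im (?z2' 0)" by (rule bdry1)
      show "(sqrt 2 - 1) * Im (?z1' 0) = - (sqrt 2 + 1) * Re (?z2' 0)" by (rule bdry2)
      fix x :: real assume x: "0 \<le> x"
      show "(?z1 has_vector_derivative ?z1' x) (at x within {0..})" by (rule ray_sol_ode(1)[OF ch(1) bh(1) x])
      show "(?z2 has_vector_derivative ?z2' x) (at x within {0..})" by (rule ray_sol_ode(1)[OF ch(2) bh(2) x])
      show "(?z1' has_vector_derivative 2 * \<i> * ?z1 x + \<mu> *\<^sub>R energy_shift (?z1 x) + V1 x *\<^sub>R wall_shift (?z1 x)) (at x within {0..})"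
        using ray_sol_ode(2)[OF ch(1) bh(1) x, where a = ?w1] unfolding p1[OF x] .
      show "(?z2' has_vector_derivative 2 * \<i> * ?z2 x + \<mu> *\<^sub>R energy_shift (?z2 x) - V2 x *\<^sub>R wall_shift (?z2 x)) (at x within {0..})"
        using ray_sol_ode(2)[OF ch(2) bh(2) x, where a = ?w2] unfolding p2[OF x] .
      show "norm (?z1 x) \<le> C * exp (-x/2)" "norm (?z1' x) \<le> C * exp (-x/2)"
        "norm (?z2 x) \<le> C * exp (-x/2)" "norm (?z2' x) \<le> C * exp (-x/2)"
        using C[OF x] by (simp_all add: mult.commute)
    qed
    thus "\<exists>\<mu> z1 z1' z2 z2'. \<bar>\<mu>\<bar> \<le> \<eta> \<and> half_line_pair \<mu> V1 V2 z1 z1' z2 z2'"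
      using \<mu> by blast
  qed
qed

section \<open>Decaying solutions for steep walls\<close>

text \<open>Derivatives are asked for off 0 only, so that the sign wall is included; continuity of
  \<open>u1\<close> and \<open>v1\<close> across 0 is what places the solution in
  \<open>H\<^sup>2\<close>.\<close>

definition profiles :: "real \<Rightarrow> (real \<Rightarrow> real) \<Rightarrow> real \<Rightarrow> (real \<Rightarrow> real) \<Rightarrow> (real \<Rightarrow> real) \<Rightarrow> (real \<Rightarrow> real) \<Rightarrow> (real \<Rightarrow> real) \<Rightarrow> bool" where
  "profiles l w \<rho> u v u1 v1 \<longleftrightarrow>
     continuous_on UNIV u \<and> continuous_on UNIV v \<and> continuous_on UNIV u1 \<and> continuous_on UNIV v1 \<and>
     (\<forall>x. x \<noteq> 0 \<longrightarrow> (u has_real_derivative u1 x) (at x) \<and> (v has_real_derivative v1 x) (at x) \<and>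
        (u1 has_real_derivative - l * (w x + \<rho>) * v x) (at x) \<and>
        (v1 has_real_derivative l * (w x - \<rho>) * u x) (at x)) \<and>
     (\<exists>C \<eta>. \<eta> > 0 \<and> (\<forall>x. \<bar>u x\<bar> \<le> C * exp (- \<eta> * \<bar>x\<bar>) \<and> \<bar>v x\<bar> \<le> C * exp (- \<eta> * \<bar>x\<bar>) \<and>
        \<bar>u1 x\<bar> \<le> C * exp (- \<eta> * \<bar>x\<bar>) \<and> \<bar>v1 x\<bar> \<le> C * exp (- \<eta> * \<bar>x\<bar>))) \<and>
     (\<exists>x. u x \<noteq> 0 \<or> v x \<noteq> 0)"

lemma profilesD:
  assumes "profiles l w \<rho> u v u1 v1"
  shows "continuous_on UNIV u" "continuous_on UNIV v" "continuous_on UNIV u1" "continuous_on UNIV v1"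
    and "\<And>x. x \<noteq> 0 \<Longrightarrow> (u has_real_derivative u1 x) (at x)"
      "\<And>x. x \<noteq> 0 \<Longrightarrow> (v has_real_derivative v1 x) (at x)"
      "\<And>x. x \<noteq> 0 \<Longrightarrow> (u1 has_real_derivative - l * (w x + \<rho>) * v x) (at x)"
      "\<And>x. x \<noteq> 0 \<Longrightarrow> (v1 has_real_derivative l * (w x - \<rho>) * u x) (at x)"
  using assms unfolding profiles_def by blast+

text \<open>Second derivatives pick up \<open>k\<^sup>2\<close>. This reduces any coupling to
  \<open>2 sqrt 2\<close> at the price of a wall width multiplied by \<open>k\<close>, which a
  statement about all small widths absorbs.\<close>

lemma profiles_rescale:
  assumes p: "profiles l (\<lambda>x. w (x / k)) \<rho> u v u1 v1" and k: "k > 0"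
  shows "profiles (l * k\<^sup>2) w \<rho> (\<lambda>x. u (k * x)) (\<lambda>x. v (k * x)) (\<lambda>x. k * u1 (k * x)) (\<lambda>x. k * v1 (k * x))"
proof -
  have cont: "continuous_on UNIV (\<lambda>x. f (k * x))" if "continuous_on UNIV f" for f :: "real \<Rightarrow> real"
    by (rule continuous_on_compose2[OF that]) (auto intro!: continuous_intros)
  have der: "((\<lambda>x. f (k * x)) has_real_derivative f' * k) (at x)" if "(f has_real_derivative f') (at (k * x))" for f f' x
    by (rule DERIV_chain'[of "\<lambda>x. k * x" k, OF _ that]) (auto intro!: derivative_eq_intros)
  from p obtain C \<eta> where \<eta>: "\<eta> > 0" and b: "\<And>x. \<bar>u x\<bar> \<le> C * exp (- \<eta> * \<bar>x\<bar>)" "\<And>x. \<bar>v x\<bar> \<le> C * exp (- \<eta> * \<bar>x\<bar>)"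
        "\<And>x. \<bar>u1 x\<bar> \<le> C * exp (- \<eta> * \<bar>x\<bar>)" "\<And>x. \<bar>v1 x\<bar> \<le> C * exp (- \<eta> * \<bar>x\<bar>)"
    unfolding profiles_def by blast
  have C: "C \<ge> 0" using b(1)[of 0] by simp
  have bd: "\<bar>f (k * x)\<bar> \<le> (1 + k) * C * exp (- (\<eta> * k) * \<bar>x\<bar>)" "\<bar>k * f (k * x)\<bar> \<le> (1 + k) * C * exp (- (\<eta> * k) * \<bar>x\<bar>)"
    if "\<And>x. \<bar>f x\<bar> \<le> C * exp (- \<eta> * \<bar>x\<bar>)" for f x
  proof -
    define E where "E = C * exp (- (\<eta> * k) * \<bar>x\<bar>)"
    have "\<bar>f (k * x)\<bar> \<le> E" using that[of "k * x"] k by (simp add: abs_mult E_def mult.assoc)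
    moreover have "E \<ge> 0" using C by (simp add: E_def)
    ultimately have "\<bar>f (k * x)\<bar> \<le> (1 + k) * E" "\<bar>k * f (k * x)\<bar> \<le> (1 + k) * E"
      using k by (auto simp: abs_mult algebra_simps add_increasing add_increasing2 mult_left_mono)
    thus "\<bar>f (k * x)\<bar> \<le> (1 + k) * C * exp (- (\<eta> * k) * \<bar>x\<bar>)" "\<bar>k * f (k * x)\<bar> \<le> (1 + k) * C * exp (- (\<eta> * k) * \<bar>x\<bar>)"
      by (simp_all add: E_def mult.assoc)
  qed
  have nz: "\<exists>x. u (k * x) \<noteq> 0 \<or> v (k * x) \<noteq> 0"
  proof -
    from p obtain x where "u x \<noteq> 0 \<or> v x \<noteq> 0" unfolding profiles_def by blast
    hence "u (k * (x / k)) \<noteq> 0 \<or> v (k * (x / k)) \<noteq> 0" using k by simp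
    thus ?thesis by blast
  qed
  have d: "((\<lambda>x. u (k * x)) has_real_derivative k * u1 (k * x)) (at x)"
       "((\<lambda>x. v (k * x)) has_real_derivative k * v1 (k * x)) (at x)"
       "((\<lambda>x. k * u1 (k * x)) has_real_derivative - (l * k\<^sup>2) * (w x + \<rho>) * v (k * x)) (at x)"
       "((\<lambda>x. k * v1 (k * x)) has_real_derivative l * k\<^sup>2 * (w x - \<rho>) * u (k * x)) (at x)" if "x \<noteq> 0" for x
  proof -
    have q: "(u has_real_derivative u1 (k*x)) (at (k*x))" "(v has_real_derivative v1 (k*x)) (at (k*x))"
        "(u1 has_real_derivative - l * (w x + \<rho>) * v (k*x)) (at (k*x))"
        "(v1 has_real_derivative l * (w x - \<rho>) * u (k*x)) (at (k*x))"
      using profilesD(5-8)[OF p, of "k * x"] k that by auto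
    show "((\<lambda>x. u (k * x)) has_real_derivative k * u1 (k * x)) (at x)"
       "((\<lambda>x. v (k * x)) has_real_derivative k * v1 (k * x)) (at x)"
      using der[OF q(1)] der[OF q(2)] by (simp_all add: mult.commute)
    show "((\<lambda>x. k * u1 (k * x)) has_real_derivative - (l * k\<^sup>2) * (w x + \<rho>) * v (k * x)) (at x)"
      using DERIV_cmult[OF der[OF q(3)], of k] by (simp add: power2_eq_square mult_ac)
    show "((\<lambda>x. k * v1 (k * x)) has_real_derivative l * k\<^sup>2 * (w x - \<rho>) * u (k * x)) (at x)"
      using DERIV_cmult[OF der[OF q(4)], of k] by (simp add: power2_eq_square mult_ac)
  qed
  show ?thesis
    unfolding profiles_def
  proof (intro conjI allI impI)
    show "\<exists>C \<eta>. \<eta> > 0 \<and> (\<forall>x. \<bar>u (k * x)\<bar> \<le> C * exp (- \<eta> * \<bar>x\<bar>) \<and> \<bar>v (k * x)\<bar> \<le> C * exp (- \<eta> * \<bar>x\<bar>) \<and>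
        \<bar>k * u1 (k * x)\<bar> \<le> C * exp (- \<eta> * \<bar>x\<bar>) \<and> \<bar>k * v1 (k * x)\<bar> \<le> C * exp (- \<eta> * \<bar>x\<bar>))"
      using bd(1)[OF b(1)] bd(1)[OF b(2)] bd(2)[OF b(3)] bd(2)[OF b(4)] \<eta> k
      by (intro exI[of _ "(1 + k) * C"] exI[of _ "\<eta> * k"]) auto
  qed (use p d nz in \<open>auto simp: profiles_def intro!: cont continuous_on_mult_left\<close>)
qed

lemma glued_derivative:
  fixes a b :: "real \<Rightarrow> real"
  assumes "x > 0 \<Longrightarrow> (a has_real_derivative a') (at x within {0..})"
    and "x < 0 \<Longrightarrow> (b has_real_derivative b') (at (- x) within {0..})" and "x \<noteq> 0"
  shows "((\<lambda>x. if x \<ge> 0 then a x else b (- x)) has_real_derivative (if x \<ge> 0 then a' else - b')) (at x)"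
proof (cases "x > 0")
  case True
  have "(a has_real_derivative a') (at x)"
  proof -
    have "at x within {0..} = at x" by (rule at_within_interior) (use True in auto)
    thus ?thesis using assms(1)[OF True] by simp
  qed
  hence "((\<lambda>x. if x \<ge> 0 then a x else b (- x)) has_real_derivative a') (at x)"
    by (rule has_field_derivative_transform_within_open[where S = "{0<..}"]) (use True in auto)
  thus ?thesis using True by simp
next
  case False
  hence x: "x < 0" using assms(3) by simp
  have "(b has_real_derivative b') (at (- x))"
  proof -
    have "at (- x) within {0..} = at (- x)" by (rule at_within_interior) (use x in auto)
    thus ?thesis using assms(2)[OF x] by simp
  qed
  hence "((\<lambda>x. b (- x)) has_real_derivative - b') (at x)"
    using DERIV_mirror[of b b' x] by simp
  hence "((\<lambda>x. if x \<ge> 0 then a x else b (- x)) has_real_derivative - b') (at x)"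
    by (rule has_field_derivative_transform_within_open[where S = "{..<0}"]) (use x in auto)
  thus ?thesis using x by simp
qed

lemma glued_continuous:
  fixes a b :: "real \<Rightarrow> real"
  assumes "continuous_on {0..} a" "continuous_on {0..} b" "a 0 = b 0"
  shows "continuous_on UNIV (\<lambda>x. if x \<ge> 0 then a x else b (- x))"
proof -
  have "continuous_on {..0} (\<lambda>x. b (- x))"
    by (rule continuous_on_compose2[OF assms(2)]) (auto intro!: continuous_intros)
  hence "continuous_on ({0..} \<union> {..0}) (\<lambda>x. if x \<ge> 0 then a x else b (- x))"
    using assms by (intro continuous_on_cases) auto
  moreover have "{0..} \<union> {..0} = (UNIV :: real set)" by auto
  ultimately show ?thesis by simp
qed

lemma glued_bound:
  fixes a b :: "real \<Rightarrow> real"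
  assumes "\<And>x. x \<ge> 0 \<Longrightarrow> \<bar>a x\<bar> \<le> C * exp (- x / 2)" "\<And>x. x \<ge> 0 \<Longrightarrow> \<bar>b x\<bar> \<le> C * exp (- x / 2)"
  shows "\<bar>if x \<ge> 0 then a x else b (- x)\<bar> \<le> C * exp (- (1/2) * \<bar>x\<bar>)"
  using assms(1)[of x] assms(2)[of "-x"] by auto

text \<open>This inverts the folding: as \<open>(sqrt 2 - 1) * (sqrt 2 + 1) = 1\<close>, the
  boundary relations of the pair are exactly the continuity of \<open>u\<close>, \<open>v\<close>,
  \<open>u1\<close>, \<open>v1\<close> at 0. The link between \<open>V1\<close>, \<open>V2\<close>
  and the wall is required for \<open>x > 0\<close> only, which admits \<open>sgn\<close>, whose
  value at 0 fits neither side.\<close>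

lemma whole_line_profiles:
  fixes z1 z2 z1' z2' :: "real \<Rightarrow> complex"
  defines "u \<equiv> \<lambda>x. if x \<ge> 0 then Re (z1 x) else Im (z2 (- x))"
    and "v \<equiv> \<lambda>x. if x \<ge> 0 then (sqrt 2 - 1) * Im (z1 x) else (sqrt 2 + 1) * Re (z2 (- x))"
    and "u1 \<equiv> \<lambda>x. if x \<ge> 0 then Re (z1' x) else - Im (z2' (- x))"
    and "v1 \<equiv> \<lambda>x. if x \<ge> 0 then (sqrt 2 - 1) * Im (z1' x) else - ((sqrt 2 + 1) * Re (z2' (- x)))"
  assumes pair: "half_line_pair \<mu> V1 V2 z1 z1' z2 z2'"
    and V: "\<And>x. x > 0 \<Longrightarrow> V1 x = w x - 1" "\<And>x. x > 0 \<Longrightarrow> V2 x = w (- x) + 1"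
  shows "profiles (2 * sqrt 2) w (1 / sqrt 2 + \<mu>) u v u1 v1"
proof -
  from pair obtain u0 v0 C where v0: "v0 \<noteq> 0" and z: "\<And>x. x \<ge> 0 \<Longrightarrow> (z1 has_vector_derivative z1' x) (at x within {0..})"
      "\<And>x. x \<ge> 0 \<Longrightarrow> (z1' has_vector_derivative 2 * \<i> * z1 x + \<mu> *\<^sub>R energy_shift (z1 x) + V1 x *\<^sub>R wall_shift (z1 x)) (at x within {0..})"
      "\<And>x. x \<ge> 0 \<Longrightarrow> (z2 has_vector_derivative z2' x) (at x within {0..})"
      "\<And>x. x \<ge> 0 \<Longrightarrow> (z2' has_vector_derivative 2 * \<i> * z2 x + \<mu> *\<^sub>R energy_shift (z2 x) - V2 x *\<^sub>R wall_shift (z2 x)) (at x within {0..})"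
    and b: "\<And>x. x \<ge> 0 \<Longrightarrow> norm (z1 x) \<le> C * exp (-x/2)" "\<And>x. x \<ge> 0 \<Longrightarrow> norm (z1' x) \<le> C * exp (-x/2)"
      "\<And>x. x \<ge> 0 \<Longrightarrow> norm (z2 x) \<le> C * exp (-x/2)" "\<And>x. x \<ge> 0 \<Longrightarrow> norm (z2' x) \<le> C * exp (-x/2)"
    and z0: "z1 0 = Complex u0 ((sqrt 2 + 1) * v0)" "z2 0 = Complex ((sqrt 2 - 1) * v0) u0"
    and z0': "Re (z1' 0) = - Im (z2' 0)" "(sqrt 2 - 1) * Im (z1' 0) = - (sqrt 2 + 1) * Re (z2' 0)"
    unfolding half_line_pair_def by blast
  note s2 = sqrt2_mult
  have RI: "((\<lambda>x. Re (f x)) has_real_derivative Re f') F" "((\<lambda>x. Im (f x)) has_real_derivative Im f') F"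
    if "(f has_vector_derivative f') F" for f f' F
    using has_derivative_Re[OF that[unfolded has_vector_derivative_def]] has_derivative_Im[OF that[unfolded has_vector_derivative_def]]
    by (auto simp: has_field_derivative_def mult.commute[of _ "Re f'"] mult.commute[of _ "Im f'"] elim!: has_derivative_eq_rhs)
  have C0: "C \<ge> 0" using order_trans[OF norm_ge_zero b(1)[of 0]] by simp
  have cz: "continuous_on {0..} z1" "continuous_on {0..} z1'" "continuous_on {0..} z2" "continuous_on {0..} z2'"
    using z by (auto intro!: continuous_on_vector_derivative)
  show ?thesis
    unfolding profiles_def
  proof (intro conjI allI impI)
    show "continuous_on UNIV u" unfolding u_def
      by (intro glued_continuous continuous_intros cz) (simp add: z0)
    show "continuous_on UNIV v" unfolding v_def
      by (intro glued_continuous continuous_intros cz) (simp add: z0 algebra_simps s2)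
    show "continuous_on UNIV u1" unfolding u1_def
      by (rule glued_continuous[where b = "\<lambda>x. - Im (z2' x)"]) (auto intro!: continuous_intros cz simp: z0')
    show "continuous_on UNIV v1" unfolding v1_def
      by (rule glued_continuous[where b = "\<lambda>x. - ((sqrt 2 + 1) * Re (z2' x))"])
        (use z0'(2) in \<open>auto intro!: continuous_intros cz simp: algebra_simps\<close>)
    have "v 0 = v0" by (simp add: v_def z0 algebra_simps s2)
    thus "\<exists>x. u x \<noteq> 0 \<or> v x \<noteq> 0" using v0 by (intro exI[of _ 0]) simp
    have big: "\<bar>(sqrt 2 - 1) * r\<bar> \<le> (3 * C) * e" "\<bar>(sqrt 2 + 1) * r\<bar> \<le> (3 * C) * e" "\<bar>r\<bar> \<le> (3 * C) * e"
      if r: "\<bar>r\<bar> \<le> C * e" and e: "e \<ge> 0" for r e :: real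
    proof -
      have ce: "0 \<le> C * e" using C0 e by simp
      have "\<bar>sqrt 2 - 1\<bar> * \<bar>r\<bar> \<le> 3 * (C * e)" "\<bar>sqrt 2 + 1\<bar> * \<bar>r\<bar> \<le> 3 * (C * e)"
        using r sqrt2_bounds by (intro mult_mono; simp)+
      thus "\<bar>(sqrt 2 - 1) * r\<bar> \<le> (3 * C) * e" "\<bar>(sqrt 2 + 1) * r\<bar> \<le> (3 * C) * e" "\<bar>r\<bar> \<le> (3 * C) * e"
        using r ce by (simp_all add: abs_mult mult.assoc)
    qed
    have rb: "\<bar>Re (z1 x)\<bar> \<le> C * exp (-x/2)" "\<bar>Im (z1 x)\<bar> \<le> C * exp (-x/2)"
      "\<bar>Re (z2 x)\<bar> \<le> C * exp (-x/2)" "\<bar>Im (z2 x)\<bar> \<le> C * exp (-x/2)"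
      "\<bar>Re (z1' x)\<bar> \<le> C * exp (-x/2)" "\<bar>Im (z1' x)\<bar> \<le> C * exp (-x/2)"
      "\<bar>Re (z2' x)\<bar> \<le> C * exp (-x/2)" "\<bar>Im (z2' x)\<bar> \<le> C * exp (-x/2)" if "x \<ge> 0" for x
      using b[OF that] order_trans[OF abs_Re_le_cmod] order_trans[OF abs_Im_le_cmod] by blast+
    have "\<bar>u x\<bar> \<le> (3 * C) * exp (- (1/2) * \<bar>x\<bar>)" "\<bar>v x\<bar> \<le> (3 * C) * exp (- (1/2) * \<bar>x\<bar>)" for x
      unfolding u_def v_def by (intro glued_bound big rb; simp)+
    moreover have "\<bar>u1 x\<bar> \<le> (3 * C) * exp (- (1/2) * \<bar>x\<bar>)" for x
      unfolding u1_def
      by (rule glued_bound[where b = "\<lambda>x. - Im (z2' x)"]; (simp only: abs_minus_cancel)?; intro big rb; simp)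
    moreover have "\<bar>v1 x\<bar> \<le> (3 * C) * exp (- (1/2) * \<bar>x\<bar>)" for x
      unfolding v1_def
      by (rule glued_bound[where b = "\<lambda>x. - ((sqrt 2 + 1) * Re (z2' x))"]; (simp only: abs_minus_cancel)?; intro big rb; simp)
    ultimately show "\<exists>C \<eta>. \<eta> > 0 \<and> (\<forall>x. \<bar>u x\<bar> \<le> C * exp (- \<eta> * \<bar>x\<bar>) \<and> \<bar>v x\<bar> \<le> C * exp (- \<eta> * \<bar>x\<bar>) \<and>
        \<bar>u1 x\<bar> \<le> C * exp (- \<eta> * \<bar>x\<bar>) \<and> \<bar>v1 x\<bar> \<le> C * exp (- \<eta> * \<bar>x\<bar>))"
      by (intro exI[of _ "3 * C"] exI[of _ "1/2"]) auto
    fix x :: real assume x: "x \<noteq> 0"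
    have "(u has_real_derivative (if x \<ge> 0 then Re (z1' x) else - Im (z2' (- x)))) (at x)"
      unfolding u_def by (intro glued_derivative RI z x) auto
    thus "(u has_real_derivative u1 x) (at x)" by (simp add: u1_def)
    have "(v has_real_derivative (if x \<ge> 0 then (sqrt 2 - 1) * Im (z1' x) else - ((sqrt 2 + 1) * Re (z2' (- x))))) (at x)"
      unfolding v_def by (intro glued_derivative DERIV_cmult RI z x) auto
    thus "(v has_real_derivative v1 x) (at x)" by (simp add: v1_def)
    have V1': "x \<ge> 0 \<Longrightarrow> w x = V1 x + 1" and V2': "\<not> x \<ge> 0 \<Longrightarrow> w x = V2 (- x) - 1"
      using V(1)[of x] V(2)[of "-x"] x by auto
    have i2: "1 / sqrt 2 = sqrt 2 / 2" by (simp add: field_simps)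
    have "(u1 has_real_derivative (if x \<ge> 0 then Re (2 * \<i> * z1 x + \<mu> *\<^sub>R energy_shift (z1 x) + V1 x *\<^sub>R wall_shift (z1 x))
        else - (- Im (2 * \<i> * z2 (-x) + \<mu> *\<^sub>R energy_shift (z2 (-x)) - V2 (-x) *\<^sub>R wall_shift (z2 (-x)))))) (at x)"
      unfolding u1_def by (rule glued_derivative[where b = "\<lambda>x. - Im (z2' x)"]; intro DERIV_minus RI z x; simp)
    moreover have "(if x \<ge> 0 then Re (2 * \<i> * z1 x + \<mu> *\<^sub>R energy_shift (z1 x) + V1 x *\<^sub>R wall_shift (z1 x))
        else - (- Im (2 * \<i> * z2 (-x) + \<mu> *\<^sub>R energy_shift (z2 (-x)) - V2 (-x) *\<^sub>R wall_shift (z2 (-x)))))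
      = - (2 * sqrt 2) * (w x + (1 / sqrt 2 + \<mu>)) * v x"
      unfolding i2 by (cases "x \<ge> 0") (simp_all add: V1' V2' v_def energy_shift_def wall_shift_def algebra_simps s2)
    ultimately show "(u1 has_real_derivative - (2 * sqrt 2) * (w x + (1 / sqrt 2 + \<mu>)) * v x) (at x)" by simp
    have "(v1 has_real_derivative (if x \<ge> 0 then (sqrt 2 - 1) * Im (2 * \<i> * z1 x + \<mu> *\<^sub>R energy_shift (z1 x) + V1 x *\<^sub>R wall_shift (z1 x))
        else - (- ((sqrt 2 + 1) * Re (2 * \<i> * z2 (-x) + \<mu> *\<^sub>R energy_shift (z2 (-x)) - V2 (-x) *\<^sub>R wall_shift (z2 (-x))))))) (at x)"
      unfolding v1_def by (rule glued_derivative[where b = "\<lambda>x. - ((sqrt 2 + 1) * Re (z2' x))"]; intro DERIV_minus DERIV_cmult RI z x; simp)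
    moreover have "(if x \<ge> 0 then (sqrt 2 - 1) * Im (2 * \<i> * z1 x + \<mu> *\<^sub>R energy_shift (z1 x) + V1 x *\<^sub>R wall_shift (z1 x))
        else - (- ((sqrt 2 + 1) * Re (2 * \<i> * z2 (-x) + \<mu> *\<^sub>R energy_shift (z2 (-x)) - V2 (-x) *\<^sub>R wall_shift (z2 (-x))))))
      = 2 * sqrt 2 * (w x - (1 / sqrt 2 + \<mu>)) * u x"
      unfolding i2 by (cases "x \<ge> 0") (simp_all add: V1' V2' u_def energy_shift_def wall_shift_def algebra_simps s2)
    ultimately show "(v1 has_real_derivative 2 * sqrt 2 * (w x - (1 / sqrt 2 + \<mu>)) * u x) (at x)" by simp
  qed
qed

lemma bounded_of_limits:
  fixes w :: "real \<Rightarrow> real"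
  assumes c: "continuous_on UNIV w" and t: "(w \<longlongrightarrow> a) at_top" and bt: "(w \<longlongrightarrow> b) at_bot"
  obtains W where "\<And>x. \<bar>w x\<bar> \<le> W"
proof -
  have "eventually (\<lambda>x. dist (w x) a < 1) at_top" using t tendstoD zero_less_one by blast
  then obtain N1 where N1: "\<And>x. x \<ge> N1 \<Longrightarrow> dist (w x) a < 1" by (auto simp: eventually_at_top_linorder)
  have "eventually (\<lambda>x. dist (w x) b < 1) at_bot" using bt tendstoD zero_less_one by blast
  then obtain N2 where N2: "\<And>x. x \<le> N2 \<Longrightarrow> dist (w x) b < 1" by (auto simp: eventually_at_bot_linorder)
  have "compact (w ` {N2..N1})" by (intro compact_continuous_image continuous_on_subset[OF c]) auto
  then obtain B where B: "\<And>x. x \<in> {N2..N1} \<Longrightarrow> \<bar>w x\<bar> \<le> B"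
    using compact_imp_bounded bounded_iff by (metis imageI real_norm_def)
  show ?thesis
  proof (rule that[of "\<bar>a\<bar> + \<bar>b\<bar> + \<bar>B\<bar> + 1"])
    fix x show "\<bar>w x\<bar> \<le> \<bar>a\<bar> + \<bar>b\<bar> + \<bar>B\<bar> + 1"
      using N1[of x] N2[of x] B[of x] by (cases "x \<ge> N1"; cases "x \<le> N2") (auto simp: dist_real_def)
  qed
qed

lemma perturbed_profiles:
  assumes \<eta>: "\<eta> > 0" and c: "continuous_on UNIV w" and t: "(w \<longlongrightarrow> 1) at_top" and bt: "(w \<longlongrightarrow> -1) at_bot"
  obtains \<epsilon>0 where "\<epsilon>0 > 0"
    and "\<And>\<epsilon>. 0 < \<epsilon> \<Longrightarrow> \<epsilon> < \<epsilon>0 \<Longrightarrow> \<exists>\<rho> u v u1 v1. \<bar>\<rho> - 1 / sqrt 2\<bar> \<le> \<eta> \<and> profiles (2 * sqrt 2) (\<lambda>x. w (x / \<epsilon>)) \<rho> u v u1 v1"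
proof -
  obtain W where W: "\<And>x. \<bar>w x\<bar> \<le> W" using bounded_of_limits[OF c t bt] by blast
  have W0: "W \<ge> 0" using W[of 0] by linarith
  obtain d where d: "d > 0" and key: "\<And>V1 V2. small_potentials d V1 V2 \<Longrightarrow>
       \<exists>\<mu> z1 z1' z2 z2'. \<bar>\<mu>\<bar> \<le> \<eta> \<and> half_line_pair \<mu> V1 V2 z1 z1' z2 z2'"
    using half_line_solutions[OF \<eta>] by blast
  have "eventually (\<lambda>x. dist (w x) 1 < d/2) at_top" using tendstoD[OF t, of "d/2"] d by linarith
  then obtain N1 where N1: "\<And>x. x \<ge> N1 \<Longrightarrow> dist (w x) 1 < d/2" by (auto simp: eventually_at_top_linorder)
  have "eventually (\<lambda>x. dist (w x) (-1) < d/2) at_bot" using tendstoD[OF bt, of "d/2"] d by linarith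
  then obtain N2 where N2: "\<And>x. x \<le> N2 \<Longrightarrow> dist (w x) (-1) < d/2" by (auto simp: eventually_at_bot_linorder)
  define R where "R = \<bar>N1\<bar> + \<bar>N2\<bar>"
  have R0: "R \<ge> 0" by (simp add: R_def)
  define M where "M = W + 1"
  have M0: "M > 0" using W0 by (simp add: M_def)
  \<comment> \<open>\<open>R\<close> may be 0; the enlarged \<open>S\<close> can be divided
    by.\<close>
  define S where "S = R + 1"
  have S0: "S > 0" "R \<le> S" using R0 by (simp_all add: S_def)
  \<comment> \<open>Half of \<open>d\<close> is reserved for the tails, where the wall is within
    \<open>d / 2\<close> of its limits; a width below \<open>e0\<close> keeps the core contribution
    \<open>M * (R * \<epsilon>)\<close> within the other half.\<close>
  define e0 where "e0 = d / (2 * M * S)"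
  have e0: "e0 > 0" using d M0 S0 by (simp add: e0_def)
  show ?thesis
  proof (rule that[OF e0])
    fix \<epsilon> :: real assume \<epsilon>: "0 < \<epsilon>" "\<epsilon> < e0"
    define V1 where "V1 x = w (x / \<epsilon>) - 1" for x
    define V2 where "V2 x = w (- x / \<epsilon>) + 1" for x
    have cV: "continuous_on UNIV V1" "continuous_on UNIV V2"
      unfolding V1_def[abs_def] V2_def[abs_def]
      by (intro continuous_intros continuous_on_compose2[OF c]; use \<epsilon> in auto)+
    have BV: "\<bar>V1 t\<bar> \<le> M" "\<bar>V2 t\<bar> \<le> M" for t
      using W[of "t / \<epsilon>"] W[of "- t / \<epsilon>"] unfolding V1_def V2_def M_def by linarith+
    have V: "\<bar>V1 t\<bar> \<le> M * indicator {0..R * \<epsilon>} t + d / 2" "\<bar>V2 t\<bar> \<le> M * indicator {0..R * \<epsilon>} t + d / 2"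
      if t0: "t \<ge> 0" for t
    proof -
      have "\<bar>V1 t\<bar> \<le> M * indicator {0..R * \<epsilon>} t + d / 2 \<and> \<bar>V2 t\<bar> \<le> M * indicator {0..R * \<epsilon>} t + d / 2"
      proof (cases "t \<le> R * \<epsilon>")
        case True
        thus ?thesis using BV[of t] t0 d by (simp add: indicator_def)
      next
        case False
        hence "R < t / \<epsilon>" using \<epsilon> by (simp add: field_simps)
        hence "t / \<epsilon> \<ge> N1" "- t / \<epsilon> \<le> N2" unfolding R_def by (auto simp: abs_le_iff)
        from N1[OF this(1)] N2[OF this(2)] False show ?thesis
          by (simp add: V1_def V2_def dist_real_def indicator_def)
      qed
      thus "\<bar>V1 t\<bar> \<le> M * indicator {0..R * \<epsilon>} t + d / 2" "\<bar>V2 t\<bar> \<le> M * indicator {0..R * \<epsilon>} t + d / 2" by auto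
    qed
    have sm: "M * (R * \<epsilon>) + d / 2 \<le> d"
    proof -
      have "M * (R * \<epsilon>) \<le> M * (S * e0)"
        using M0 R0 S0 \<epsilon> by (intro mult_left_mono mult_mono) auto
      also have "\<dots> = d / 2" using M0 S0 by (simp add: e0_def field_simps)
      finally show ?thesis by simp
    qed
    have "small_potentials d V1 V2"
      unfolding small_potentials_def
    proof (intro conjI cV)
      show "\<exists>B. \<forall>t. \<bar>V1 t\<bar> \<le> B \<and> \<bar>V2 t\<bar> \<le> B" using BV by blast
      have "\<forall>t\<ge>0. \<bar>V1 t\<bar> \<le> M * indicator {0..R * \<epsilon>} t + d / 2 \<and> \<bar>V2 t\<bar> \<le> M * indicator {0..R * \<epsilon>} t + d / 2"
        using V by blast
      moreover have "R * \<epsilon> \<ge> 0" "M \<ge> 0" "d / 2 \<ge> 0" using R0 M0 \<epsilon> d by auto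
      ultimately show "\<exists>R\<ge>0. \<exists>M\<ge>0. \<exists>d'\<ge>0. M * R + d' \<le> d \<and>
        (\<forall>t\<ge>0. \<bar>V1 t\<bar> \<le> M * indicator {0..R} t + d' \<and> \<bar>V2 t\<bar> \<le> M * indicator {0..R} t + d')"
        using sm by blast
    qed
    from key[OF this] obtain \<mu> z1 z1' z2 z2' where \<mu>: "\<bar>\<mu>\<bar> \<le> \<eta>"
      and pair: "half_line_pair \<mu> V1 V2 z1 z1' z2 z2'" by blast
    have "profiles (2 * sqrt 2) (\<lambda>x. w (x / \<epsilon>)) (1 / sqrt 2 + \<mu>)
      (\<lambda>x. if x \<ge> 0 then Re (z1 x) else Im (z2 (- x)))
      (\<lambda>x. if x \<ge> 0 then (sqrt 2 - 1) * Im (z1 x) else (sqrt 2 + 1) * Re (z2 (- x)))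
      (\<lambda>x. if x \<ge> 0 then Re (z1' x) else - Im (z2' (- x)))
      (\<lambda>x. if x \<ge> 0 then (sqrt 2 - 1) * Im (z1' x) else - ((sqrt 2 + 1) * Re (z2' (- x))))"
      by (rule whole_line_profiles[OF pair]) (auto simp: V1_def V2_def)
    thus "\<exists>\<rho> u v u1 v1. \<bar>\<rho> - 1 / sqrt 2\<bar> \<le> \<eta> \<and> profiles (2 * sqrt 2) (\<lambda>x. w (x / \<epsilon>)) \<rho> u v u1 v1"
      using \<mu> by (intro exI conjI) (auto simp del: of_real_add)
  qed
qed

section \<open>From classical solutions to eigenpairs\<close>

lemma test_function_props:
  assumes "test_function \<phi>"
  obtains R where "R > 0" "continuous_on UNIV \<phi>" "continuous_on UNIV (deriv \<phi>)"
    "\<And>x. (\<phi> has_real_derivative deriv \<phi> x) (at x)"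
    "\<And>x. \<bar>x\<bar> \<ge> R \<Longrightarrow> \<phi> x = 0" "\<And>x. \<bar>x\<bar> \<ge> R \<Longrightarrow> deriv \<phi> x = 0"
proof -
  have s: "(deriv ^^ n) \<phi> differentiable_on UNIV" for n
    using assms by (simp add: test_function_def smooth_def)
  have d0: "\<phi> differentiable_on UNIV" using s[of 0] by simp
  have d1: "deriv \<phi> differentiable_on UNIV" using s[of 1] by simp
  have der: "(\<phi> has_real_derivative deriv \<phi> x) (at x)" for x
    using d0 by (simp add: differentiable_on_def DERIV_deriv_iff_real_differentiable)
  have "bounded (closure {x. \<phi> x \<noteq> 0})"
    using assms by (simp add: test_function_def compact_imp_bounded)
  then obtain B where B: "\<And>x. x \<in> closure {x. \<phi> x \<noteq> 0} \<Longrightarrow> \<bar>x\<bar> \<le> B"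
    unfolding bounded_iff by auto
  have z: "\<phi> x = 0" if "\<bar>x\<bar> > B" for x
    using B[of x] that closure_subset[of "{x. \<phi> x \<noteq> 0}"] by force
  have dz: "deriv \<phi> x = 0" if "\<bar>x\<bar> > B" for x
  proof -
    have op: "open {y::real. \<bar>y\<bar> > B}" by (intro open_Collect_less continuous_intros)
    have "((\<lambda>x. 0) has_real_derivative deriv \<phi> x) (at x)"
      by (rule has_field_derivative_transform_within_open[OF der[of x] op]) (use that z in auto)
    thus ?thesis using DERIV_unique DERIV_const by blast
  qed
  show ?thesis
  \<comment> \<open>Vanishing is known for \<open>\<bar>x\<bar> > B\<close>; the additional 1
    includes the endpoints and makes the radius positive.\<close>
  proof (rule that[of "\<bar>B\<bar> + 1"])
    show "continuous_on UNIV \<phi>" "continuous_on UNIV (deriv \<phi>)"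
      using d0 d1 differentiable_imp_continuous_on by auto
  qed (use der z dz in auto)
qed

text \<open>Integration by parts tolerates the missing derivative at 0: the product with the test
  function is continuous there, so the fundamental theorem holds with one exceptional point and
  produces no jump term. Hence \<open>g\<close> may jump, as second derivatives do at the sign
  wall.\<close>

lemma weak_derivativeI:
  fixes h g :: "real \<Rightarrow> complex^2"
  assumes c: "continuous_on UNIV h" and d: "\<And>x. x \<noteq> 0 \<Longrightarrow> (h has_vector_derivative g x) (at x)"
    and gm: "g \<in> borel_measurable borel" and gb: "\<And>x. norm (g x) \<le> C"
  shows "weak_derivative h g"
  unfolding weak_derivative_def
proof (intro allI impI)
  fix \<phi> assume "test_function \<phi>"
  then obtain R where R: "R > 0" and cp: "continuous_on UNIV \<phi>" "continuous_on UNIV (deriv \<phi>)"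
    and der: "\<And>x. (\<phi> has_real_derivative deriv \<phi> x) (at x)"
    and z: "\<And>x. \<bar>x\<bar> \<ge> R \<Longrightarrow> \<phi> x = 0" "\<And>x. \<bar>x\<bar> \<ge> R \<Longrightarrow> deriv \<phi> x = 0"
    using test_function_props by blast
  have supp: "integrable lborel f" if "continuous_on UNIV f" "\<And>x. \<bar>x\<bar> \<ge> R \<Longrightarrow> f x = 0"
    for f :: "real \<Rightarrow> 'b :: {banach, second_countable_topology}"
  proof -
    have "set_integrable lborel {-R..R} f"
      by (rule borel_integrable_atLeastAtMost') (rule continuous_on_subset[OF that(1)], simp)
    moreover have "(\<lambda>x. indicator {-R..R} x *\<^sub>R f x) = f"
      using that(2) by (auto simp: fun_eq_iff indicator_def abs_if)
    ultimately show ?thesis by (simp add: set_integrable_def)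
  qed
  have i1: "integrable lborel (\<lambda>x. deriv \<phi> x *\<^sub>R h x)"
    by (rule supp) (use z in \<open>auto intro!: continuous_intros cp c\<close>)
  have i2: "integrable lborel (\<lambda>x. \<phi> x *\<^sub>R g x)"
  proof (rule Bochner_Integration.integrable_bound)
    show "integrable lborel (\<lambda>x. C * \<bar>\<phi> x\<bar>)"
      by (rule supp) (use z in \<open>auto intro!: continuous_intros cp\<close>)
    have [measurable]: "\<phi> \<in> borel_measurable borel" using cp(1) by (rule borel_measurable_continuous_onI)
    note gm[measurable]
    show "(\<lambda>x. \<phi> x *\<^sub>R g x) \<in> borel_measurable lborel" by measurable
    show "AE x in lborel. norm (\<phi> x *\<^sub>R g x) \<le> norm (C * \<bar>\<phi> x\<bar>)"
    proof (rule AE_I2)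
      fix x
      have "norm (g x) \<le> \<bar>C\<bar>" using gb[of x] by linarith
      thus "norm (\<phi> x *\<^sub>R g x) \<le> norm (C * \<bar>\<phi> x\<bar>)" by (simp add: abs_mult mult.commute[of "\<bar>C\<bar>"] mult_left_mono)
    qed
  qed
  have "((\<lambda>x. deriv \<phi> x *\<^sub>R h x + \<phi> x *\<^sub>R g x) has_integral (\<phi> R *\<^sub>R h R - \<phi> (-R) *\<^sub>R h (-R))) {-R..R}"
  proof (rule fundamental_theorem_of_calculus_interior_strong[where S = "{0}"])
    show "continuous_on {-R..R} (\<lambda>x. \<phi> x *\<^sub>R h x)"
      by (intro continuous_intros continuous_on_subset[OF cp(1)] continuous_on_subset[OF c]) auto
    fix x assume "x \<in> {- R<..<R} - {0}"
    hence "x \<noteq> 0" by simp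
    from has_vector_derivative_scaleR[OF der[of x] d[OF this]]
    show "((\<lambda>x. \<phi> x *\<^sub>R h x) has_vector_derivative deriv \<phi> x *\<^sub>R h x + \<phi> x *\<^sub>R g x) (at x)"
      by (simp add: add.commute)
  qed (use R in auto)
  hence "((\<lambda>x. deriv \<phi> x *\<^sub>R h x + \<phi> x *\<^sub>R g x) has_integral 0) {-R..R}"
    using z R by simp
  hence "((\<lambda>x. deriv \<phi> x *\<^sub>R h x + \<phi> x *\<^sub>R g x) has_integral 0) UNIV"
    by (rule has_integral_on_superset) (use z in \<open>auto simp: abs_if\<close>)
  moreover have "((\<lambda>x. deriv \<phi> x *\<^sub>R h x + \<phi> x *\<^sub>R g x) has_integral
      (LINT x|lborel. deriv \<phi> x *\<^sub>R h x + \<phi> x *\<^sub>R g x)) UNIV"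
    by (intro has_integral_integral_lborel Bochner_Integration.integrable_add i1 i2)
  ultimately have "(LINT x|lborel. deriv \<phi> x *\<^sub>R h x + \<phi> x *\<^sub>R g x) = 0"
    using has_integral_unique by blast
  thus "(LINT x|lborel. deriv \<phi> x *\<^sub>R h x) = - (LINT x|lborel. \<phi> x *\<^sub>R g x)"
    using i1 i2 by (simp add: eq_neg_iff_add_eq_0)
qed

lemma integrable_exp_abs:
  assumes a: "a > 0"
  shows "integrable lborel (\<lambda>x::real. exp (- a * \<bar>x\<bar>))"
proof -
  have "(\<lambda>x::real. exp (- a * \<bar>x\<bar>)) integrable_on {0..}"
    by (rule integrable_eq[OF integrable_on_exp_minus_to_infinity[OF a]]) auto
  hence 1: "(\<lambda>x::real. exp (- a * \<bar>x\<bar>)) absolutely_integrable_on {0..}"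
    by (intro nonnegative_absolutely_integrable_1) auto
  define f where "f x = indicator {0..} x *\<^sub>R exp (- a * \<bar>x\<bar>)" for x :: real
  have [measurable]: "f \<in> borel_measurable borel" unfolding f_def by measurable
  have "integrable lebesgue f"
    using 1 by (simp add: set_integrable_def f_def[abs_def])
  hence f: "integrable lborel f"
    by (subst (asm) integrable_completion) auto
  have f': "integrable lborel (\<lambda>x. f (- x))"
    using lborel_integrable_real_affine[OF f, of "-1" 0] by simp
  show ?thesis
  proof (rule Bochner_Integration.integrable_bound[OF Bochner_Integration.integrable_add[OF f f']])
    \<comment> \<open>Domination rather than equality, because both halves count at 0.\<close>
    show "AE x in lborel. norm (exp (- a * \<bar>x\<bar>)) \<le> norm (f x + f (- x))"
      by (rule AE_I2) (auto simp: f_def indicator_def)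
  qed measurable
qed

lemma L2I_exponential:
  fixes f :: "real \<Rightarrow> complex^2"
  assumes m: "f \<in> borel_measurable borel" and a: "a > 0" and b: "\<And>x. norm (f x) \<le> C * exp (- a * \<bar>x\<bar>)"
  shows "f \<in> L2"
proof -
  note m[measurable]
  have "integrable lborel (\<lambda>x. (norm (f x))\<^sup>2)"
  proof (rule Bochner_Integration.integrable_bound)
    show "integrable lborel (\<lambda>x. C\<^sup>2 * exp (- (2 * a) * \<bar>x\<bar>))"
      using integrable_exp_abs[of "2 * a"] a by simp
    show "AE x in lborel. norm ((norm (f x))\<^sup>2) \<le> norm (C\<^sup>2 * exp (- (2 * a) * \<bar>x\<bar>))"
    proof (rule AE_I2)
      fix x
      have "(norm (f x))\<^sup>2 \<le> (C * exp (- a * \<bar>x\<bar>))\<^sup>2" by (rule power_mono[OF b]) simp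
      also have "\<dots> = C\<^sup>2 * exp (- (2 * a) * \<bar>x\<bar>)"
        by (simp add: power_mult_distrib power2_eq_square flip: exp_add)
      finally show "norm ((norm (f x))\<^sup>2) \<le> norm (C\<^sup>2 * exp (- (2 * a) * \<bar>x\<bar>))" by simp
    qed
  qed measurable
  thus ?thesis by (simp add: L2_def)
qed

section \<open>The matrices and the passage to complex vectors\<close>

lemma sigma2_mult: "sigma2 *v x = vector [- \<i> * x $ 2, \<i> * x $ 1]"
  and sigma3_mult: "sigma3 *v x = vector [x $ 1, - x $ 2]"
  by (simp_all add: vec_eq_iff forall_2 matrix_vector_mult_def sum_2 sigma2_def sigma3_def vector_2)

lemma linear_sigma2: "linear ((*v) sigma2)" and linear_sigma3: "linear ((*v) sigma3)"
  by (auto intro!: linearI simp: sigma2_mult sigma3_mult vec_eq_iff forall_2 vector_2 algebra_simps)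

lemma bounded_linear_vector_smult: "bounded_linear (\<lambda>x :: complex^2. c *s x)"
  unfolding linear_conv_bounded_linear[symmetric]
  by (auto intro!: linearI simp: vec_eq_iff algebra_simps)

lemma has_vector_derivative_smult:
  assumes "(f has_vector_derivative f') F"
  shows "((\<lambda>x. c *s f x :: complex^2) has_vector_derivative c *s f') F"
  by (rule bounded_linear.has_vector_derivative[OF bounded_linear_vector_smult assms])

lemma norm_vector_smult: "norm (c *s x :: complex^2) = norm c * norm x"
  by (simp add: norm_vec_def norm_mult L2_set_right_distrib)

lemma not_AE_zero:
  fixes f :: "real \<Rightarrow> complex^2"
  assumes c: "continuous_on UNIV f" and x: "f x \<noteq> 0"
  shows "\<not> (AE x in lborel. f x = 0)"
proof
  assume "AE x in lborel. f x = 0"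
  have op: "open {x. f x \<noteq> 0}"
    using open_Collect_neq[OF c continuous_on_const[of UNIV 0]] by simp
  hence "{x. f x \<noteq> 0} \<in> null_sets lborel"
    using \<open>AE x in lborel. f x = 0\<close> by (subst AE_iff_null_sets) auto
  hence "negligible {x. f x \<noteq> 0}"
    by (simp add: negligible_iff_null_sets null_sets_completionI)
  thus False using open_not_negligible[OF op] x by blast
qed

text \<open>A basis of eigenvectors of \<open>sigma3\<close> that \<open>sigma2\<close> swaps up to
  one common real factor, which is what makes the system for \<open>u\<close> and \<open>v\<close>
  real. The order of the eigenvectors is recorded by \<open>\<tau> = 1\<close> or
  \<open>\<tau> = - 1\<close>; reversing it reverses the eigenvalue.\<close>

definition sigma_frame :: "real \<Rightarrow> real \<Rightarrow> real \<Rightarrow> real \<Rightarrow> complex^2 \<Rightarrow> complex^2 \<Rightarrow> bool" where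
  "sigma_frame \<alpha>2 \<theta> l \<tau> e1 e2 \<longleftrightarrow>
     \<alpha>2 *\<^sub>R (sigma2 *v e1) = - (\<tau> * \<theta> / l) *\<^sub>R e2 \<and> \<alpha>2 *\<^sub>R (sigma2 *v e2) = - (\<tau> * \<theta> / l) *\<^sub>R e1 \<and>
     sigma3 *v e1 = \<tau> *\<^sub>R e1 \<and> sigma3 *v e2 = - \<tau> *\<^sub>R e2 \<and>
     (\<forall>a b. a *\<^sub>R e1 + b *\<^sub>R e2 = 0 \<longrightarrow> a = 0 \<and> b = 0)"

text \<open>Pointwise algebra in the wall value \<open>y\<close> and the profile values
  \<open>a\<close>, \<open>b\<close>, kept apart from analysis because both the weak and the
  classical formulation use it.\<close>

lemma profile_equation:
  fixes e1 e2 :: "complex^2"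
  assumes l: "l > 0"
    and frame: "sigma_frame \<alpha>2 \<theta> l \<tau> e1 e2"
  shows "(- \<alpha>2) *\<^sub>R (sigma2 *v (- ((- l * (y + \<rho>) * b) *\<^sub>R e1 + (l * (y - \<rho>) * a) *\<^sub>R e2)))
      + (\<theta> * y) *\<^sub>R (sigma3 *v (a *\<^sub>R e1 + b *\<^sub>R e2)) = (\<tau> * \<theta> * \<rho>) *\<^sub>R (a *\<^sub>R e1 + b *\<^sub>R e2)"
proof -
  note e = frame[unfolded sigma_frame_def]
  let ?d = "(- l * (y + \<rho>) * b) *\<^sub>R e1 + (l * (y - \<rho>) * a) *\<^sub>R e2"
  have "(- \<alpha>2) *\<^sub>R (sigma2 *v (- ?d)) = \<alpha>2 *\<^sub>R (sigma2 *v ?d)"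
    by (simp only: linear_neg[OF linear_sigma2] scaleR_minus_left scaleR_minus_right minus_minus)
  also have "\<dots> = (- l * (y + \<rho>) * b) *\<^sub>R (\<alpha>2 *\<^sub>R (sigma2 *v e1)) + (l * (y - \<rho>) * a) *\<^sub>R (\<alpha>2 *\<^sub>R (sigma2 *v e2))"
    unfolding linear_add[OF linear_sigma2] linear_scale[OF linear_sigma2] by (simp add: algebra_simps)
  also have "\<dots> = ((y + \<rho>) * b * \<tau> * \<theta>) *\<^sub>R e2 - ((y - \<rho>) * a * \<tau> * \<theta>) *\<^sub>R e1"
  proof -
    have "(- l * (y + \<rho>) * b) * (- (\<tau> * \<theta> / l)) = (y + \<rho>) * b * \<tau> * \<theta>"
      "(l * (y - \<rho>) * a) * (- (\<tau> * \<theta> / l)) = - ((y - \<rho>) * a * \<tau> * \<theta>)"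
      using l by (simp_all add: field_simps)
    thus ?thesis using e by simp
  qed
  finally have 1: "(- \<alpha>2) *\<^sub>R (sigma2 *v (- ?d)) = \<dots>" .
  have "sigma3 *v (a *\<^sub>R e1 + b *\<^sub>R e2) = a *\<^sub>R (sigma3 *v e1) + b *\<^sub>R (sigma3 *v e2)"
    unfolding linear_add[OF linear_sigma3] by (simp only: linear_scale[OF linear_sigma3])
  also have "\<dots> = (a * \<tau>) *\<^sub>R e1 - (b * \<tau>) *\<^sub>R e2" using e by simp
  finally have 2: "sigma3 *v (a *\<^sub>R e1 + b *\<^sub>R e2) = \<dots>" .
  show ?thesis unfolding 1 2 by (simp add: algebra_simps)
qed

text \<open>Exponential decay puts the function and its two derivatives into \<open>L2\<close>, and
  continuity of the function and of its first derivative makes the derivatives weak ones, so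
  \<open>P\<close> can be applied twice.\<close>

lemma eigenpair_of_profiles:
  fixes e1 e2 :: "complex^2"
  assumes p: "profiles l w \<rho> u v u1 v1" and l: "l > 0"
    and w: "w \<in> borel_measurable borel" and W: "\<And>x. \<bar>w x\<bar> \<le> W"
    and frame: "sigma_frame \<alpha>2 \<theta> l \<tau> e1 e2"
  shows "eigenpair (S_op \<alpha>2 \<theta> w) (\<tau> * \<theta> * \<rho>) (\<lambda>X. u X *\<^sub>R e1 + v X *\<^sub>R e2)"
proof -
  define f where "f X = u X *\<^sub>R e1 + v X *\<^sub>R e2" for X
  define f1 where "f1 X = u1 X *\<^sub>R e1 + v1 X *\<^sub>R e2" for X
  define f2 where "f2 X = (- l * (w X + \<rho>) * v X) *\<^sub>R e1 + (l * (w X - \<rho>) * u X) *\<^sub>R e2" for X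
  note cont = profilesD(1-4)[OF p] and der = profilesD(5-8)[OF p]
  from p obtain C \<eta> where \<eta>: "\<eta> > 0" and b: "\<And>x. \<bar>u x\<bar> \<le> C * exp (- \<eta> * \<bar>x\<bar>)" "\<And>x. \<bar>v x\<bar> \<le> C * exp (- \<eta> * \<bar>x\<bar>)"
        "\<And>x. \<bar>u1 x\<bar> \<le> C * exp (- \<eta> * \<bar>x\<bar>)" "\<And>x. \<bar>v1 x\<bar> \<le> C * exp (- \<eta> * \<bar>x\<bar>)"
    unfolding profiles_def by blast
  from p obtain x0 where x0: "u x0 \<noteq> 0 \<or> v x0 \<noteq> 0" unfolding profiles_def by blast
  have C: "C \<ge> 0" using b(1)[of 0] by simp
  have comb: "norm (r *\<^sub>R e1 + q *\<^sub>R e2) \<le> (K * (norm e1 + norm e2)) * exp (- \<eta> * \<bar>x\<bar>)"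
    if "\<bar>r\<bar> \<le> K * exp (- \<eta> * \<bar>x\<bar>)" "\<bar>q\<bar> \<le> K * exp (- \<eta> * \<bar>x\<bar>)" for r q x K
  proof -
    have "norm (r *\<^sub>R e1 + q *\<^sub>R e2) \<le> \<bar>r\<bar> * norm e1 + \<bar>q\<bar> * norm e2"
      by (metis norm_scaleR norm_triangle_ineq)
    also have "\<dots> \<le> (K * exp (- \<eta> * \<bar>x\<bar>)) * norm e1 + (K * exp (- \<eta> * \<bar>x\<bar>)) * norm e2"
      using that by (intro add_mono mult_right_mono) auto
    finally show ?thesis by (simp add: algebra_simps)
  qed
  define K where "K = C * (norm e1 + norm e2)"
  define K' where "K' = (l * (W + \<bar>\<rho>\<bar>) * C) * (norm e1 + norm e2)"
  have bf: "norm (f x) \<le> K * exp (- \<eta> * \<bar>x\<bar>)" and bd: "norm (f1 x) \<le> K * exp (- \<eta> * \<bar>x\<bar>)" for x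
    unfolding f_def f1_def K_def by (intro comb b)+
  have bdd: "norm (f2 x) \<le> K' * exp (- \<eta> * \<bar>x\<bar>)" for x
  proof -
    have wb: "\<bar>w x + \<rho>\<bar> \<le> W + \<bar>\<rho>\<bar>" "\<bar>w x - \<rho>\<bar> \<le> W + \<bar>\<rho>\<bar>" using W[of x] by linarith+
    have "\<bar>w x + \<rho>\<bar> * \<bar>v x\<bar> \<le> (W + \<bar>\<rho>\<bar>) * (C * exp (- \<eta> * \<bar>x\<bar>))"
      "\<bar>w x - \<rho>\<bar> * \<bar>u x\<bar> \<le> (W + \<bar>\<rho>\<bar>) * (C * exp (- \<eta> * \<bar>x\<bar>))"
      using wb b C by (intro mult_mono; simp; linarith)+
    from this[THEN mult_left_mono, of l]
    have "\<bar>- l * (w x + \<rho>) * v x\<bar> \<le> (l * (W + \<bar>\<rho>\<bar>) * C) * exp (- \<eta> * \<bar>x\<bar>)"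
      "\<bar>l * (w x - \<rho>) * u x\<bar> \<le> (l * (W + \<bar>\<rho>\<bar>) * C) * exp (- \<eta> * \<bar>x\<bar>)"
      using l by (simp_all add: abs_mult mult.assoc)
    thus ?thesis unfolding f2_def K'_def by (rule comb)
  qed
  have [measurable]: "u \<in> borel_measurable borel" "v \<in> borel_measurable borel" "u1 \<in> borel_measurable borel" "v1 \<in> borel_measurable borel"
    using cont by (auto intro: borel_measurable_continuous_onI)
  note w[measurable]
  have m: "f \<in> borel_measurable borel" "f1 \<in> borel_measurable borel" "f2 \<in> borel_measurable borel"
    unfolding f_def f1_def f2_def by measurable
  have sm: "(\<lambda>x. c *s g x) \<in> borel_measurable borel" if "g \<in> borel_measurable borel" for c and g :: "real \<Rightarrow> complex^2"
    using borel_measurable_continuous_onI[OF linear_continuous_on[OF bounded_linear_vector_smult]] that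
    by (rule measurable_compose[rotated])
  have d1: "(f has_vector_derivative f1 x) (at x)" "(f1 has_vector_derivative f2 x) (at x)" if "x \<noteq> 0" for x
  proof -
    have "((\<lambda>X. u X *\<^sub>R e1) has_vector_derivative u1 x *\<^sub>R e1) (at x)" "((\<lambda>X. v X *\<^sub>R e2) has_vector_derivative v1 x *\<^sub>R e2) (at x)"
      "((\<lambda>X. u1 X *\<^sub>R e1) has_vector_derivative (- l * (w x + \<rho>) * v x) *\<^sub>R e1) (at x)"
      "((\<lambda>X. v1 X *\<^sub>R e2) has_vector_derivative (l * (w x - \<rho>) * u x) *\<^sub>R e2) (at x)"
      using der[OF that, THEN has_vector_derivative_scaleR, OF has_vector_derivative_const] by simp_all
    thus "(f has_vector_derivative f1 x) (at x)" "(f1 has_vector_derivative f2 x) (at x)"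
      unfolding f_def[abs_def] f1_def[abs_def] f2_def by - (rule has_vector_derivative_add; assumption)+
  qed
  have c: "continuous_on UNIV f" "continuous_on UNIV f1"
    unfolding f_def[abs_def] f1_def[abs_def] by (intro continuous_intros cont)+
  have le: "B * exp (- \<eta> * \<bar>x\<bar>) \<le> B" if "B \<ge> 0" for B x
    using that \<eta> by (intro mult_left_le) auto
  have KK: "K \<ge> 0" "K' \<ge> 0"
    using order_trans[OF norm_ge_zero bf[of 0]] order_trans[OF norm_ge_zero bdd[of 0]] by simp_all
  have L: "f \<in> L2" "(\<lambda>x. (- \<i>) *s f1 x) \<in> L2" "(\<lambda>x. (- \<i>) *s ((- \<i>) *s f2 x)) \<in> L2" "(\<lambda>x. r *\<^sub>R f x) \<in> L2" for r
  proof -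
    show "f \<in> L2" by (rule L2I_exponential[OF m(1) \<eta> bf])
    show "(\<lambda>x. (- \<i>) *s f1 x) \<in> L2" by (rule L2I_exponential[OF sm[OF m(2)] \<eta>]) (use bd in \<open>simp add: norm_vector_smult\<close>)
    show "(\<lambda>x. (- \<i>) *s ((- \<i>) *s f2 x)) \<in> L2"
      by (rule L2I_exponential[OF sm[OF sm[OF m(3)]] \<eta>]) (use bdd in \<open>simp add: norm_vector_smult\<close>)
    show "(\<lambda>x. r *\<^sub>R f x) \<in> L2"
    proof (rule L2I_exponential[OF _ \<eta>])
      show "(\<lambda>x. r *\<^sub>R f x) \<in> borel_measurable borel" using m(1) by measurable
      show "norm (r *\<^sub>R f x) \<le> (\<bar>r\<bar> * K) * exp (- \<eta> * \<bar>x\<bar>)" for x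
        using mult_left_mono[OF bf[of x], of "\<bar>r\<bar>"] by (simp add: mult.assoc)
    qed
  qed
  have wd1: "weak_derivative f f1"
    by (rule weak_derivativeI[OF c(1) d1(1) m(2), of K]) (use bd le[OF KK(1)] order_trans in blast)+
  have wd2: "weak_derivative (\<lambda>x. (- \<i>) *s f1 x) (\<lambda>x. (- \<i>) *s f2 x)"
  proof (rule weak_derivativeI[of _ _ K'])
    show "continuous_on UNIV (\<lambda>x. (- \<i>) *s f1 x)"
      by (rule bounded_linear.continuous_on[OF bounded_linear_vector_smult c(2)])
    show "norm ((- \<i>) *s f2 x) \<le> K'" for x
      using order_trans[OF bdd le[OF KK(2)]] by (simp add: norm_vector_smult)
    show "((\<lambda>x. (- \<i>) *s f1 x) has_vector_derivative (- \<i>) *s f2 x) (at x)" if "x \<noteq> 0" for x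
      by (rule has_vector_derivative_smult[OF d1(2)[OF that]])
    show "(\<lambda>x. (- \<i>) *s f2 x) \<in> borel_measurable borel" by (rule sm[OF m(3)])
  qed
  have "momentum f (\<lambda>x. (- \<i>) *s f1 x)"
    unfolding momentum_def using L wd1 by auto
  moreover have "momentum (\<lambda>x. (- \<i>) *s f1 x) (\<lambda>x. (- \<i>) *s ((- \<i>) *s f2 x))"
    unfolding momentum_def using L wd2 by auto
  moreover have "(\<tau> * \<theta> * \<rho>) *\<^sub>R f X = (- \<alpha>2) *\<^sub>R (sigma2 *v ((- \<i>) *s ((- \<i>) *s f2 X))) + (\<theta> * w X) *\<^sub>R (sigma3 *v f X)" for X
  proof -
    have "(- \<i>) *s ((- \<i>) *s f2 X) = - f2 X" by (simp add: vec_eq_iff)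
    thus ?thesis unfolding f_def f2_def by (simp only: profile_equation[OF l frame])
  qed
  ultimately have "S_op \<alpha>2 \<theta> w f (\<lambda>X. (\<tau> * \<theta> * \<rho>) *\<^sub>R f X)"
    unfolding S_op_def using L(4) by blast
  moreover have "f x0 \<noteq> 0" unfolding f_def using frame x0 unfolding sigma_frame_def by blast
  ultimately show ?thesis
    unfolding eigenpair_def f_def[symmetric] using not_AE_zero[OF c(1)] by auto
qed

lemma matched_solution_of_profiles:
  fixes e1 e2 :: "complex^2"
  assumes p: "profiles l sgn \<rho> u v u1 v1" and l: "l > 0"
    and frame: "sigma_frame \<alpha>2 \<theta> l \<tau> e1 e2"
  shows "matched_solution \<alpha>2 \<theta> (\<tau> * \<theta> * \<rho>) (\<lambda>X. u X *\<^sub>R e1 + v X *\<^sub>R e2)"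
proof -
  let ?d = "\<lambda>X. u1 X *\<^sub>R e1 + v1 X *\<^sub>R e2"
  let ?dd = "\<lambda>X. (- l * (sgn X + \<rho>) * v X) *\<^sub>R e1 + (l * (sgn X - \<rho>) * u X) *\<^sub>R e2"
  note cont = profilesD(1-4)[OF p] and der = profilesD(5-8)[OF p]
  note eq = profile_equation[OF l frame]
  have sc: "((\<lambda>X. f X *\<^sub>R c) has_vector_derivative f' *\<^sub>R c) (at x)" if "(f has_real_derivative f') (at x)"
    for f f' x and c :: "complex^2"
    using has_vector_derivative_scaleR[OF that has_vector_derivative_const[of c]] by simp
  show ?thesis
    unfolding matched_solution_def
  proof (rule exI[of _ ?d], rule exI[of _ ?dd], intro conjI allI impI)
    fix X :: real assume X: "X \<noteq> 0"
    show "((\<lambda>X. u X *\<^sub>R e1 + v X *\<^sub>R e2) has_vector_derivative ?d X) (at X)"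
      by (intro has_vector_derivative_add sc der X)
    show "(?d has_vector_derivative ?dd X) (at X)"
      by (intro has_vector_derivative_add sc der X)
  next
    fix X :: real assume "X > 0"
    thus "(- \<alpha>2) *\<^sub>R (sigma2 *v (- ?dd X)) + \<theta> *\<^sub>R (sigma3 *v (u X *\<^sub>R e1 + v X *\<^sub>R e2)) =
      (\<tau> * \<theta> * \<rho>) *\<^sub>R (u X *\<^sub>R e1 + v X *\<^sub>R e2)"
      using eq[of 1 \<rho> "v X" "u X"] by (simp only: sgn_pos mult_1_right)
  next
    fix X :: real assume "X < 0"
    thus "(- \<alpha>2) *\<^sub>R (sigma2 *v (- ?dd X)) - \<theta> *\<^sub>R (sigma3 *v (u X *\<^sub>R e1 + v X *\<^sub>R e2)) =
      (\<tau> * \<theta> * \<rho>) *\<^sub>R (u X *\<^sub>R e1 + v X *\<^sub>R e2)"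
      using eq[of "-1" \<rho> "v X" "u X"]
      by (simp only: sgn_neg mult_minus_right mult_1_right scaleR_minus_left diff_conv_add_uminus)
  next
    have "continuous_on UNIV (\<lambda>X. u X *\<^sub>R e1 + v X *\<^sub>R e2)" by (intro continuous_intros cont)
    thus "isCont (\<lambda>X. u X *\<^sub>R e1 + v X *\<^sub>R e2) 0" by (simp add: continuous_on_eq_continuous_at)
    have "continuous_on UNIV ?d" by (intro continuous_intros cont)
    thus "isCont ?d 0" by (simp add: continuous_on_eq_continuous_at)
  qed
qed

section \<open>Decaying solutions with constant coefficients\<close>

text \<open>The equation \<open>f'' = z\<^sup>2 f\<close> factors:
  \<open>exp (- z x) (f' + z f)\<close> is constant, and a second integration yields a combination
  of both exponentials. Square integrability, expressed by a dominating \<open>F\<close> on the line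
  that different components can share, excludes the growing one.\<close>

lemma decaying_solution:
  fixes f f1 :: "real \<Rightarrow> complex" and z :: complex
  assumes z: "Re z > 0"
    and d: "\<And>x. x > 0 \<Longrightarrow> (f has_vector_derivative f1 x) (at x)"
      "\<And>x. x > 0 \<Longrightarrow> (f1 has_vector_derivative z\<^sup>2 * f x) (at x)"
    and F: "integrable lborel F" and bd: "\<And>x. x > 0 \<Longrightarrow> (norm (f x))\<^sup>2 \<le> F x"
  obtains A where "\<And>x. x > 0 \<Longrightarrow> f x = A * exp (- (z * of_real x))"
    and "\<And>x. x > 0 \<Longrightarrow> f1 x = - z * A * exp (- (z * of_real x))"
proof -
  have z0: "z \<noteq> 0" using z by auto
  note E = has_vector_derivative_exp_mult
  have const: "\<exists>k. \<forall>x>0. g x = k" if "\<And>x. x > 0 \<Longrightarrow> (g has_vector_derivative 0) (at x)" for g :: "real \<Rightarrow> complex"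
  proof -
    have "(g has_vector_derivative 0) (at x within {0<..})" if "x \<in> {0<..}" for x
      using \<open>\<And>x. x > 0 \<Longrightarrow> (g has_vector_derivative 0) (at x)\<close> that
      by (auto intro: has_vector_derivative_at_within)
    then obtain k where "\<And>x. x \<in> {0<..} \<Longrightarrow> g x = k"
      using has_vector_derivative_zero_constant[of "{0<..}" g] by auto
    thus ?thesis by auto
  qed
  have "\<exists>k. \<forall>x>0. exp (- z * of_real x) * (f1 x + z * f x) = k"
  proof (rule const)
    fix x :: real assume x: "x > 0"
    have "((\<lambda>x. f1 x + z * f x) has_vector_derivative z\<^sup>2 * f x + z * f1 x) (at x)"
      by (intro has_vector_derivative_add has_vector_derivative_mult_right d x)
    from has_vector_derivative_mult[OF E[of "- z"] this]
    show "((\<lambda>x. exp (- z * of_real x) * (f1 x + z * f x)) has_vector_derivative 0) (at x)"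
      by (simp add: algebra_simps power2_eq_square)
  qed
  then obtain k where k: "\<And>x. x > 0 \<Longrightarrow> exp (- z * of_real x) * (f1 x + z * f x) = k" by blast
  define B where "B = k / (2 * z)"
  have g: "f1 x + z * f x = 2 * z * B * exp (z * of_real x)" if "x > 0" for x
  proof -
    have "exp (z * of_real x) * (exp (- z * of_real x) * (f1 x + z * f x)) = exp (z * of_real x) * k"
      by (simp only: k[OF that])
    thus ?thesis using z0 by (simp add: B_def exp_minus mult.commute flip: mult.assoc)
  qed
  have "\<exists>A. \<forall>x>0. exp (z * of_real x) * f x - B * exp (2 * z * of_real x) = A"
  proof (rule const)
    fix x :: real assume x: "x > 0"
    have "((\<lambda>x. exp (z * of_real x) * f x - B * exp (2 * z * of_real x)) has_vector_derivative
      (exp (z * of_real x) * f1 x + z * exp (z * of_real x) * f x) - B * (2 * z * exp (2 * z * of_real x))) (at x)"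
      by (intro has_vector_derivative_diff has_vector_derivative_mult_right has_vector_derivative_mult E d x)
    moreover have "(exp (z * of_real x) * f1 x + z * exp (z * of_real x) * f x) = exp (z * of_real x) * (f1 x + z * f x)"
      by (simp add: algebra_simps)
    moreover have "exp (2 * z * of_real x) = exp (z * of_real x) * exp (z * of_real x)"
      by (simp add: mult.assoc flip: exp_add)
    ultimately show "((\<lambda>x. exp (z * of_real x) * f x - B * exp (2 * z * of_real x)) has_vector_derivative 0) (at x)"
      using g[OF x] by (simp add: algebra_simps)
  qed
  then obtain A where A: "\<And>x. x > 0 \<Longrightarrow> exp (z * of_real x) * f x - B * exp (2 * z * of_real x) = A" by blast
  have f: "f x = A * exp (- (z * of_real x)) + B * exp (z * of_real x)" if "x > 0" for x
  proof -
    have "exp (- (z * of_real x)) * (exp (z * of_real x) * f x) = exp (- (z * of_real x)) * (A + B * exp (2 * z * of_real x))"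
      using A[OF that] by (simp add: algebra_simps)
    moreover have "exp (2 * z * of_real x) = exp (z * of_real x) * exp (z * of_real x)"
      by (simp add: mult.assoc flip: exp_add)
    ultimately show ?thesis by (simp add: exp_minus field_simps)
  qed
  have B0: "B = 0"
  proof (rule ccontr)
    assume "B \<noteq> 0"
    define r where "r = Re z"
    \<comment> \<open>Beyond \<open>x1\<close> the growing term exceeds \<open>norm A + 1\<close>,
      by \<open>r * x \<le> exp (r * x)\<close>, and hence
      \<open>norm (f x) \<ge> 1\<close>.\<close>
    define x1 where "x1 = 1 + (norm A + 1) / (norm B * r)"
    have nB: "norm B > 0" using \<open>B \<noteq> 0\<close> by simp
    have r: "r > 0" using z by (simp add: r_def)
    have x1: "x1 > 0" using nB r by (simp add: x1_def add_pos_nonneg)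
    have big: "1 \<le> F x" if "x \<ge> x1" for x
    proof -
      have x0: "x > 0" using x1 that by simp
      have "(norm A + 1) / (norm B * r) \<le> x" using that by (simp add: x1_def)
      hence "norm A + 1 \<le> norm B * (r * x)" using nB r by (simp add: field_simps)
      also have "\<dots> \<le> norm B * exp (r * x)"
      proof (rule mult_left_mono)
        show "r * x \<le> exp (r * x)" using exp_ge_add_one_self[of "r * x"] by linarith
      qed simp
      also have "\<dots> = norm (B * exp (z * of_real x))" by (simp add: norm_mult r_def)
      finally have 1: "norm A + 1 \<le> norm (B * exp (z * of_real x))" .
      have 2: "norm (A * exp (- (z * of_real x))) \<le> norm A"
        unfolding norm_mult using r x0 by (intro mult_left_le) (auto simp: r_def)
      have "1 \<le> norm (f x)"
        using norm_diff_ineq[of "B * exp (z * of_real x)" "A * exp (- (z * of_real x))"] 1 2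
        unfolding f[OF x0] by (simp add: add.commute)
      hence "1 \<le> (norm (f x))\<^sup>2" by simp
      thus ?thesis using bd[OF x0] by linarith
    qed
    \<comment> \<open>An interval longer than the integral of \<open>\<bar>F\<bar>\<close>, on which
      \<open>F \<ge> 1\<close>, is the contradiction.\<close>
    define n where "n = \<bar>LINT x|lborel. \<bar>F x\<bar>\<bar> + 1"
    have "(LINT x|lborel. indicator {x1..x1 + n} x) \<le> (LINT x|lborel. \<bar>F x\<bar>)"
    proof (rule integral_mono)
      show "integrable lborel (indicator {x1..x1 + n} :: real \<Rightarrow> real)" by (rule integrable_real_indicator) (auto simp: emeasure_lborel_Icc_eq)
      show "integrable lborel (\<lambda>x. \<bar>F x\<bar>)" using F by (rule integrable_abs)
      show "indicator {x1..x1 + n} x \<le> \<bar>F x\<bar>" for x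
        using big[of x] by (auto simp: indicator_def)
    qed
    moreover have "(LINT x|lborel. indicator {x1..x1 + n} x :: real) = n" by (simp add: n_def)
    ultimately show False unfolding n_def by linarith
  qed
  show ?thesis
  proof (rule that[of A])
    fix x :: real assume x: "x > 0"
    show "f x = A * exp (- (z * of_real x))" using f[OF x] B0 by simp
    moreover have "f1 x = - z * f x" using g[OF x] B0 by (simp add: eq_neg_iff_add_eq_0)
    ultimately show "f1 x = - z * A * exp (- (z * of_real x))" by (simp add: mult.assoc)
  qed
qed

text \<open>The combinations \<open>f + i g\<close> and \<open>f - i g\<close> diagonalize the
  system with the coefficients \<open>z\<^sup>2\<close> and \<open>(cnj z)\<^sup>2\<close>. As
  \<open>f\<close> and \<open>g\<close> are complex, these are not conjugates of each other and both
  have to be solved. The limits at 0 identify the constants, after which the slopes are functions of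
  the values.\<close>

lemma half_line_decay:
  fixes f g f1 g1 :: "real \<Rightarrow> complex" and r :: real
  assumes r: "r > 0"
    and d: "\<And>x. x > 0 \<Longrightarrow> (f has_vector_derivative f1 x) (at x)" "\<And>x. x > 0 \<Longrightarrow> (g has_vector_derivative g1 x) (at x)"
      "\<And>x. x > 0 \<Longrightarrow> (f1 has_vector_derivative - (2 * r\<^sup>2) *\<^sub>R g x) (at x)"
      "\<And>x. x > 0 \<Longrightarrow> (g1 has_vector_derivative (2 * r\<^sup>2) *\<^sub>R f x) (at x)"
    and F: "integrable lborel F" and bd: "\<And>x. x > 0 \<Longrightarrow> (norm (f x))\<^sup>2 \<le> F x" "\<And>x. x > 0 \<Longrightarrow> (norm (g x))\<^sup>2 \<le> F x"
    and lim: "(f \<longlongrightarrow> f0) (at_right 0)" "(g \<longlongrightarrow> g0) (at_right 0)" "(f1 \<longlongrightarrow> f10) (at_right 0)" "(g1 \<longlongrightarrow> g10) (at_right 0)"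
  shows "\<And>x. x > 0 \<Longrightarrow> f x = exp (- r * x) *\<^sub>R (f0 * of_real (cos (r * x)) + g0 * of_real (sin (r * x)))"
    and "\<And>x. x > 0 \<Longrightarrow> g x = exp (- r * x) *\<^sub>R (g0 * of_real (cos (r * x)) - f0 * of_real (sin (r * x)))"
    and "f10 = of_real r * (g0 - f0)" and "g10 = - of_real r * (f0 + g0)"
proof -
  define z where "z = Complex r r"
  have zz: "z\<^sup>2 = 2 * of_real (r\<^sup>2) * \<i>" "(cnj z)\<^sup>2 = - (2 * of_real (r\<^sup>2) * \<i>)"
    by (simp_all add: z_def complex_eq_iff power2_eq_square)
  have sq: "(norm (f x + w * g x))\<^sup>2 \<le> 4 * F x" if x: "x > 0" and w: "norm w = 1" for x w
  proof -
    have "norm (f x + w * g x) \<le> norm (f x) + norm (g x)"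
      using norm_triangle_ineq[of "f x" "w * g x"] w by (simp add: norm_mult)
    hence "(norm (f x + w * g x))\<^sup>2 \<le> (norm (f x) + norm (g x))\<^sup>2" by (intro power_mono) auto
    also have "\<dots> \<le> 2 * (norm (f x))\<^sup>2 + 2 * (norm (g x))\<^sup>2"
      using sum_squares_bound[of "norm (f x)" "norm (g x)"] by (simp add: power2_sum)
    finally show ?thesis using bd[OF x] by linarith
  qed
  have F4: "integrable lborel (\<lambda>x. 4 * F x)" using F by simp
  have d': "((\<lambda>x. f x + w * g x) has_vector_derivative f1 x + w * g1 x) (at x)"
      "((\<lambda>x. f1 x + w * g1 x) has_vector_derivative - (2 * r\<^sup>2) *\<^sub>R g x + w * ((2 * r\<^sup>2) *\<^sub>R f x)) (at x)" if "x > 0" for x w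
    by (intro has_vector_derivative_add has_vector_derivative_mult_right d that)+
  have Re: "Re z > 0" "Re (cnj z) > 0" using r by (simp_all add: z_def)
  obtain A where A: "\<And>x. x > 0 \<Longrightarrow> f x + \<i> * g x = A * exp (- (z * of_real x))"
     "\<And>x. x > 0 \<Longrightarrow> f1 x + \<i> * g1 x = - z * A * exp (- (z * of_real x))"
  proof (rule decaying_solution[OF Re(1) d'(1)[where w = \<i>] _ F4])
    show "((\<lambda>x. f1 x + \<i> * g1 x) has_vector_derivative z\<^sup>2 * (f x + \<i> * g x)) (at x)" if "x > 0" for x
      using d'(2)[OF that, of \<i>] unfolding zz by (simp add: scaleR_conv_of_real algebra_simps)
  qed (use sq[of _ \<i>] in auto)
  obtain B where B: "\<And>x. x > 0 \<Longrightarrow> f x + - \<i> * g x = B * exp (- (cnj z * of_real x))"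
     "\<And>x. x > 0 \<Longrightarrow> f1 x + - \<i> * g1 x = - cnj z * B * exp (- (cnj z * of_real x))"
  proof (rule decaying_solution[OF Re(2) d'(1)[where w = "- \<i>"] _ F4])
    show "((\<lambda>x. f1 x + - \<i> * g1 x) has_vector_derivative (cnj z)\<^sup>2 * (f x + - \<i> * g x)) (at x)" if "x > 0" for x
      using d'(2)[OF that, of "- \<i>"] unfolding zz by (simp add: scaleR_conv_of_real algebra_simps)
  qed (use sq[of _ "- \<i>"] in auto)
  have ex: "((\<lambda>x. C * exp (- (y * of_real x))) \<longlongrightarrow> C) (at_right 0)" for C y :: complex
  proof -
    have "((\<lambda>x::real. C * exp (- (y * of_real x))) \<longlongrightarrow> C * exp (- (y * of_real 0))) (at_right 0)"
      by (intro tendsto_intros)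
    thus ?thesis by simp
  qed
  have uniq: "p = q" if "(h \<longlongrightarrow> p) (at_right 0)" "((\<lambda>x. q * exp (- (y * of_real x))) \<longlongrightarrow> q) (at_right 0)"
    "\<And>x. x > 0 \<Longrightarrow> h x = q * exp (- (y * of_real x))" for h and p q y :: complex
  proof -
    have "eventually (\<lambda>x. q * exp (- (y * of_real x)) = h x) (at_right (0::real))"
      unfolding eventually_at_right_field using that(3) by (auto intro: exI[of _ 1])
    from tendsto_cong[OF this] that(2) have "(h \<longlongrightarrow> q) (at_right 0)" by blast
    thus ?thesis using tendsto_unique[OF _ that(1)] by simp
  qed
  have A0: "f0 + \<i> * g0 = A" by (rule uniq[OF _ ex A(1)]) (intro tendsto_intros lim)
  have A1: "f10 + \<i> * g10 = - z * A" by (rule uniq[OF _ ex A(2)]) (intro tendsto_intros lim)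
  have B0: "f0 + - \<i> * g0 = B" by (rule uniq[OF _ ex B(1)]) (intro tendsto_intros lim)
  have B1: "f10 + - \<i> * g10 = - cnj z * B" by (rule uniq[OF _ ex B(2)]) (intro tendsto_intros lim)
  have zc: "z = of_real r * (1 + \<i>)" "cnj z = of_real r * (1 - \<i>)" by (simp_all add: z_def complex_eq_iff)
  have "2 * f10 = (f10 + \<i> * g10) + (f10 + - \<i> * g10)" by simp
  also have "\<dots> = 2 * (of_real r * (g0 - f0))"
    unfolding A1 B1 A0[symmetric] B0[symmetric] zc by (simp add: algebra_simps)
  finally show "f10 = of_real r * (g0 - f0)" by simp
  have "2 * \<i> * g10 = (f10 + \<i> * g10) - (f10 + - \<i> * g10)" by simp
  also have "\<dots> = 2 * \<i> * (- of_real r * (f0 + g0))"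
    unfolding A1 B1 A0[symmetric] B0[symmetric] zc by (simp add: algebra_simps)
  finally show "g10 = - of_real r * (f0 + g0)" by (subst (asm) mult_left_cancel) auto
  fix x :: real assume x: "x > 0"
  define e s c where "e = complex_of_real (exp (- r * x))" and "s = complex_of_real (sin (r * x))" and "c = complex_of_real (cos (r * x))"
  have ez: "exp (- (z * of_real x)) = e * (c - \<i> * s)" "exp (- (cnj z * of_real x)) = e * (c + \<i> * s)"
    unfolding e_def s_def c_def
    by (simp_all add: z_def complex_eq_iff Re_exp Im_exp)
  have "2 * f x = (f x + \<i> * g x) + (f x + - \<i> * g x)" by simp
  also have "\<dots> = 2 * (e * (f0 * c + g0 * s))"
    unfolding A(1)[OF x] B(1)[OF x] A0[symmetric] B0[symmetric] ez by (simp add: algebra_simps)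
  finally show "f x = exp (- r * x) *\<^sub>R (f0 * of_real (cos (r * x)) + g0 * of_real (sin (r * x)))"
    by (simp add: e_def s_def c_def scaleR_conv_of_real)
  have "2 * \<i> * g x = (f x + \<i> * g x) - (f x + - \<i> * g x)" by simp
  also have "\<dots> = 2 * \<i> * (e * (g0 * c - f0 * s))"
    unfolding A(1)[OF x] B(1)[OF x] A0[symmetric] B0[symmetric] ez by (simp add: algebra_simps)
  finally show "g x = exp (- r * x) *\<^sub>R (g0 * of_real (cos (r * x)) - f0 * of_real (sin (r * x)))"
    by (simp add: e_def s_def c_def scaleR_conv_of_real)
qed

section \<open>The sign wall and the bound states\<close>

text \<open>An odd wall is preserved by the reflection \<open>x \<mapsto> - x\<close> combined with
  exchanging \<open>u\<close> and \<open>v\<close>; the solution here is invariant, which is why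
  \<open>v\<close> is the reflected \<open>u\<close>. It is computed for rate 1 and then
  dilated.\<close>

lemma sgn_profiles:
  assumes k: "k > 0"
  shows "\<exists>u1 v1. profiles (2 * sqrt 2 * k\<^sup>2) sgn (1 / sqrt 2) (bound_profile k) (\<lambda>x. bound_profile k (- x)) u1 v1"
proof -
  note s2 = sqrt2_mult
  \<comment> \<open>The decaying solution with \<open>u 0 = v 0 = sqrt 2 - 1\<close>, the value of
    \<open>bound_profile\<close> at 0; on the left the folded function is \<open>sqrt 2 - 1\<close>
    times it.\<close>
  define z1 where "z1 x = Complex (sqrt 2 - 1) 1 * exp (- \<omega> * of_real x)" for x
  have dz: "(z1 has_vector_derivative - \<omega> * z1 x) (at x within S)" for x S
  proof -
    have "((\<lambda>x. Complex (sqrt 2 - 1) 1 * exp (- \<omega> * of_real x)) has_vector_derivative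
        Complex (sqrt 2 - 1) 1 * (- \<omega> * exp (- \<omega> * of_real x))) (at x within S)"
      by (rule has_vector_derivative_real_field) (auto intro!: derivative_eq_intros)
    thus ?thesis by (simp add: z1_def[abs_def] mult_ac)
  qed
  have kk: "- \<omega> * (- \<omega> * y) = 2 * \<i> * y" for y
    by (simp add: complex_eq_iff algebra_simps)
  have z1z: "z1 0 = Complex (sqrt 2 - 1) 1" by (simp add: z1_def)
  have nz: "norm (z1 x) = norm (z1 0) * exp (- x)" for x by (simp add: z1_def norm_mult)
  have nb: "norm (y * z1 x) \<le> (norm y * norm (z1 0)) * exp (- x / 2)" if "x \<ge> 0" for x y
  proof -
    have "(norm y * norm (z1 0)) * exp (- x) \<le> (norm y * norm (z1 0)) * exp (- x / 2)"
      using that by (intro mult_left_mono) auto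
    thus ?thesis by (simp add: norm_mult[of y] nz[of x] mult.assoc)
  qed
  define q where "q = complex_of_real (sqrt 2 - 1)"
  define C where "C = (1 + norm \<omega> + norm q + norm (q * \<omega>)) * norm (z1 0)"
  have n0: "norm \<omega> \<ge> 0" "norm q \<ge> 0" "norm (q * \<omega>) \<ge> 0" by simp_all
  have C: "norm y * norm (z1 0) * exp (- x / 2) \<le> C * exp (- x / 2)"
    if "norm y \<le> 1 + norm \<omega> + norm q + norm (q * \<omega>)" for x y
    unfolding C_def using that by (intro mult_right_mono) auto
  have "half_line_pair 0 (\<lambda>x. 0) (\<lambda>x. 0) z1 (\<lambda>x. - \<omega> * z1 x) (\<lambda>x. q * z1 x) (\<lambda>x. q * (- \<omega> * z1 x))"
    unfolding half_line_pair_def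
  proof (rule exI[of _ "sqrt 2 - 1"], rule exI[of _ "sqrt 2 - 1"], rule exI[of _ C], intro conjI allI impI)
    show "sqrt 2 - 1 \<noteq> (0::real)" using sqrt2_bounds by simp
    show "z1 0 = Complex (sqrt 2 - 1) ((sqrt 2 + 1) * (sqrt 2 - 1))"
      "q * z1 0 = Complex ((sqrt 2 - 1) * (sqrt 2 - 1)) (sqrt 2 - 1)"
      unfolding z1z q_def by (simp_all add: complex_eq_iff algebra_simps)
    show "Re (- \<omega> * z1 0) = - Im (q * (- \<omega> * z1 0))"
      "(sqrt 2 - 1) * Im (- \<omega> * z1 0) = - (sqrt 2 + 1) * Re (q * (- \<omega> * z1 0))"
      unfolding z1z q_def by (simp_all add: algebra_simps s2)
    fix x :: real assume x: "x \<ge> 0"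
    show "(z1 has_vector_derivative - \<omega> * z1 x) (at x within {0..})" by (rule dz)
    show "((\<lambda>x. q * z1 x) has_vector_derivative q * (- \<omega> * z1 x)) (at x within {0..})"
      by (intro has_vector_derivative_mult_right dz)
    have D: "((\<lambda>x. - \<omega> * z1 x) has_vector_derivative - \<omega> * (- \<omega> * z1 x)) (at x within {0..})"
      by (intro has_vector_derivative_mult_right dz)
    thus "((\<lambda>x. - \<omega> * z1 x) has_vector_derivative 2 * \<i> * z1 x + 0 *\<^sub>R energy_shift (z1 x) + 0 *\<^sub>R wall_shift (z1 x)) (at x within {0..})"
      unfolding kk by simp
    have "((\<lambda>x. q * (- \<omega> * z1 x)) has_vector_derivative q * (- \<omega> * (- \<omega> * z1 x))) (at x within {0..})"
      by (intro has_vector_derivative_mult_right D)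
    thus "((\<lambda>x. q * (- \<omega> * z1 x)) has_vector_derivative 2 * \<i> * (q * z1 x) + 0 *\<^sub>R energy_shift (q * z1 x) - 0 *\<^sub>R wall_shift (q * z1 x)) (at x within {0..})"
      unfolding kk by (simp add: mult_ac)
    show "norm (z1 x) \<le> C * exp (- x / 2)"
      using order_trans[OF nb[OF x, of 1] C[of 1]] n0 by simp
    show "norm (- \<omega> * z1 x) \<le> C * exp (- x / 2)"
      using order_trans[OF nb[OF x, of "- \<omega>"] C[of "- \<omega>"]] n0 by simp
    show "norm (q * z1 x) \<le> C * exp (- x / 2)"
      using order_trans[OF nb[OF x, of q] C[of q]] n0 by simp
    show "norm (q * (- \<omega> * z1 x)) \<le> C * exp (- x / 2)"
      using order_trans[OF nb[OF x, of "q * - \<omega>"] C[of "q * - \<omega>"]] n0 by (simp add: mult.assoc)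
  qed
  from whole_line_profiles[OF this, of sgn] obtain u1 v1 where
    p: "profiles (2 * sqrt 2) sgn (1 / sqrt 2 + 0)
      (\<lambda>x. if x \<ge> 0 then Re (z1 x) else Im (q * z1 (- x)))
      (\<lambda>x. if x \<ge> 0 then (sqrt 2 - 1) * Im (z1 x) else (sqrt 2 + 1) * Re (q * z1 (- x))) u1 v1"
    by auto
  have e: "Re (z1 x) = exp (- x) * ((sqrt 2 - 1) * cos x + sin x)" "Im (z1 x) = exp (- x) * (cos x - (sqrt 2 - 1) * sin x)" for x
    by (simp_all add: z1_def Re_exp Im_exp algebra_simps)
  have 1: "(\<lambda>x. if x \<ge> 0 then Re (z1 x) else Im (q * z1 (- x))) = bound_profile 1"
    by (auto simp: fun_eq_iff bound_profile_def Let_def q_def e algebra_simps)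
  have 2: "(\<lambda>x. if x \<ge> 0 then (sqrt 2 - 1) * Im (z1 x) else (sqrt 2 + 1) * Re (q * z1 (- x))) = (\<lambda>x. bound_profile 1 (- x))"
  proof
    fix x :: real
    \<comment> \<open>At \<open>x = 0\<close> both sides take their nonnegative branch; elsewhere
      the branches are opposite.\<close>
    show "(if x \<ge> 0 then (sqrt 2 - 1) * Im (z1 x) else (sqrt 2 + 1) * Re (q * z1 (- x))) = bound_profile 1 (- x)"
      by (cases "x = 0") (auto simp: bound_profile_def Let_def q_def e algebra_simps s2)
  qed
  have "profiles (2 * sqrt 2) (\<lambda>x. sgn (x / k)) (1 / sqrt 2) (bound_profile 1) (\<lambda>x. bound_profile 1 (- x)) u1 v1"
    using p k unfolding 1 2 by (simp add: sgn_divide)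
  from profiles_rescale[OF this k]
  have "profiles (2 * sqrt 2 * k\<^sup>2) sgn (1 / sqrt 2) (\<lambda>x. bound_profile 1 (k * x)) (\<lambda>x. bound_profile 1 (- (k * x)))
     (\<lambda>x. k * u1 (k * x)) (\<lambda>x. k * v1 (k * x))" .
  moreover have "bound_profile 1 (k * x) = bound_profile k x" for x
    using k by (simp add: bound_profile_def zero_le_mult_iff Let_def)
  from this this[of "- x" for x] have "(\<lambda>x. bound_profile 1 (k * x)) = bound_profile k" "(\<lambda>x. bound_profile 1 (- (k * x))) = (\<lambda>x. bound_profile k (- x))"
    by auto
  ultimately show ?thesis by auto
qed

section \<open>Return to the coupling constants of the operator\<close>

lemma decay_rate_props:
  assumes "\<alpha>2 \<noteq> 0" "\<theta> \<noteq> 0"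
  shows "decay_rate \<alpha>2 \<theta> > 0" and "2 * sqrt 2 * (decay_rate \<alpha>2 \<theta>)\<^sup>2 = \<bar>\<theta>\<bar> / \<bar>\<alpha>2\<bar>"
  using assms by (simp_all add: decay_rate_def)

context
  fixes \<alpha>2 \<theta> :: real
  assumes nz: "\<alpha>2 \<noteq> 0" "\<theta> \<noteq> 0"
begin

lemma pair_positive: "\<bar>\<theta>\<bar> / \<bar>\<alpha>2\<bar> > 0" using nz by simp

lemma sgn_coupling: "\<alpha>2 * sgn (\<alpha>2 * \<theta>) = \<theta> / (\<bar>\<theta>\<bar> / \<bar>\<alpha>2\<bar>)" "sgn (\<alpha>2 * \<theta>) * sgn (\<alpha>2 * \<theta>) = 1"
  using nz unfolding sgn_mult by (cases "\<alpha>2 > 0"; cases "\<theta> > 0"; simp)+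

text \<open>The factor \<open>- i sgn (\<alpha>2 \<theta>)\<close> compensates the imaginary entries
  of \<open>sigma2\<close> and the sign of the coupling; both swap relations carry the same constant
  because the sign squares to 1.\<close>

lemma sigma_frames:
  defines "\<sigma> \<equiv> complex_of_real (sgn (\<alpha>2 * \<theta>))"
  shows "sigma_frame \<alpha>2 \<theta> (\<bar>\<theta>\<bar> / \<bar>\<alpha>2\<bar>) 1 (vector [1, 0]) (vector [0, - \<i> * \<sigma>])"
    and "sigma_frame \<alpha>2 \<theta> (\<bar>\<theta>\<bar> / \<bar>\<alpha>2\<bar>) (- 1) (vector [0, 1]) (vector [- \<i> * \<sigma>, 0])"
proof -
  have s: "1 * \<theta> / (\<bar>\<theta>\<bar> / \<bar>\<alpha>2\<bar>) = \<alpha>2 * sgn (\<alpha>2 * \<theta>)" "- 1 * \<theta> / (\<bar>\<theta>\<bar> / \<bar>\<alpha>2\<bar>) = - (\<alpha>2 * sgn (\<alpha>2 * \<theta>))"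
    using sgn_coupling by simp_all
  note simps = vec_eq_iff forall_2 sigma2_mult sigma3_mult vector_2 complex_eq_iff sgn_coupling(2) mult.assoc nz sgn_eq_0_iff
  show "sigma_frame \<alpha>2 \<theta> (\<bar>\<theta>\<bar> / \<bar>\<alpha>2\<bar>) 1 (vector [1, 0]) (vector [0, - \<i> * \<sigma>])"
    "sigma_frame \<alpha>2 \<theta> (\<bar>\<theta>\<bar> / \<bar>\<alpha>2\<bar>) (- 1) (vector [0, 1]) (vector [- \<i> * \<sigma>, 0])"
    unfolding sigma_frame_def s \<sigma>_def by (simp_all add: simps)
qed

lemma eigenvalues_of_profiles:
  assumes "profiles (\<bar>\<theta>\<bar> / \<bar>\<alpha>2\<bar>) w \<rho> u v u1 v1" "w \<in> borel_measurable borel" "\<And>x. \<bar>w x\<bar> \<le> W"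
  shows "eigenvalue (S_op \<alpha>2 \<theta> w) (\<theta> * \<rho>)" "eigenvalue (S_op \<alpha>2 \<theta> w) (- (\<theta> * \<rho>))"
  using eigenpair_of_profiles[OF assms(1) pair_positive assms(2,3) sigma_frames(1)]
    eigenpair_of_profiles[OF assms(1) pair_positive assms(2,3) sigma_frames(2)]
  unfolding eigenvalue_def by auto

lemma steep_eigenvalues:
  assumes w: "domain_wall w"
  shows "\<exists>\<epsilon>0>0. \<forall>\<epsilon>. 0 < \<epsilon> \<and> \<epsilon> < \<epsilon>0 \<longrightarrow>
          (\<exists>\<Omega>. \<Omega> > 0 \<and> \<Omega> \<in> spectral_gap \<theta> \<and> - \<Omega> \<in> spectral_gap \<theta> \<and>
             eigenvalue (S_op \<alpha>2 \<theta> (\<lambda>X. w (X / \<epsilon>))) \<Omega> \<and>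
             eigenvalue (S_op \<alpha>2 \<theta> (\<lambda>X. w (X / \<epsilon>))) (- \<Omega>))"
proof -
  define k where "k = decay_rate \<alpha>2 \<theta>"
  have k: "k > 0" "2 * sqrt 2 * k\<^sup>2 = \<bar>\<theta>\<bar> / \<bar>\<alpha>2\<bar>" using decay_rate_props[OF nz] by (simp_all add: k_def)
  have "w differentiable_on UNIV"
    using w unfolding domain_wall_def smooth_def by (metis funpow_0)
  hence c: "continuous_on UNIV w" by (rule differentiable_imp_continuous_on)
  have lim: "(w \<longlongrightarrow> 1) at_top" "(w \<longlongrightarrow> - 1) at_bot" using w by (simp_all add: domain_wall_def)
  obtain W where W: "\<And>x. \<bar>w x\<bar> \<le> W" using bounded_of_limits[OF c lim] by blast
  \<comment> \<open>Any tolerance keeping \<open>\<rho>\<close> strictly between 0 and 1 would do;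
    1/8 works because \<open>1 / sqrt 2\<close> lies between \<open>1/2\<close> and
    \<open>7/8\<close>.\<close>
  have "(1/8::real) > 0" by simp
  from perturbed_profiles[OF this c lim] obtain e0 where e0: "e0 > 0" and
    key: "\<And>\<epsilon>. 0 < \<epsilon> \<Longrightarrow> \<epsilon> < e0 \<Longrightarrow> \<exists>\<rho> u v u1 v1. \<bar>\<rho> - 1 / sqrt 2\<bar> \<le> 1/8 \<and> profiles (2 * sqrt 2) (\<lambda>x. w (x / \<epsilon>)) \<rho> u v u1 v1"
    by blast
  show ?thesis
  \<comment> \<open>Dilation by \<open>k\<close> turns a wall of width \<open>k * \<epsilon>\<close>
    at the normalized coupling into one of width \<open>\<epsilon>\<close> at the given
    coupling.\<close>
  proof (rule exI[of _ "e0 / k"], intro conjI allI impI)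
    show "e0 / k > 0" using e0 k by simp
    fix \<epsilon> :: real assume \<epsilon>: "0 < \<epsilon> \<and> \<epsilon> < e0 / k"
    hence "0 < k * \<epsilon>" "k * \<epsilon> < e0" using k by (auto simp: field_simps)
    from key[OF this] obtain \<rho> u v u1 v1 where \<rho>: "\<bar>\<rho> - 1 / sqrt 2\<bar> \<le> 1/8"
      and p: "profiles (2 * sqrt 2) (\<lambda>x. w (x / (k * \<epsilon>))) \<rho> u v u1 v1" by blast
    have "profiles (2 * sqrt 2 * k\<^sup>2) (\<lambda>x. w (x / \<epsilon>)) \<rho> (\<lambda>x. u (k * x)) (\<lambda>x. v (k * x)) (\<lambda>x. k * u1 (k * x)) (\<lambda>x. k * v1 (k * x))"
      by (rule profiles_rescale[OF _ k(1)]) (use p in \<open>simp add: mult.commute\<close>)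
    hence p': "profiles (\<bar>\<theta>\<bar> / \<bar>\<alpha>2\<bar>) (\<lambda>x. w (x / \<epsilon>)) \<rho> (\<lambda>x. u (k * x)) (\<lambda>x. v (k * x)) (\<lambda>x. k * u1 (k * x)) (\<lambda>x. k * v1 (k * x))"
      unfolding k(2) .
    have "(\<lambda>x. w (x / \<epsilon>)) \<in> borel_measurable borel"
      by (intro borel_measurable_continuous_onI continuous_on_compose2[OF c] continuous_intros) (use \<epsilon> in auto)
    note ev = eigenvalues_of_profiles[OF p' this, of W, OF W]
    have "sqrt 2 < 7/4" by (rule real_less_lsqrt) (auto simp: power2_eq_square)
    moreover have "1 / sqrt 2 = sqrt 2 / 2" by (simp add: field_simps)
    ultimately have \<rho>b: "0 < \<rho>" "\<rho> < 1" using \<rho> sqrt2_bounds by linarith+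
    have "\<bar>\<theta>\<bar> * \<rho> < \<bar>\<theta>\<bar> * 1" using \<rho>b nz by (intro mult_strict_left_mono) auto
    moreover have "\<bar>\<theta>\<bar> * \<rho> > 0" using \<rho>b nz by simp
    \<comment> \<open>Which of the two frames yields the positive eigenvalue depends on the sign of
      \<open>\<theta>\<close>.\<close>
    moreover have "eigenvalue (S_op \<alpha>2 \<theta> (\<lambda>X. w (X / \<epsilon>))) (\<bar>\<theta>\<bar> * \<rho>)" "eigenvalue (S_op \<alpha>2 \<theta> (\<lambda>X. w (X / \<epsilon>))) (- (\<bar>\<theta>\<bar> * \<rho>))"
      using ev by (cases "\<theta> \<ge> 0"; simp)+
    ultimately show "\<exists>\<Omega>. \<Omega> > 0 \<and> \<Omega> \<in> spectral_gap \<theta> \<and> - \<Omega> \<in> spectral_gap \<theta> \<and>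
             eigenvalue (S_op \<alpha>2 \<theta> (\<lambda>X. w (X / \<epsilon>))) \<Omega> \<and>
             eigenvalue (S_op \<alpha>2 \<theta> (\<lambda>X. w (X / \<epsilon>))) (- \<Omega>)"
      by (intro exI[of _ "\<bar>\<theta>\<bar> * \<rho>"]) (auto simp: spectral_gap_def)
  qed
qed

lemma bound_state_representation:
  "bound_state_1 \<alpha>2 \<theta> = (\<lambda>X. bound_profile (decay_rate \<alpha>2 \<theta>) X *\<^sub>R vector [1, 0]
      + bound_profile (decay_rate \<alpha>2 \<theta>) (- X) *\<^sub>R vector [0, - \<i> * of_real (sgn (\<alpha>2 * \<theta>))])"
  "bound_state_2 \<alpha>2 \<theta> = (\<lambda>X. bound_profile (decay_rate \<alpha>2 \<theta>) X *\<^sub>R vector [0, 1]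
      + bound_profile (decay_rate \<alpha>2 \<theta>) (- X) *\<^sub>R vector [- \<i> * of_real (sgn (\<alpha>2 * \<theta>)), 0])"
  by (auto simp: bound_state_1_def bound_state_2_def fun_eq_iff Let_def vec_eq_iff forall_2 vector_2 complex_eq_iff)

lemma bound_states_solve:
  shows "eigenpair (S_op \<alpha>2 \<theta> sgn) (\<theta> / sqrt 2) (bound_state_1 \<alpha>2 \<theta>)"
    and "eigenpair (S_op \<alpha>2 \<theta> sgn) (- \<theta> / sqrt 2) (bound_state_2 \<alpha>2 \<theta>)"
    and "matched_solution \<alpha>2 \<theta> (\<theta> / sqrt 2) (bound_state_1 \<alpha>2 \<theta>)"
    and "matched_solution \<alpha>2 \<theta> (- \<theta> / sqrt 2) (bound_state_2 \<alpha>2 \<theta>)"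
proof -
  obtain u1 v1 where p: "profiles (\<bar>\<theta>\<bar> / \<bar>\<alpha>2\<bar>) sgn (1 / sqrt 2) (bound_profile (decay_rate \<alpha>2 \<theta>))
      (\<lambda>x. bound_profile (decay_rate \<alpha>2 \<theta>) (- x)) u1 v1"
    using sgn_profiles[OF decay_rate_props(1)[OF nz]] unfolding decay_rate_props(2)[OF nz] by blast
  have m: "(sgn :: real \<Rightarrow> real) \<in> borel_measurable borel" by measurable
  have b: "\<bar>sgn x\<bar> \<le> (1::real)" for x :: real by (simp add: sgn_if)
  show "eigenpair (S_op \<alpha>2 \<theta> sgn) (\<theta> / sqrt 2) (bound_state_1 \<alpha>2 \<theta>)"
    "eigenpair (S_op \<alpha>2 \<theta> sgn) (- \<theta> / sqrt 2) (bound_state_2 \<alpha>2 \<theta>)"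
    using eigenpair_of_profiles[OF p pair_positive m b sigma_frames(1)] eigenpair_of_profiles[OF p pair_positive m b sigma_frames(2)]
    by (simp_all add: bound_state_representation)
  show "matched_solution \<alpha>2 \<theta> (\<theta> / sqrt 2) (bound_state_1 \<alpha>2 \<theta>)"
    "matched_solution \<alpha>2 \<theta> (- \<theta> / sqrt 2) (bound_state_2 \<alpha>2 \<theta>)"
    using matched_solution_of_profiles[OF p pair_positive sigma_frames(1)] matched_solution_of_profiles[OF p pair_positive sigma_frames(2)]
    by (simp_all add: bound_state_representation)
qed

end

section \<open>Complex multiples of solutions\<close>

lemma matched_solution_smult:
  assumes "matched_solution \<alpha>2 \<theta> \<Omega> f"
  shows "matched_solution \<alpha>2 \<theta> \<Omega> (\<lambda>X. c *s f X)"
proof -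
  from assms obtain f1 f2 where d: "\<And>X. X \<noteq> 0 \<Longrightarrow> (f has_vector_derivative f1 X) (at X)"
      "\<And>X. X \<noteq> 0 \<Longrightarrow> (f1 has_vector_derivative f2 X) (at X)"
    and e: "\<And>X. X > 0 \<Longrightarrow> (- \<alpha>2) *\<^sub>R (sigma2 *v (- f2 X)) + \<theta> *\<^sub>R (sigma3 *v f X) = \<Omega> *\<^sub>R f X"
      "\<And>X. X < 0 \<Longrightarrow> (- \<alpha>2) *\<^sub>R (sigma2 *v (- f2 X)) - \<theta> *\<^sub>R (sigma3 *v f X) = \<Omega> *\<^sub>R f X"
    and c: "isCont f 0" "isCont f1 0"
    unfolding matched_solution_def by blast
  have s: "\<Omega> *\<^sub>R (c *s x) = c *s (\<Omega> *\<^sub>R x)"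
    "(- \<alpha>2) *\<^sub>R (sigma2 *v (- (c *s y))) + \<theta> *\<^sub>R (sigma3 *v (c *s x)) = c *s ((- \<alpha>2) *\<^sub>R (sigma2 *v (- y)) + \<theta> *\<^sub>R (sigma3 *v x))"
    "(- \<alpha>2) *\<^sub>R (sigma2 *v (- (c *s y))) - \<theta> *\<^sub>R (sigma3 *v (c *s x)) = c *s ((- \<alpha>2) *\<^sub>R (sigma2 *v (- y)) - \<theta> *\<^sub>R (sigma3 *v x))"
    for x y :: "complex^2"
    by (simp_all add: sigma2_mult sigma3_mult vec_eq_iff forall_2 vector_2 algebra_simps)
  show ?thesis
    unfolding matched_solution_def
  proof (rule exI[of _ "\<lambda>X. c *s f1 X"], rule exI[of _ "\<lambda>X. c *s f2 X"], intro conjI allI impI)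
    show "isCont (\<lambda>X. c *s f X) 0" "isCont (\<lambda>X. c *s f1 X) 0"
      by (intro bounded_linear.isCont[OF bounded_linear_vector_smult] c)+
  qed (simp_all only: s e, (intro has_vector_derivative_smult d; assumption)+)
qed

lemma L2_smult:
  assumes "\<psi> \<in> L2"
  shows "(\<lambda>X. c *s \<psi> X) \<in> L2"
proof -
  have "(\<lambda>X. c *s \<psi> X) \<in> borel_measurable borel"
    using borel_measurable_continuous_onI[OF linear_continuous_on[OF bounded_linear_vector_smult]] assms
    unfolding L2_def by (auto intro: measurable_compose[rotated])
  moreover have "integrable lborel (\<lambda>X. (norm c)\<^sup>2 * (norm (\<psi> X))\<^sup>2)" using assms by (simp add: L2_def)
  ultimately show ?thesis by (simp add: L2_def norm_vector_smult power_mult_distrib)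
qed

section \<open>Uniqueness of the bound states\<close>

lemma has_vector_derivative_mirror:
  assumes "(h has_vector_derivative h') (at (- x))"
  shows "((\<lambda>x::real. h (- x)) has_vector_derivative - h') (at x)"
proof -
  have "(uminus has_vector_derivative (- 1 :: real)) (at x)"
    by (auto intro!: derivative_eq_intros)
  from vector_diff_chain_at[OF this assms] show ?thesis by (simp add: o_def)
qed

text \<open>Scaling \<open>b\<close> by \<open>1 / c\<close> on the right, and by \<open>c\<close>
  on the left after reflection, brings both half-lines to the normal form of
  \<open>half_line_decay\<close> with the same rate \<open>r\<close>. Each side then expresses the
  slopes at 0 through the values, and equating them leaves two linear relations between
  \<open>a 0\<close> and \<open>b 0\<close>.\<close>

lemma matched_components:
  fixes a b a1 b1 aa bb :: "real \<Rightarrow> complex" and c r :: real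
  assumes c: "c > 0" and r: "r > 0"
    and der: "\<forall>x. x \<noteq> 0 \<longrightarrow> (a has_vector_derivative a1 x) (at x) \<and> (b has_vector_derivative b1 x) (at x) \<and>
      (a1 has_vector_derivative aa x) (at x) \<and> (b1 has_vector_derivative bb x) (at x)"
    and right: "\<forall>x>0. aa x = - (2 * r\<^sup>2 / c) *\<^sub>R b x \<and> bb x = (2 * r\<^sup>2 * c) *\<^sub>R a x"
    and left: "\<forall>x<0. aa x = (2 * r\<^sup>2 * c) *\<^sub>R b x \<and> bb x = - (2 * r\<^sup>2 / c) *\<^sub>R a x"
    and cont: "isCont a 0" "isCont b 0" "isCont a1 0" "isCont b1 0"
    and F: "integrable lborel F" and bd: "\<And>x. (norm (a x))\<^sup>2 \<le> F x" "\<And>x. (norm (b x))\<^sup>2 \<le> F x"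
  shows "2 *\<^sub>R a 0 = (1 / c - c) *\<^sub>R b 0" and "2 *\<^sub>R b 0 = (1 / c - c) *\<^sub>R a 0"
    and "\<And>x. x > 0 \<Longrightarrow> a x = exp (- r * x) *\<^sub>R (cos (r * x) *\<^sub>R a 0 + (sin (r * x) / c) *\<^sub>R b 0)"
    and "\<And>x. x > 0 \<Longrightarrow> b x = exp (- r * x) *\<^sub>R (cos (r * x) *\<^sub>R b 0 - (sin (r * x) * c) *\<^sub>R a 0)"
    and "\<And>x. x < 0 \<Longrightarrow> a x = exp (r * x) *\<^sub>R (cos (r * x) *\<^sub>R a 0 + (sin (r * x) * c) *\<^sub>R b 0)"
    and "\<And>x. x < 0 \<Longrightarrow> b x = exp (r * x) *\<^sub>R (cos (r * x) *\<^sub>R b 0 - (sin (r * x) / c) *\<^sub>R a 0)"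
proof -
  have d: "(a has_vector_derivative a1 x) (at x)" "(b has_vector_derivative b1 x) (at x)"
      "(a1 has_vector_derivative aa x) (at x)" "(b1 has_vector_derivative bb x) (at x)" if "x \<noteq> 0" for x
    using der that by auto
  have pos: "aa x = - (2 * r\<^sup>2 / c) *\<^sub>R b x" "bb x = (2 * r\<^sup>2 * c) *\<^sub>R a x" if "x > 0" for x
    using right that by auto
  have neg: "aa x = (2 * r\<^sup>2 * c) *\<^sub>R b x" "bb x = - (2 * r\<^sup>2 / c) *\<^sub>R a x" if "x < 0" for x
    using left that by auto
  have F0: "F x \<ge> 0" for x using order_trans[OF zero_le_power2 bd(1)] .
  \<comment> \<open>One dominating function for all three scalings \<open>1\<close>,
    \<open>c\<close> and \<open>1 / c\<close>.\<close>
  define K where "K = 1 + c\<^sup>2 + (1 / c)\<^sup>2"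
  have K: "1 \<le> K" "c\<^sup>2 \<le> K" "(1 / c)\<^sup>2 \<le> K" by (simp_all add: K_def)
  have KF: "(norm (k *\<^sub>R y))\<^sup>2 \<le> K * F x" if "k\<^sup>2 \<le> K" "(norm y)\<^sup>2 \<le> F x" for k x and y :: complex
  proof -
    have "(norm (k *\<^sub>R y))\<^sup>2 = k\<^sup>2 * (norm y)\<^sup>2" by (simp add: power_mult_distrib)
    also have "\<dots> \<le> K * F x" using that K F0 by (intro mult_mono) auto
    finally show ?thesis .
  qed
  have iK: "integrable lborel (\<lambda>x. K * F x)" using F by simp
  have iK': "integrable lborel (\<lambda>x. K * F (- x))"
    using lborel_integrable_real_affine[OF F, of "-1" 0] by simp
  have lim_right: "(h \<longlongrightarrow> h 0) (at_right 0)" if "isCont h 0" for h :: "real \<Rightarrow> complex"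
    using that unfolding isCont_def by (rule tendsto_within_subset) simp
  have lim_left: "((\<lambda>x. h (- x)) \<longlongrightarrow> h 0) (at_right 0)" if "isCont h 0" for h :: "real \<Rightarrow> complex"
  proof -
    have "isCont (\<lambda>x. h (- x)) 0" by (rule isCont_o2[where f = uminus]) (use that in auto)
    from lim_right[OF this] show ?thesis by simp
  qed
  note R = half_line_decay[of r a a1 "\<lambda>x. (1 / c) *\<^sub>R b x" "\<lambda>x. (1 / c) *\<^sub>R b1 x" "\<lambda>x. K * F x" "a 0" "(1 / c) *\<^sub>R b 0" "a1 0" "(1 / c) *\<^sub>R b1 0"]
  have sd: "((\<lambda>x. k *\<^sub>R h x) has_vector_derivative k *\<^sub>R h') (at x)" if "(h has_vector_derivative h') (at x)" for k h' x and h :: "real \<Rightarrow> complex"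
    using has_vector_derivative_scaleR[OF DERIV_const[of k] that] by simp
  have Rp: "r > 0" "\<And>x. x > 0 \<Longrightarrow> (a has_vector_derivative a1 x) (at x)"
    "\<And>x. x > 0 \<Longrightarrow> ((\<lambda>x. (1 / c) *\<^sub>R b x) has_vector_derivative (1 / c) *\<^sub>R b1 x) (at x)"
    "\<And>x. x > 0 \<Longrightarrow> (a1 has_vector_derivative - (2 * r\<^sup>2) *\<^sub>R ((1 / c) *\<^sub>R b x)) (at x)"
    "\<And>x. x > 0 \<Longrightarrow> ((\<lambda>x. (1 / c) *\<^sub>R b1 x) has_vector_derivative (2 * r\<^sup>2) *\<^sub>R a x) (at x)"
    "integrable lborel (\<lambda>x. K * F x)" "\<And>x. x > 0 \<Longrightarrow> (norm (a x))\<^sup>2 \<le> K * F x" "\<And>x. x > 0 \<Longrightarrow> (norm ((1 / c) *\<^sub>R b x))\<^sup>2 \<le> K * F x"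
    "(a \<longlongrightarrow> a 0) (at_right 0)" "((\<lambda>x. (1 / c) *\<^sub>R b x) \<longlongrightarrow> (1 / c) *\<^sub>R b 0) (at_right 0)"
    "(a1 \<longlongrightarrow> a1 0) (at_right 0)" "((\<lambda>x. (1 / c) *\<^sub>R b1 x) \<longlongrightarrow> (1 / c) *\<^sub>R b1 0) (at_right 0)"
  proof -
    fix x :: real assume x: "x > 0"
    show "(a has_vector_derivative a1 x) (at x)" using d x by simp
    show "((\<lambda>x. (1 / c) *\<^sub>R b x) has_vector_derivative (1 / c) *\<^sub>R b1 x) (at x)" using d x by (intro sd) simp
    show "(a1 has_vector_derivative - (2 * r\<^sup>2) *\<^sub>R ((1 / c) *\<^sub>R b x)) (at x)"
      using d(3)[of x] x unfolding pos(1)[OF x] by simp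
    have "((\<lambda>x. (1 / c) *\<^sub>R b1 x) has_vector_derivative (1 / c) *\<^sub>R bb x) (at x)" using d x by (intro sd) simp
    thus "((\<lambda>x. (1 / c) *\<^sub>R b1 x) has_vector_derivative (2 * r\<^sup>2) *\<^sub>R a x) (at x)"
      unfolding pos(2)[OF x] using c by simp
    show "(norm (a x))\<^sup>2 \<le> K * F x" using KF[of 1 "a x" x] K bd by simp
    show "(norm ((1 / c) *\<^sub>R b x))\<^sup>2 \<le> K * F x" by (intro KF K bd)
  qed (intro r iK lim_right cont tendsto_intros)+
  note R' = R[OF Rp]
  \<comment> \<open>The reflected pair is taken in the order \<open>c b\<close>, \<open>a\<close>,
    since the coefficients have changed places for \<open>x < 0\<close>.\<close>
  have Lp: "\<And>x. x > 0 \<Longrightarrow> ((\<lambda>x. c *\<^sub>R b (- x)) has_vector_derivative c *\<^sub>R - b1 (- x)) (at x)"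
    "\<And>x. x > 0 \<Longrightarrow> ((\<lambda>x. a (- x)) has_vector_derivative - a1 (- x)) (at x)"
    "\<And>x. x > 0 \<Longrightarrow> ((\<lambda>x. c *\<^sub>R - b1 (- x)) has_vector_derivative - (2 * r\<^sup>2) *\<^sub>R a (- x)) (at x)"
    "\<And>x. x > 0 \<Longrightarrow> ((\<lambda>x. - a1 (- x)) has_vector_derivative (2 * r\<^sup>2) *\<^sub>R (c *\<^sub>R b (- x))) (at x)"
    "\<And>x. x > 0 \<Longrightarrow> (norm (c *\<^sub>R b (- x)))\<^sup>2 \<le> K * F (- x)" "\<And>x. x > 0 \<Longrightarrow> (norm (a (- x)))\<^sup>2 \<le> K * F (- x)"
    "((\<lambda>x. c *\<^sub>R b (- x)) \<longlongrightarrow> c *\<^sub>R b 0) (at_right 0)" "((\<lambda>x. a (- x)) \<longlongrightarrow> a 0) (at_right 0)"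
    "((\<lambda>x. c *\<^sub>R - b1 (- x)) \<longlongrightarrow> c *\<^sub>R - b1 0) (at_right 0)" "((\<lambda>x. - a1 (- x)) \<longlongrightarrow> - a1 0) (at_right 0)"
  proof -
    fix x :: real assume x: "x > 0"
    show "((\<lambda>x. c *\<^sub>R b (- x)) has_vector_derivative c *\<^sub>R - b1 (- x)) (at x)"
      by (intro sd has_vector_derivative_mirror d) (use x in simp)
    show "((\<lambda>x. a (- x)) has_vector_derivative - a1 (- x)) (at x)"
      by (intro has_vector_derivative_mirror d) (use x in simp)
    have "((\<lambda>x. c *\<^sub>R - b1 (- x)) has_vector_derivative c *\<^sub>R - (- bb (- x))) (at x)"
      by (intro sd has_vector_derivative_minus has_vector_derivative_mirror d) (use x in simp)
    thus "((\<lambda>x. c *\<^sub>R - b1 (- x)) has_vector_derivative - (2 * r\<^sup>2) *\<^sub>R a (- x)) (at x)"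
      using neg(2)[of "- x"] x c by simp
    have "((\<lambda>x. - a1 (- x)) has_vector_derivative - (- aa (- x))) (at x)"
      by (intro has_vector_derivative_minus has_vector_derivative_mirror d) (use x in simp)
    thus "((\<lambda>x. - a1 (- x)) has_vector_derivative (2 * r\<^sup>2) *\<^sub>R (c *\<^sub>R b (- x))) (at x)"
      using neg(1)[of "- x"] x by simp
    show "(norm (c *\<^sub>R b (- x)))\<^sup>2 \<le> K * F (- x)" by (intro KF K bd)
    show "(norm (a (- x)))\<^sup>2 \<le> K * F (- x)" using KF[of 1 "a (- x)" "- x"] K bd by simp
  qed (intro lim_left cont tendsto_intros)+
  note L' = half_line_decay[OF r Lp(1-4) iK' Lp(5-10)]
  have Ra: "a x = exp (- r * x) *\<^sub>R (a 0 * of_real (cos (r * x)) + (1 / c) *\<^sub>R b 0 * of_real (sin (r * x)))"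
    and Rb: "(1 / c) *\<^sub>R b x = exp (- r * x) *\<^sub>R ((1 / c) *\<^sub>R b 0 * of_real (cos (r * x)) - a 0 * of_real (sin (r * x)))"
    if "x > 0" for x
    by (rule R'(1), use that in auto)[1] (rule R'(2), use that in auto)[1]
  have Lb: "c *\<^sub>R b (- x) = exp (- r * x) *\<^sub>R (c *\<^sub>R b 0 * of_real (cos (r * x)) + a 0 * of_real (sin (r * x)))"
    and La: "a (- x) = exp (- r * x) *\<^sub>R (a 0 * of_real (cos (r * x)) - c *\<^sub>R b 0 * of_real (sin (r * x)))"
    if "x > 0" for x
    by (rule L'(1), use that in auto)[1] (rule L'(2), use that in auto)[1]
  have c0: "c \<noteq> 0" using c by simp
  \<comment> \<open>The slope of \<open>a\<close> at 0, once from the right and once from the left;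
    the slope of \<open>b\<close> follows below.\<close>
  have "of_real r * ((1 / c) *\<^sub>R b 0 - a 0) = of_real r * (a 0 + c *\<^sub>R b 0)"
    using R'(3) L'(4) by (simp add: algebra_simps)
  hence "(1 / c) *\<^sub>R b 0 - a 0 = a 0 + c *\<^sub>R b 0" using r by simp
  thus "2 *\<^sub>R a 0 = (1 / c - c) *\<^sub>R b 0" by (simp add: algebra_simps scaleR_2)
  have "(1 / c) *\<^sub>R b1 0 = - of_real r * (a 0 + (1 / c) *\<^sub>R b 0)" by (rule R'(4))
  hence "c *\<^sub>R ((1 / c) *\<^sub>R b1 0) = c *\<^sub>R (- of_real r * (a 0 + (1 / c) *\<^sub>R b 0))" by simp
  moreover have "c *\<^sub>R (- of_real r * (a 0 + (1 / c) *\<^sub>R b 0)) = - of_real r * (c *\<^sub>R a 0 + b 0)"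
    using c0 by (simp add: algebra_simps)
  ultimately have b1: "b1 0 = - of_real r * (c *\<^sub>R a 0 + b 0)" using c0 by simp
  have "(1 / c) *\<^sub>R (c *\<^sub>R - b1 0) = (1 / c) *\<^sub>R (of_real r * (a 0 - c *\<^sub>R b 0))"
    using L'(3) by simp
  moreover have "(1 / c) *\<^sub>R (of_real r * (a 0 - c *\<^sub>R b 0)) = of_real r * ((1 / c) *\<^sub>R a 0 - b 0)"
    using c0 by (simp add: algebra_simps)
  ultimately have "- b1 0 = of_real r * ((1 / c) *\<^sub>R a 0 - b 0)" using c0 by simp
  hence "b1 0 = - of_real r * ((1 / c) *\<^sub>R a 0 - b 0)" by (metis minus_minus mult_minus_left)
  hence "of_real r * (c *\<^sub>R a 0 + b 0) = of_real r * ((1 / c) *\<^sub>R a 0 - b 0)" using b1 by simp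
  hence "c *\<^sub>R a 0 + b 0 = (1 / c) *\<^sub>R a 0 - b 0" using r by simp
  thus "2 *\<^sub>R b 0 = (1 / c - c) *\<^sub>R a 0" by (simp add: algebra_simps scaleR_2)
  show "a x = exp (- r * x) *\<^sub>R (cos (r * x) *\<^sub>R a 0 + (sin (r * x) / c) *\<^sub>R b 0)" if "x > 0" for x
    using Ra[OF that] by (simp add: scaleR_conv_of_real mult_ac)
  show "b x = exp (- r * x) *\<^sub>R (cos (r * x) *\<^sub>R b 0 - (sin (r * x) * c) *\<^sub>R a 0)" if "x > 0" for x
  proof -
    have "b x = c *\<^sub>R ((1 / c) *\<^sub>R b x)" using c0 by simp
    also have "\<dots> = exp (- r * x) *\<^sub>R (cos (r * x) *\<^sub>R b 0 - (sin (r * x) * c) *\<^sub>R a 0)"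
      unfolding Rb[OF that] using c0 by (simp add: scaleR_conv_of_real field_simps)
    finally show ?thesis .
  qed
  show "a x = exp (r * x) *\<^sub>R (cos (r * x) *\<^sub>R a 0 + (sin (r * x) * c) *\<^sub>R b 0)" if "x < 0" for x
    using La[of "- x"] that by (simp add: scaleR_conv_of_real mult_ac)
  show "b x = exp (r * x) *\<^sub>R (cos (r * x) *\<^sub>R b 0 - (sin (r * x) / c) *\<^sub>R a 0)" if "x < 0" for x
  proof -
    have "b x = (1 / c) *\<^sub>R (c *\<^sub>R b x)" using c0 by simp
    also have "\<dots> = exp (r * x) *\<^sub>R (cos (r * x) *\<^sub>R b 0 - (sin (r * x) / c) *\<^sub>R a 0)"
      using Lb[of "- x"] that c0 by (simp add: scaleR_conv_of_real field_simps)
    finally show ?thesis .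
  qed
qed

text \<open>The way back from the matrix equation to the system, now for complex components: a
  matched solution is not known to be a multiple of a real profile in advance.\<close>

lemma component_equations:
  fixes d x :: "complex^2"
  assumes nz: "\<alpha>2 \<noteq> 0" "\<theta> \<noteq> 0"
    and eq: "(- \<alpha>2) *\<^sub>R (sigma2 *v (- d)) + (\<theta> * y) *\<^sub>R (sigma3 *v x) = \<Omega> *\<^sub>R x"
  shows "d $ 1 = - (\<bar>\<theta>\<bar> / \<bar>\<alpha>2\<bar> * (y + \<Omega> / \<theta>)) *\<^sub>R (\<i> * of_real (sgn (\<alpha>2 * \<theta>)) * x $ 2)"
    and "\<i> * of_real (sgn (\<alpha>2 * \<theta>)) * d $ 2 = (\<bar>\<theta>\<bar> / \<bar>\<alpha>2\<bar> * (y - \<Omega> / \<theta>)) *\<^sub>R x $ 1"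
proof -
  define l s \<rho> where "l = \<bar>\<theta>\<bar> / \<bar>\<alpha>2\<bar>" and "s = sgn (\<alpha>2 * \<theta>)" and "\<rho> = \<Omega> / \<theta>"
  have ss: "s * s = 1" unfolding s_def by (rule sgn_coupling(2)[OF nz])
  have "\<alpha>2 * s = \<theta> / l" unfolding s_def l_def by (rule sgn_coupling(1)[OF nz])
  moreover have "l > 0" unfolding l_def by (rule pair_positive[OF nz])
  ultimately have \<theta>: "\<theta> = l * \<alpha>2 * s" by (simp add: mult.assoc)
  have \<Omega>: "\<Omega> = \<rho> * \<theta>" using nz by (simp add: \<rho>_def)
  from arg_cong[OF eq, of "\<lambda>v. v $ 1"] arg_cong[OF eq, of "\<lambda>v. v $ 2"]
  have c: "- (\<alpha>2 *\<^sub>R (\<i> * d $ 2)) + (\<theta> * y) *\<^sub>R x $ 1 = \<Omega> *\<^sub>R x $ 1"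
    "\<alpha>2 *\<^sub>R (\<i> * d $ 1) - (\<theta> * y) *\<^sub>R x $ 2 = \<Omega> *\<^sub>R x $ 2"
    by (simp_all add: sigma2_mult sigma3_mult vector_2)
  have "\<alpha>2 *\<^sub>R (\<i> * d $ 2) = \<alpha>2 *\<^sub>R ((l * s * (y - \<rho>)) *\<^sub>R x $ 1)"
    using c(1) unfolding \<Omega> unfolding \<theta> by (simp add: algebra_simps)
  hence 1: "\<i> * d $ 2 = (l * s * (y - \<rho>)) *\<^sub>R x $ 1" by (rule scaleR_left_imp_eq[OF nz(1)])
  have "\<alpha>2 *\<^sub>R (\<i> * d $ 1) = \<alpha>2 *\<^sub>R ((l * s * (y + \<rho>)) *\<^sub>R x $ 2)"
    using c(2) unfolding \<Omega> unfolding \<theta> by (simp add: algebra_simps)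
  hence 2: "\<i> * d $ 1 = (l * s * (y + \<rho>)) *\<^sub>R x $ 2" by (rule scaleR_left_imp_eq[OF nz(1)])
  have "\<i> * of_real s * d $ 2 = s *\<^sub>R (\<i> * d $ 2)" by (simp add: scaleR_conv_of_real mult_ac)
  also have "\<dots> = ((s * s) * (l * (y - \<rho>))) *\<^sub>R x $ 1" unfolding 1 by (simp add: mult_ac)
  finally show "\<i> * of_real (sgn (\<alpha>2 * \<theta>)) * d $ 2 = (\<bar>\<theta>\<bar> / \<bar>\<alpha>2\<bar> * (y - \<Omega> / \<theta>)) *\<^sub>R x $ 1"
    unfolding ss by (simp add: l_def s_def \<rho>_def)
  have "d $ 1 = - \<i> * (\<i> * d $ 1)" by (simp flip: mult.assoc)
  also have "\<dots> = - (l * (y + \<rho>)) *\<^sub>R (\<i> * of_real s * x $ 2)" unfolding 2 by (simp add: scaleR_conv_of_real mult_ac)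
  finally show "d $ 1 = - (\<bar>\<theta>\<bar> / \<bar>\<alpha>2\<bar> * (y + \<Omega> / \<theta>)) *\<^sub>R (\<i> * of_real (sgn (\<alpha>2 * \<theta>)) * x $ 2)"
    by (simp add: l_def s_def \<rho>_def)
qed

lemma bound_profile_cases:
  "x > 0 \<Longrightarrow> bound_profile k x = exp (- k * x) * ((sqrt 2 - 1) * cos (k * x) + sin (k * x))"
  "x > 0 \<Longrightarrow> bound_profile k (- x) = (sqrt 2 - 1) * exp (- k * x) * (cos (k * x) - (sqrt 2 - 1) * sin (k * x))"
  "x < 0 \<Longrightarrow> bound_profile k x = (sqrt 2 - 1) * exp (k * x) * (cos (k * x) + (sqrt 2 - 1) * sin (k * x))"
  "x < 0 \<Longrightarrow> bound_profile k (- x) = exp (k * x) * ((sqrt 2 - 1) * cos (k * x) - sin (k * x))"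
  "bound_profile k 0 = sqrt 2 - 1"
  by (simp_all add: bound_profile_def Let_def)

text \<open>The matching relations force \<open>(1 / c - c)\<^sup>2 = 4\<close> unless the solution
  vanishes. Each sign of the root fixes \<open>c\<close>, with it \<open>\<rho>\<close> and the
  decay rate, and leaves one free complex constant.\<close>

lemma matched_solution_unique:
  assumes nz: "\<alpha>2 \<noteq> 0" "\<theta> \<noteq> 0" and gap: "\<Omega> \<in> spectral_gap \<theta>"
    and L2: "\<psi> \<in> L2" and n0: "\<psi> \<noteq> (\<lambda>X. 0)" and m: "matched_solution \<alpha>2 \<theta> \<Omega> \<psi>"
  shows "\<exists>c. c \<noteq> 0 \<and>
            ((\<Omega> = \<theta> / sqrt 2 \<and> \<psi> = (\<lambda>X. c *s bound_state_1 \<alpha>2 \<theta> X)) \<or>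
             (\<Omega> = - \<theta> / sqrt 2 \<and> \<psi> = (\<lambda>X. c *s bound_state_2 \<alpha>2 \<theta> X)))"
proof -
  define l \<sigma> \<rho> where "l = \<bar>\<theta>\<bar> / \<bar>\<alpha>2\<bar>" and "\<sigma> = complex_of_real (sgn (\<alpha>2 * \<theta>))" and "\<rho> = \<Omega> / \<theta>"
  have l: "l > 0" unfolding l_def by (rule pair_positive[OF nz])
  have \<sigma>: "\<sigma> * \<sigma> = 1" unfolding \<sigma>_def using sgn_coupling(2)[OF nz] by (simp flip: of_real_mult)
  have "\<bar>\<Omega>\<bar> < \<bar>\<theta>\<bar>" using gap by (auto simp: spectral_gap_def abs_less_iff)
  hence "\<bar>\<rho>\<bar> < 1" using nz by (simp add: \<rho>_def)
  hence \<rho>: "1 + \<rho> > 0" "1 - \<rho> > 0" by auto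
  from m obtain f1 f2 where d: "\<And>X. X \<noteq> 0 \<Longrightarrow> (\<psi> has_vector_derivative f1 X) (at X)"
      "\<And>X. X \<noteq> 0 \<Longrightarrow> (f1 has_vector_derivative f2 X) (at X)"
    and e: "\<And>X. X > 0 \<Longrightarrow> (- \<alpha>2) *\<^sub>R (sigma2 *v (- f2 X)) + \<theta> *\<^sub>R (sigma3 *v \<psi> X) = \<Omega> *\<^sub>R \<psi> X"
      "\<And>X. X < 0 \<Longrightarrow> (- \<alpha>2) *\<^sub>R (sigma2 *v (- f2 X)) - \<theta> *\<^sub>R (sigma3 *v \<psi> X) = \<Omega> *\<^sub>R \<psi> X"
    and cont: "isCont \<psi> 0" "isCont f1 0"
    unfolding matched_solution_def by blast
  \<comment> \<open>Symmetrization: this ratio and the rate \<open>r\<close> below give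
    \<open>2 r\<^sup>2 / c = l (1 + \<rho>)\<close> and
    \<open>2 r\<^sup>2 c = l (1 - \<rho>)\<close>. Being in the gap makes both factors positive, so
    the exponents are \<open>1 + i\<close> and \<open>1 - i\<close> times a real rate, up to
    sign.\<close>
  define c where "c = sqrt ((1 - \<rho>) / (1 + \<rho>))"
  define r where "r = sqrt (l * c * (1 + \<rho>) / 2)"
  have c: "c > 0" "c\<^sup>2 * (1 + \<rho>) = 1 - \<rho>" using \<rho> by (simp_all add: c_def)
  have r: "r > 0" "2 * r\<^sup>2 = l * c * (1 + \<rho>)" using l c \<rho> by (simp_all add: r_def)
  have k: "2 * r\<^sup>2 / c = l * (1 + \<rho>)" "2 * r\<^sup>2 * c = l * (1 - \<rho>)"
    unfolding r(2) c(2)[symmetric] using c(1) by (simp_all add: power2_eq_square mult_ac)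
  let ?a = "\<lambda>X. \<psi> X $ 1" and ?b = "\<lambda>X. \<i> * \<sigma> * \<psi> X $ 2"
  have e': "f2 X $ 1 = - (2 * r\<^sup>2 / c) *\<^sub>R ?b X" "\<i> * \<sigma> * f2 X $ 2 = (2 * r\<^sup>2 * c) *\<^sub>R ?a X" if "X > 0" for X
    using component_equations[OF nz, of "f2 X" 1 "\<psi> X" \<Omega>] e(1)[OF that] unfolding k
    by (simp_all add: l_def \<sigma>_def \<rho>_def)
  have e'': "f2 X $ 1 = (2 * r\<^sup>2 * c) *\<^sub>R ?b X" "\<i> * \<sigma> * f2 X $ 2 = - (2 * r\<^sup>2 / c) *\<^sub>R ?a X" if "X < 0" for X
  proof -
    have s: "- (l * (- 1 + \<rho>)) = l * (1 - \<rho>)" "l * (- 1 - \<rho>) = - (l * (1 + \<rho>))" by (simp_all add: algebra_simps)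
    show "f2 X $ 1 = (2 * r\<^sup>2 * c) *\<^sub>R ?b X" "\<i> * \<sigma> * f2 X $ 2 = - (2 * r\<^sup>2 / c) *\<^sub>R ?a X"
      using component_equations[OF nz, of "f2 X" "- 1" "\<psi> X" \<Omega>] e(2)[OF that] 
      unfolding k s[symmetric] by (simp_all add: l_def \<sigma>_def \<rho>_def)
  qed
  have nth: "((\<lambda>X. f X $ i) has_vector_derivative f' $ i) F" if "(f has_vector_derivative f') F"
    for f and f' :: "complex^2" and i F
    by (rule bounded_linear.has_vector_derivative[OF bounded_linear_vec_nth that])
  have cnth: "isCont (\<lambda>X. f X $ i) 0" if "isCont f 0" for f :: "real \<Rightarrow> complex^2" and i
    by (rule bounded_linear.isCont[OF bounded_linear_vec_nth that])
  have \<sigma>n: "norm \<sigma> = 1"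
  proof -
    have "norm \<sigma> * norm \<sigma> = 1" using arg_cong[OF \<sigma>, of norm] by (simp add: norm_mult)
    thus ?thesis using norm_ge_zero[of \<sigma>] by (metis abs_of_nonneg abs_one power2_eq_iff_nonneg power2_eq_square mult_1 zero_le_one)
  qed
  note M = matched_components[of c r ?a "\<lambda>X. f1 X $ 1" ?b "\<lambda>X. \<i> * \<sigma> * f1 X $ 2" "\<lambda>X. f2 X $ 1"
     "\<lambda>X. \<i> * \<sigma> * f2 X $ 2" "\<lambda>X. (norm (\<psi> X))\<^sup>2"]
  have Mp: "\<forall>x. x \<noteq> 0 \<longrightarrow> (?a has_vector_derivative f1 x $ 1) (at x) \<and>
      (?b has_vector_derivative \<i> * \<sigma> * f1 x $ 2) (at x) \<and>
      ((\<lambda>X. f1 X $ 1) has_vector_derivative f2 x $ 1) (at x) \<and>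
      ((\<lambda>X. \<i> * \<sigma> * f1 X $ 2) has_vector_derivative \<i> * \<sigma> * f2 x $ 2) (at x)"
    by (intro allI impI conjI has_vector_derivative_mult_right nth d)
  have Me: "\<forall>x>0. f2 x $ 1 = - (2 * r\<^sup>2 / c) *\<^sub>R ?b x \<and> \<i> * \<sigma> * f2 x $ 2 = (2 * r\<^sup>2 * c) *\<^sub>R ?a x"
    "\<forall>x<0. f2 x $ 1 = (2 * r\<^sup>2 * c) *\<^sub>R ?b x \<and> \<i> * \<sigma> * f2 x $ 2 = - (2 * r\<^sup>2 / c) *\<^sub>R ?a x"
    using e' e'' by blast+
  have Mc: "isCont ?a 0" "isCont ?b 0" "isCont (\<lambda>X. f1 X $ 1) 0" "isCont (\<lambda>X. \<i> * \<sigma> * f1 X $ 2) 0"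
    by (intro continuous_intros cnth cont)+
  have Mi: "integrable lborel (\<lambda>X. (norm (\<psi> X))\<^sup>2)" using L2 by (simp add: L2_def)
  have Mb: "(norm (?a x))\<^sup>2 \<le> (norm (\<psi> x))\<^sup>2" "(norm (?b x))\<^sup>2 \<le> (norm (\<psi> x))\<^sup>2" for x
    using Finite_Cartesian_Product.norm_nth_le[of "\<psi> x"] \<sigma>n by (auto simp: norm_mult intro!: power_mono)
  note M' = M[OF c(1) r(1) Mp Me Mc Mi Mb]
  define a0 b0 where "a0 = ?a 0" and "b0 = ?b 0"
  note M'' = M'[folded a0_def b0_def]
  have \<psi>2: "\<psi> X $ 2 = - \<i> * \<sigma> * ?b X" for X
  proof -
    have "- \<i> * \<sigma> * ?b X = - (\<i> * \<i>) * (\<sigma> * \<sigma>) * \<psi> X $ 2" by algebra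
    thus ?thesis unfolding \<sigma> by simp
  qed
  \<comment> \<open>The solution is given explicitly by its components at 0, and
    \<open>a0 = 0\<close> entails \<open>b0 = 0\<close>.\<close>
  have "a0 \<noteq> 0"
  proof
    assume a0: "a0 = 0"
    hence b0: "b0 = 0" using M''(2) by simp
    have "\<psi> X = 0" for X
    proof -
      have "?a X = 0 \<and> ?b X = 0"
      proof (cases X "0::real" rule: linorder_cases)
        case less
        thus ?thesis using M''(5,6)[OF less] unfolding a0 b0 by simp
      next
        case equal
        thus ?thesis using a0 b0 unfolding a0_def b0_def by simp
      next
        case greater
        thus ?thesis using M''(3,4)[OF greater] unfolding a0 b0 by simp
      qed
      hence z: "?a X = 0" "?b X = 0" by auto
      have "\<psi> X $ 2 = - \<i> * \<sigma> * 0" using \<psi>2[of X] unfolding z(2) .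
      thus ?thesis using z(1) by (simp add: vec_eq_iff forall_2)
    qed
    thus False using n0 by auto
  qed
  define D where "D = 1 / c - c"
  have "4 *\<^sub>R a0 = 2 *\<^sub>R (2 *\<^sub>R a0)" by simp
  also have "\<dots> = D *\<^sub>R (2 *\<^sub>R b0)" unfolding M''(1) D_def by (simp add: mult.commute)
  also have "\<dots> = (D * D) *\<^sub>R a0" unfolding M''(2) D_def by simp
  finally have "(4 - D * D) *\<^sub>R a0 = 0" by (simp add: algebra_simps)
  hence "D * D = 2 * 2" using \<open>a0 \<noteq> 0\<close> by simp
  hence D: "D = 2 \<or> D = - 2" using square_eq_iff[of D 2] by simp
  note s2 = sqrt2_mult
  define \<delta> where "\<delta> = sqrt 2 - 1"
  have \<delta>: "\<delta> > 0" "\<delta> * (sqrt 2 + 1) = 1" using sqrt2_bounds by (simp_all add: \<delta>_def algebra_simps)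
  define \<kappa> where "\<kappa> = decay_rate \<alpha>2 \<theta>"
  have \<kappa>: "\<kappa> > 0" "2 * sqrt 2 * \<kappa>\<^sup>2 = l" unfolding \<kappa>_def l_def by (rule decay_rate_props[OF nz])+
  \<comment> \<open>From \<open>c\<^sup>2 (1 + \<rho>) = 1 - \<rho>\<close> the quantity
    \<open>c (1 + \<rho>)\<close> is \<open>sqrt (1 - \<rho>\<^sup>2)\<close>, which is
    \<open>1 / sqrt 2\<close> at both eigenvalues; hence they share one rate.\<close>
  have rk: "r = \<kappa>" if "c * (1 + \<rho>) = 1 / sqrt 2"
  proof -
    have "2 * r\<^sup>2 = l * (1 / sqrt 2)" using r(2) that by (simp add: mult.assoc)
    also have "\<dots> = 2 * \<kappa>\<^sup>2" unfolding \<kappa>(2)[symmetric] by simp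
    finally show ?thesis using r(1) \<kappa>(1) by simp
  qed
  have i2: "1 / sqrt 2 = sqrt 2 / 2" by (simp add: field_simps)
  \<comment> \<open>\<open>bound_profile\<close> equals \<open>\<delta>\<close> at 0, so dividing by
    \<open>\<delta>\<close> gives the multiple.\<close>
  define C where "C = of_real (1 / \<delta>) * a0"
  have a0C: "a0 = of_real \<delta> * C" using \<delta> by (simp add: C_def)
  have C0: "C \<noteq> 0" using a0C \<open>a0 \<noteq> 0\<close> by auto
  from D show ?thesis
  proof
    \<comment> \<open>Now \<open>c\<^sup>2 + 2 c = 1\<close>, with positive root
      \<open>sqrt 2 - 1\<close>.\<close>
    assume D2: "D = 2"
    have "1 = c * (c + 2)" using D2 c(1) by (simp add: D_def field_simps)
    hence "(c + 1)\<^sup>2 = 2" by (simp add: power2_eq_square algebra_simps)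
    hence "sqrt 2 = c + 1" using c(1) by (intro real_sqrt_unique) auto
    hence cd: "c = \<delta>" by (simp add: \<delta>_def)
    have b0: "b0 = a0" using M''(1) D2 unfolding D_def by simp
    have rho: "\<rho> = 1 / sqrt 2"
    proof -
      have "(4 - 2 * sqrt 2) * (\<rho> - 1 / sqrt 2) = 0"
        using c(2) unfolding cd \<delta>_def i2 by (simp add: power2_eq_square algebra_simps s2)
      thus ?thesis using sqrt2_bounds by simp
    qed
    with nz have \<Omega>: "\<Omega> = \<theta> / sqrt 2" by (simp add: \<rho>_def field_simps)
    have "c * (1 + \<rho>) = 1 / sqrt 2"
      unfolding rho cd \<delta>_def i2 by (simp add: field_simps s2)
    note rk = rk[OF this]
    note rep = M''(3-6)[unfolded b0 rk cd, unfolded a0C]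
    have A: "?a X = C * of_real (bound_profile \<kappa> X) \<and> ?b X = C * of_real (bound_profile \<kappa> (- X))" for X
    proof (cases "X = 0")
      case True
      have "?a X = a0" "?b X = b0" by (simp_all add: True a0_def b0_def)
      moreover have "bound_profile \<kappa> X = \<delta>" "bound_profile \<kappa> (- X) = \<delta>"
        using True bound_profile_cases(5)[of \<kappa>] by (simp_all add: \<delta>_def)
      ultimately show ?thesis unfolding b0 a0C by simp
    next
      case False
      show ?thesis
      proof (cases "X > 0")
        case True
        show ?thesis unfolding rep(1,2)[OF True] bound_profile_cases(1,2)[OF True] \<delta>_def[symmetric]
          using \<delta>(1) by (simp add: scaleR_conv_of_real field_simps)
      next
        case False
        hence X: "X < 0" using \<open>X \<noteq> 0\<close> by simp
        show ?thesis unfolding rep(3,4)[OF X] bound_profile_cases(3,4)[OF X] \<delta>_def[symmetric]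
          using \<delta>(1) by (simp add: scaleR_conv_of_real field_simps)
      qed
    qed
    have "\<psi> X = C *s bound_state_1 \<alpha>2 \<theta> X" for X
      using A[of X] \<psi>2[of X]
      by (simp add: vec_eq_iff forall_2 bound_state_1_def Let_def vector_2 \<kappa>_def \<sigma>_def)
    thus ?thesis using C0 \<Omega> by blast
  next
    \<comment> \<open>Now \<open>c\<^sup>2 - 2 c = 1\<close>, with positive root
      \<open>sqrt 2 + 1 = 1 / \<delta>\<close>; the inverted \<open>c\<close> exchanges the two
      profiles.\<close>
    assume D2: "D = - 2"
    have "1 = c * (c - 2)" using D2 c(1) by (simp add: D_def field_simps)
    hence c1: "(c - 1)\<^sup>2 = 2" "c > 2"
    proof -
      show "(c - 1)\<^sup>2 = 2" using \<open>1 = c * (c - 2)\<close> by (simp add: power2_eq_square algebra_simps)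
      have "c * (c - 2) > 0" using \<open>1 = c * (c - 2)\<close> by simp
      thus "c > 2" using c(1) by (simp add: zero_less_mult_iff)
    qed
    hence "sqrt 2 = c - 1" by (intro real_sqrt_unique) auto
    hence cd: "c = sqrt 2 + 1" by simp
    hence cd': "c = 1 / \<delta>" using \<delta> by (simp add: field_simps)
    have b0: "b0 = - a0" using M''(2) D2 unfolding D_def by (simp add: scaleR_2 flip: minus_add_distrib)
    have rho: "\<rho> = - (1 / sqrt 2)"
    proof -
      have "(4 + 2 * sqrt 2) * (\<rho> + 1 / sqrt 2) = 0"
        using c(2) unfolding cd i2 by (simp add: power2_eq_square algebra_simps s2)
      moreover have "4 + 2 * sqrt 2 \<noteq> (0::real)" using sqrt2_bounds by linarith
      ultimately show ?thesis by simp
    qed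
    with nz have \<Omega>: "\<Omega> = - \<theta> / sqrt 2" by (simp add: \<rho>_def field_simps)
    have "c * (1 + \<rho>) = 1 / sqrt 2"
      unfolding rho cd i2 by (simp add: field_simps s2)
    note rk = rk[OF this]
    note rep = M''(3-6)[unfolded b0 rk cd', unfolded a0C]
    have A: "?a X = C * of_real (bound_profile \<kappa> (- X)) \<and> ?b X = - C * of_real (bound_profile \<kappa> X)" for X
    proof (cases "X = 0")
      case True
      have "?a X = a0" "?b X = b0" by (simp_all add: True a0_def b0_def)
      moreover have "bound_profile \<kappa> X = \<delta>" "bound_profile \<kappa> (- X) = \<delta>"
        using True bound_profile_cases(5)[of \<kappa>] by (simp_all add: \<delta>_def)
      ultimately show ?thesis unfolding b0 a0C by simp
    next
      case False
      show ?thesis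
      proof (cases "X > 0")
        case True
        show ?thesis unfolding rep(1,2)[OF True] bound_profile_cases(1,2)[OF True] \<delta>_def[symmetric]
          using \<delta>(1) by (simp add: scaleR_conv_of_real field_simps)
      next
        case False
        hence X: "X < 0" using \<open>X \<noteq> 0\<close> by simp
        show ?thesis unfolding rep(3,4)[OF X] bound_profile_cases(3,4)[OF X] \<delta>_def[symmetric]
          using \<delta>(1) by (simp add: scaleR_conv_of_real field_simps)
      qed
    qed
    \<comment> \<open>The first component of \<open>bound_state_2\<close> carries
      \<open>- i \<sigma>\<close>, and \<open>i \<sigma>\<close> is its inverse because
      \<open>\<sigma> * \<sigma> = 1\<close>.\<close>
    have "\<psi> X = (\<i> * \<sigma> * C) *s bound_state_2 \<alpha>2 \<theta> X" for X
    proof -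
      have "\<psi> X $ 1 = (\<i> * \<sigma> * C) * (- \<i> * (\<sigma> * of_real (bound_profile \<kappa> (- X))))"
        using A[of X] \<sigma> by (simp add: mult_ac)
      moreover have "\<psi> X $ 2 = (\<i> * \<sigma> * C) * of_real (bound_profile \<kappa> X)"
      proof -
        have "\<psi> X $ 2 = - \<i> * \<sigma> * ?b X" by (rule \<psi>2)
        also have "\<dots> = - \<i> * \<sigma> * (- C * of_real (bound_profile \<kappa> X))"
          by (simp only: A[THEN conjunct2])
        finally show ?thesis by simp
      qed
      ultimately show ?thesis
        by (simp add: vec_eq_iff forall_2 bound_state_2_def Let_def vector_2 \<kappa>_def \<sigma>_def)
    qed
    moreover have "\<i> * \<sigma> * C \<noteq> 0" using C0 \<sigma> by auto
    ultimately show ?thesis using \<Omega> by blast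
  qed
qed

theorem theorem7p6:
  fixes \<alpha>2 \<theta> :: real
  assumes "\<alpha>2 \<noteq> 0" and "\<theta> \<noteq> 0"
  shows
    "(\<forall>w. domain_wall w \<longrightarrow>
        (\<exists>\<epsilon>0>0. \<forall>\<epsilon>. 0 < \<epsilon> \<and> \<epsilon> < \<epsilon>0 \<longrightarrow>
          (\<exists>\<Omega>. \<Omega> > 0 \<and> \<Omega> \<in> spectral_gap \<theta> \<and> - \<Omega> \<in> spectral_gap \<theta> \<and>
             eigenvalue (S_op \<alpha>2 \<theta> (\<lambda>X. w (X / \<epsilon>))) \<Omega> \<and>
             eigenvalue (S_op \<alpha>2 \<theta> (\<lambda>X. w (X / \<epsilon>))) (- \<Omega>))))
     \<and>
     (\<theta> / sqrt 2 \<in> spectral_gap \<theta> \<and> - \<theta> / sqrt 2 \<in> spectral_gap \<theta> \<and>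
      \<theta> / sqrt 2 \<noteq> - \<theta> / sqrt 2 \<and>
      eigenpair (S_op \<alpha>2 \<theta> sgn) (\<theta> / sqrt 2) (bound_state_1 \<alpha>2 \<theta>) \<and>
      eigenpair (S_op \<alpha>2 \<theta> sgn) (- \<theta> / sqrt 2) (bound_state_2 \<alpha>2 \<theta>) \<and>
      (\<forall>\<Omega> \<in> spectral_gap \<theta>. \<forall>\<psi>.
         (\<psi> \<in> L2 \<and> \<psi> \<noteq> (\<lambda>X. 0) \<and> matched_solution \<alpha>2 \<theta> \<Omega> \<psi>) \<longleftrightarrow>
         (\<exists>c. c \<noteq> 0 \<and>
            ((\<Omega> = \<theta> / sqrt 2 \<and> \<psi> = (\<lambda>X. c *s bound_state_1 \<alpha>2 \<theta> X)) \<or>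
             (\<Omega> = - \<theta> / sqrt 2 \<and> \<psi> = (\<lambda>X. c *s bound_state_2 \<alpha>2 \<theta> X))))))"
proof -
  note solve = bound_states_solve[OF assms]
  have "\<bar>\<theta> / sqrt 2\<bar> < \<bar>\<theta>\<bar>" using assms(2) by (simp add: abs_divide divide_less_eq)
  hence gap: "\<theta> / sqrt 2 \<in> spectral_gap \<theta>" "- \<theta> / sqrt 2 \<in> spectral_gap \<theta>"
    unfolding spectral_gap_def greaterThanLessThan_iff minus_divide_left[symmetric] abs_less_iff
    by (intro conjI; linarith)+
  have ne: "\<theta> / sqrt 2 \<noteq> - \<theta> / sqrt 2" using assms(2) by (simp add: field_simps)
  \<comment> \<open>The converse half of the classification; square integrability and nonvanishing
    are inherited from the eigenpairs.\<close>
  have scaled: "(\<lambda>X. c *s \<phi> X) \<in> L2 \<and> (\<lambda>X. c *s \<phi> X) \<noteq> (\<lambda>X. 0) \<and> matched_solution \<alpha>2 \<theta> \<Omega> (\<lambda>X. c *s \<phi> X)"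
    if "c \<noteq> 0" and e: "eigenpair (S_op \<alpha>2 \<theta> sgn) \<Omega> \<phi>" and m: "matched_solution \<alpha>2 \<theta> \<Omega> \<phi>" for c \<Omega> \<phi>
  proof (intro conjI)
    have "\<phi> \<in> L2" using e by (auto simp: eigenpair_def S_op_def momentum_def)
    thus "(\<lambda>X. c *s \<phi> X) \<in> L2" by (rule L2_smult)
    have "\<exists>X. \<phi> X \<noteq> 0" using e by (auto simp: eigenpair_def)
    thus "(\<lambda>X. c *s \<phi> X) \<noteq> (\<lambda>X. 0)" using \<open>c \<noteq> 0\<close> by (auto simp: fun_eq_iff vec_eq_iff)
    show "matched_solution \<alpha>2 \<theta> \<Omega> (\<lambda>X. c *s \<phi> X)" by (rule matched_solution_smult[OF m])
  qed
  have "(\<psi> \<in> L2 \<and> \<psi> \<noteq> (\<lambda>X. 0) \<and> matched_solution \<alpha>2 \<theta> \<Omega> \<psi>) \<longleftrightarrow>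
         (\<exists>c. c \<noteq> 0 \<and>
            ((\<Omega> = \<theta> / sqrt 2 \<and> \<psi> = (\<lambda>X. c *s bound_state_1 \<alpha>2 \<theta> X)) \<or>
             (\<Omega> = - \<theta> / sqrt 2 \<and> \<psi> = (\<lambda>X. c *s bound_state_2 \<alpha>2 \<theta> X))))"
    (is "?L \<longleftrightarrow> (\<exists>c. ?R c)") if "\<Omega> \<in> spectral_gap \<theta>" for \<Omega> \<psi>
  proof
    assume ?L
    thus "\<exists>c. ?R c" by (intro matched_solution_unique[OF assms that]) simp_all
  next
    assume "\<exists>c. ?R c"
    then obtain c where c: "?R c" ..
    from c show ?L
      by (elim conjE disjE) (simp_all only: scaled[OF _ solve(1,3)] scaled[OF _ solve(2,4)] not_False_eq_True simp_thms)
  qed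
  thus ?thesis
    by (intro conjI allI impI ballI steep_eigenvalues[OF assms] gap ne solve(1,2))
qed

end
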